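(* Let $K$ be a field, $S=K[t_1,\dots,t_s]$, and let $(0)\ne I\subset S$ be an unmixed graded ideal of height $c$, minimally generated by forms of degree $e\ge2$, whose associated primes are generated by linear forms. Then $$\mathrm{hyp}_I(1)\le e^{c-1}$$ and $\delta_I(1)\ge\deg(S/I)-e^{c-1}$. Furthermore, $\delta_I(1)\ge e^c-e^{c-1}$ if $I$ is a complete intersection.
   Context: $S=\bigoplus_{d\ge0}S_d$ has the standard grading; $K$ is arbitrary. An ideal is unmixed if it is proper and all its associated primes have the same height. A complete intersection is an ideal $I$ that can be generated by $\mathrm{ht}(I)$ elements. "Minimally generated by forms of degree $e$" means that all minimal homogeneous generators of $I$ have degree $e$. With $H_I(d)=\dim_K(S_d/I_d)$ and $k=\dim(S/I)$, $\deg(S/I)=(k-1)!\lim_{d\to\infty}H_I(d)/d^{k-1}$ if $k\ge1$ and $\dim_K(S/I)$ if $k=0$. For $d\ge1$ let $\mathcal F_d$ be the set of $f\in S_d\setminus I$ with $(I:f)\ne I$. Put $\mathrm{hyp}_I(d)=\max\{\deg(S/(I,f)): f\in\mathcal F_d\}$ if $\mathcal F_d\ne\emptyset$ and $\mathrm{hyp}_I(d)=0$ otherwise; $\delta_I(d)=\deg(S/I)-\mathrm{hyp}_I(d)$. *)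

theory Defs
  imports Complex_Main "HOL-Library.Poly_Mapping" "HOL-Library.Extended_Nat"
begin

section \<open>Ideals of a commutative ring\<close>

text \<open>
  Ideals are the submodules of the ring over itself, and \<^term>\<open>module.span (*) A\<close> is the
  ideal generated by \<^term>\<open>A\<close>.
\<close>

lemma module_times: "module ((*) :: 'a::comm_ring_1 \<Rightarrow> 'a \<Rightarrow> 'a)"
  by unfold_locales (simp_all add: algebra_simps)

definition is_ideal :: "'a::comm_ring_1 set \<Rightarrow> bool" where
  "is_ideal I \<longleftrightarrow> module.subspace (*) I"

definition ideal_gen :: "'a::comm_ring_1 set \<Rightarrow> 'a set" where
  "ideal_gen A = module.span (*) A"

definition is_prime_ideal :: "'a::comm_ring_1 set \<Rightarrow> bool" where
  "is_prime_ideal P \<longleftrightarrow>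
     is_ideal P \<and> P \<noteq> UNIV \<and> (\<forall>a b. a * b \<in> P \<longrightarrow> a \<in> P \<or> b \<in> P)"

definition ideal_colon :: "'a::comm_ring_1 set \<Rightarrow> 'a \<Rightarrow> 'a set" where
  "ideal_colon I f = {g. g * f \<in> I}"

definition ass_primes :: "'a::comm_ring_1 set \<Rightarrow> 'a set set" where
  "ass_primes I = {P. is_prime_ideal P \<and> (\<exists>g. P = ideal_colon I g)}"

text \<open>A prime chain of length \<open>n\<close> has the \<open>n + 1\<close> members \<open>C 0 \<subset> \<dots> \<subset> C n\<close>.\<close>

definition prime_chain :: "nat \<Rightarrow> (nat \<Rightarrow> 'a::comm_ring_1 set) \<Rightarrow> bool" where
  "prime_chain n C \<longleftrightarrow>
     (\<forall>i\<le>n. is_prime_ideal (C i)) \<and> (\<forall>i<n. C i \<subset> C (Suc i))"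

definition prime_height :: "'a::comm_ring_1 set \<Rightarrow> enat" where
  "prime_height P = Sup {enat n | n C. prime_chain n C \<and> C n = P}"

text \<open>The infimum of the empty set, \<open>\<infinity>\<close>, is the height of the unit ideal.\<close>

definition ideal_height :: "'a::comm_ring_1 set \<Rightarrow> enat" where
  "ideal_height I = Inf {prime_height P | P. is_prime_ideal P \<and> I \<subseteq> P}"

text \<open>
  The Krull dimension of the quotient by \<^term>\<open>I\<close>, whose primes correspond to the primes
  containing \<^term>\<open>I\<close>.  The zero ring gets dimension \<open>0\<close>.
\<close>

definition quot_krull_dim :: "'a::comm_ring_1 set \<Rightarrow> enat" where
  "quot_krull_dim I = Sup {enat n | n C. prime_chain n C \<and> I \<subseteq> C 0}"

definition unmixed :: "'a::comm_ring_1 set \<Rightarrow> bool" where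
  "unmixed I \<longleftrightarrow> is_ideal I \<and> I \<noteq> UNIV \<and>
     (\<forall>P\<in>ass_primes I. \<forall>Q\<in>ass_primes I. ideal_height P = ideal_height Q)"

definition complete_intersection :: "'a::comm_ring_1 set \<Rightarrow> bool" where
  "complete_intersection I \<longleftrightarrow>
     (\<exists>r (g :: nat \<Rightarrow> 'a). ideal_height I = enat r \<and> I = ideal_gen (g ` {..<r}))"


section \<open>The standard graded polynomial ring\<close>

text \<open>
  \<open>('n, 'k) mpoly\<close> is the polynomial ring over \<open>'k\<close> whose variables are indexed by
  the finite type \<open>'n\<close>; a polynomial maps exponent vectors to coefficients.
\<close>

type_synonym ('n, 'k) mpoly = "('n \<Rightarrow>\<^sub>0 nat) \<Rightarrow>\<^sub>0 'k"

definition mon_deg :: "('n::finite \<Rightarrow>\<^sub>0 nat) \<Rightarrow> nat" where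
  "mon_deg m = (\<Sum>i\<in>UNIV. Poly_Mapping.lookup m i)"

text \<open>The graded piece of degree \<^term>\<open>d\<close>; it contains \<open>0\<close>.\<close>

definition forms :: "nat \<Rightarrow> ('n::finite, 'k::zero) mpoly set" where
  "forms d = {p. \<forall>m\<in>Poly_Mapping.keys p. mon_deg m = d}"

definition hom_comp :: "nat \<Rightarrow> ('n::finite, 'k::comm_monoid_add) mpoly \<Rightarrow> ('n, 'k) mpoly" where
  "hom_comp d p = (\<Sum>m\<in>{m\<in>Poly_Mapping.keys p. mon_deg m = d}. Poly_Mapping.single m (Poly_Mapping.lookup p m))"

definition graded_ideal :: "('n::finite, 'k::comm_ring_1) mpoly set \<Rightarrow> bool" where
  "graded_ideal I \<longleftrightarrow> is_ideal I \<and> (\<forall>p\<in>I. \<forall>d. hom_comp d p \<in> I)"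

definition min_hom_generators ::
    "('n::finite, 'k::comm_ring_1) mpoly set \<Rightarrow> ('n, 'k) mpoly set \<Rightarrow> bool" where
  "min_hom_generators I G \<longleftrightarrow>
     G \<subseteq> (\<Union>d. forms d) \<and> ideal_gen G = I \<and> (\<forall>G'. G' \<subset> G \<longrightarrow> ideal_gen G' \<noteq> I)"

definition min_generated_in_degree ::
    "nat \<Rightarrow> ('n::finite, 'k::comm_ring_1) mpoly set \<Rightarrow> bool" where
  "min_generated_in_degree e I \<longleftrightarrow> (\<forall>G. min_hom_generators I G \<longrightarrow> G \<subseteq> forms e)"

definition generated_by_linear_forms :: "('n::finite, 'k::comm_ring_1) mpoly set \<Rightarrow> bool" where
  "generated_by_linear_forms P \<longleftrightarrow> (\<exists>L. L \<subseteq> forms 1 \<and> P = ideal_gen L)"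


section \<open>Hilbert function and degree\<close>

definition kscale :: "'k::field \<Rightarrow> ('n, 'k) mpoly \<Rightarrow> ('n, 'k) mpoly" where
  "kscale a p = Poly_Mapping.single 0 a * p"

lemma vector_space_kscale:
  "vector_space (kscale :: 'k::field \<Rightarrow> ('n, 'k) mpoly \<Rightarrow> ('n, 'k) mpoly)"
  by unfold_locales
    (simp_all add: kscale_def single_add mult_single algebra_simps flip: mult.assoc)

text \<open>
  For subspaces \<open>W \<subseteq> V\<close>, a set \<open>B\<close> represents a basis of \<open>V / W\<close>: the elements of \<open>B\<close> have
  distinct, linearly independent cosets, and these cosets span \<open>V / W\<close>.
\<close>

definition quot_basis ::
    "('n, 'k::field) mpoly set \<Rightarrow> ('n, 'k) mpoly set \<Rightarrow> ('n, 'k) mpoly set \<Rightarrow> bool" where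
  "quot_basis V W B \<longleftrightarrow> B \<subseteq> V \<and>
     (\<forall>T u. finite T \<and> T \<subseteq> B \<and> (\<Sum>b\<in>T. kscale (u b) b) \<in> W \<longrightarrow> (\<forall>b\<in>T. u b = 0)) \<and>
     (\<forall>v\<in>V. \<exists>x\<in>module.span kscale B. v - x \<in> W)"

text \<open>
  Vector space dimension of \<open>V / W\<close>.  As for \<^const>\<open>vector_space.dim\<close>, the result is \<open>0\<close> if
  this dimension is infinite.
\<close>

definition quot_dim :: "('n, 'k::field) mpoly set \<Rightarrow> ('n, 'k) mpoly set \<Rightarrow> nat" where
  "quot_dim V W = card (SOME B. quot_basis V W B)"

definition hilbert_fun :: "('n::finite, 'k::field) mpoly set \<Rightarrow> nat \<Rightarrow> nat" where
  "hilbert_fun I d = quot_dim (forms d) (I \<inter> forms d)"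

text \<open>The degree of the quotient ring by the graded ideal \<^term>\<open>I\<close>.\<close>

definition quot_degree :: "('n::finite, 'k::field) mpoly set \<Rightarrow> real" where
  "quot_degree I =
     (let k = the_enat (quot_krull_dim I) in
      if k = 0 then real (quot_dim UNIV I)
      else fact (k - 1) * lim (\<lambda>d. real (hilbert_fun I d) / real d ^ (k - 1)))"


section \<open>The functions hyp and delta\<close>

definition zero_div_forms ::
    "('n::finite, 'k::field) mpoly set \<Rightarrow> nat \<Rightarrow> ('n, 'k) mpoly set" where
  "zero_div_forms I d = {f. f \<in> forms d \<and> f \<notin> I \<and> ideal_colon I f \<noteq> I}"

text \<open>
  The degrees below are nonnegative integers bounded for fixed \<^term>\<open>I\<close> and \<^term>\<open>d\<close>,
  hence only finitely many values occur even if there are infinitely many \<open>f\<close>.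
\<close>

definition hyp :: "('n::finite, 'k::field) mpoly set \<Rightarrow> nat \<Rightarrow> real" where
  "hyp I d =
     (if zero_div_forms I d = {} then 0
      else Max ((\<lambda>f. quot_degree (ideal_gen (insert f I))) ` zero_div_forms I d))"

definition delta :: "('n::finite, 'k::field) mpoly set \<Rightarrow> nat \<Rightarrow> real" where
  "delta I d = quot_degree I - hyp I d"

end

theory Submission
  imports Defs "HOL-Computational_Algebra.Polynomial" "HOL-Computational_Algebra.Fraction_Field"
    "HOL-Computational_Algebra.Primes" "HOL-Library.FuncSet"
begin

text \<open>
  Everything is read off the affine Hilbert function
  \<open>A\<^sub>J(d) = dim S\<^sub>\<le>\<^sub>d / J\<^sub>\<le>\<^sub>d\<close>.  Along strict chains of primes its order of growth
  drops, so \<open>A\<^sub>I\<close> grows at most like \<open>d\<^sup>k\<close> with \<open>k\<close> the number of variables minus the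
  height \<open>c\<close>, and the linearity of the associated primes provides prime chains showing that
  \<open>S/I\<close> and \<open>S/(I, f)\<close> both have dimension exactly \<open>k\<close>.

  For the bound on \<open>hyp\<close>, pass to an infinite field, which preserves \<open>A\<close>, and cut \<open>S/(I, f)\<close>
  with \<open>k\<close> generic linear forms to finite length.  The linear forms \<open>f, b\<^sub>1, \<dots>, b\<^sub>k\<close> extend to a
  system generating the maximal ideal, which has colength \<open>1\<close>; exchanging the remaining \<open>c - 1\<close>
  linear forms one by one for generic forms of degree \<open>e\<close> in \<open>I\<close> multiplies the colength by at most
  \<open>e\<close> each time.  Here the necessary regularity comes from a counting argument: an ideal of dimension
  \<open>t\<close> generated by as few forms as \<open>t\<close> permits has multiplicity at least the
  product of their degrees, because \<open>A\<^sub>J(d) \<le> A\<^sub>J\<^sub>+\<^sub>g(d) + A\<^sub>J(d - e)\<close>.  The same count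
  gives \<open>deg (S/I) \<ge> e\<^sup>c\<close> for complete intersections.
\<close>

text \<open>The obstacle is that nothing makes S/(I, f) Cohen-Macaulay, so cutting it with forms
  need not multiply colengths in a controlled way. Counting takes over: when a form g of degree e is
  adjoined, \<open>adim\<close> is subadditive, with equality in all degrees exactly when g is a
  nonzerodivisor. A defect would push a multiplicity below the product of the degrees, which is the
  least possible value when N forms (N the number of variables) cut S down to finite length. Degrees
  at most d are used instead of single degrees because heights and Krull dimensions quantify over
  all primes, graded or not, and \<open>adim\<close> makes sense for every ideal. Linearity gives
  the lower bound on dimensions. A zero divisor f lies in an associated prime P, so (I, f) is
  contained in P. Independent linear forms generating P, completed to generators of the maximal
  ideal, give chains of primes below and above P whose lengths add up to N. The lower one has at
  most c steps, so the upper one has at least N - c.\<close>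

abbreviation "lookup \<equiv> Poly_Mapping.lookup"
abbreviation "keys \<equiv> Poly_Mapping.keys"
abbreviation "single \<equiv> Poly_Mapping.single"

section \<open>Ideals\<close>

interpretation ring_module: module "(*) :: 'a::comm_ring_1 \<Rightarrow> 'a \<Rightarrow> 'a"
  by (rule module_times)

text \<open>Otherwise this rule would loop with \<open>mult.assoc\<close>.\<close>

declare ring_module.scale_scale [simp del]

interpretation kspace: vector_space "kscale :: 'k::field \<Rightarrow> ('n, 'k) mpoly \<Rightarrow> ('n, 'k) mpoly"
  by (rule vector_space_kscale)

lemma is_idealI:
  assumes "0 \<in> I" "\<And>a b. a \<in> I \<Longrightarrow> b \<in> I \<Longrightarrow> a + b \<in> I" "\<And>s a. a \<in> I \<Longrightarrow> s * a \<in> I"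
  shows "is_ideal I"
  using assms by (auto simp: is_ideal_def intro!: ring_module.subspaceI)

lemma is_ideal_0: "is_ideal I \<Longrightarrow> 0 \<in> I"
  by (simp add: is_ideal_def ring_module.subspace_0)

lemma is_ideal_add: "is_ideal I \<Longrightarrow> a \<in> I \<Longrightarrow> b \<in> I \<Longrightarrow> a + b \<in> I"
  by (simp add: is_ideal_def ring_module.subspace_add)

lemma is_ideal_mult: "is_ideal I \<Longrightarrow> a \<in> I \<Longrightarrow> s * a \<in> I"
  by (simp add: is_ideal_def ring_module.subspace_scale)

lemma is_ideal_mult_right: "is_ideal I \<Longrightarrow> a \<in> I \<Longrightarrow> a * s \<in> I"
  using is_ideal_mult[of I a s] by (simp add: mult.commute)

lemma is_ideal_diff: "is_ideal I \<Longrightarrow> a \<in> I \<Longrightarrow> b \<in> I \<Longrightarrow> a - b \<in> I"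
  by (simp add: is_ideal_def ring_module.subspace_diff)

lemma is_ideal_sum: "is_ideal I \<Longrightarrow> (\<And>x. x \<in> A \<Longrightarrow> f x \<in> I) \<Longrightarrow> sum f A \<in> I"
  by (simp add: is_ideal_def ring_module.subspace_sum)

lemma is_ideal_UNIV_iff: "is_ideal I \<Longrightarrow> I = UNIV \<longleftrightarrow> 1 \<in> I"
  using is_ideal_mult_right[of I 1] by auto

lemma is_ideal_ideal_gen [simp]: "is_ideal (ideal_gen A)"
  by (simp add: is_ideal_def ideal_gen_def)

lemma is_ideal_zero [simp]: "is_ideal {0}"
  by (simp add: is_ideal_def)

lemma is_ideal_UNIV [simp]: "is_ideal UNIV"
  by (simp add: is_ideal_def)

lemma ideal_gen_superset: "A \<subseteq> ideal_gen A"
  by (simp add: ideal_gen_def ring_module.span_superset)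

lemma ideal_gen_minimal: "A \<subseteq> I \<Longrightarrow> is_ideal I \<Longrightarrow> ideal_gen A \<subseteq> I"
  by (simp add: ideal_gen_def is_ideal_def ring_module.span_minimal)

lemma ideal_gen_mono: "A \<subseteq> B \<Longrightarrow> ideal_gen A \<subseteq> ideal_gen B"
  by (simp add: ideal_gen_def ring_module.span_mono)

lemma ideal_gen_empty [simp]: "ideal_gen {} = {0}"
  by (simp add: ideal_gen_def)

lemma is_ideal_colon: "is_ideal I \<Longrightarrow> is_ideal (ideal_colon I g)"
  by (rule is_idealI)
    (simp_all add: ideal_colon_def is_ideal_0 distrib_right mult.assoc is_ideal_add is_ideal_mult)

lemma ideal_colon_superset: "is_ideal I \<Longrightarrow> I \<subseteq> ideal_colon I g"
  by (auto simp: ideal_colon_def is_ideal_mult_right)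

section \<open>Adjoining elements to an ideal\<close>

definition adj :: "'a::comm_ring_1 set \<Rightarrow> 'a \<Rightarrow> 'a set" where
  "adj I g = ideal_gen (insert g I)"

lemma is_ideal_adj [simp]: "is_ideal (adj I g)"
  by (simp add: adj_def)

lemma adj_superset: "I \<subseteq> adj I g" and adj_mem: "g \<in> adj I g"
  using ideal_gen_superset[of "insert g I"] by (auto simp: adj_def)

lemma adj_minimal: "I \<subseteq> J \<Longrightarrow> g \<in> J \<Longrightarrow> is_ideal J \<Longrightarrow> adj I g \<subseteq> J"
  by (simp add: adj_def ideal_gen_minimal)

lemma mem_adj_iff: "is_ideal I \<Longrightarrow> p \<in> adj I g \<longleftrightarrow> (\<exists>s. p - s * g \<in> I)"
  by (simp add: adj_def ideal_gen_def ring_module.span_insert)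
    (simp add: is_ideal_def ring_module.span_eq_iff[THEN iffD2])

lemma adj_commute: "adj (adj I g) h = adj (adj I h) g"
proof -
  have "adj (adj I g) h \<subseteq> adj (adj I h) g" for g h
    by (intro adj_minimal) (auto intro: adj_superset[THEN subsetD] adj_mem)
  thus ?thesis by blast
qed

lemma adj_absorb: "is_ideal I \<Longrightarrow> g \<in> I \<Longrightarrow> adj I g = I"
  using adj_minimal[of I I g] adj_superset[of I g] by blast

lemma adj_ideal_gen: "adj (ideal_gen A) g = ideal_gen (insert g A)"
proof
  show "adj (ideal_gen A) g \<subseteq> ideal_gen (insert g A)"
    using ideal_gen_superset[of "insert g A"] by (intro adj_minimal ideal_gen_mono) auto
  show "ideal_gen (insert g A) \<subseteq> adj (ideal_gen A) g"
    using ideal_gen_superset[of A] unfolding adj_def by (intro ideal_gen_mono) auto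
qed

definition adjs :: "'a::comm_ring_1 set \<Rightarrow> 'a list \<Rightarrow> 'a set" where
  "adjs I gs = fold (\<lambda>g J. adj J g) gs I"

lemma adjs_Nil [simp]: "adjs I [] = I"
  and adjs_Cons [simp]: "adjs I (g # gs) = adjs (adj I g) gs"
  and adjs_append [simp]: "adjs I (gs @ hs) = adjs (adjs I gs) hs"
  by (simp_all add: adjs_def)

lemma adjs_ideal_gen: "adjs (ideal_gen A) gs = ideal_gen (set gs \<union> A)"
  by (induction gs arbitrary: A) (simp_all add: adj_ideal_gen)

lemma is_ideal_adjs [simp]: "is_ideal I \<Longrightarrow> is_ideal (adjs I gs)"
  by (induction gs arbitrary: I) auto

lemma adjs_superset: "I \<subseteq> adjs I gs"
proof (induction gs arbitrary: I)
  case (Cons g gs)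
  thus ?case using adj_superset[of I g] by force
qed auto

lemma adjs_adj: "adjs (adj I g) gs = adj (adjs I gs) g"
  by (induction gs arbitrary: I) (simp_all add: adj_commute)

lemma is_prime_ideal_is_ideal: "is_prime_ideal P \<Longrightarrow> is_ideal P"
  by (simp add: is_prime_ideal_def)

lemma is_prime_ideal_colon:
  "is_prime_ideal P \<Longrightarrow> g \<notin> P \<Longrightarrow> ideal_colon P g = P"
  by (auto simp: is_prime_ideal_def ideal_colon_def is_ideal_mult_right)


section \<open>A monomial order\<close>

text \<open>
  Assigning distinct primes to the variables embeds the exponent vectors multiplicatively into
  the natural numbers, which yields a monomial order without a linear order on the variables.
\<close>

definition var_prime :: "'n::finite \<Rightarrow> nat" where
  "var_prime = (SOME f. inj f \<and> range f \<subseteq> {p. prime p})"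

lemma var_prime: "inj (var_prime :: 'n::finite \<Rightarrow> nat)" "prime (var_prime i)" for i :: "'n::finite"
proof -
  obtain T :: "nat set" where T: "finite T" "card T = card (UNIV :: 'n set)" "T \<subseteq> {p. prime p}"
    using infinite_arbitrarily_large[OF primes_infinite] by metis
  then obtain f :: "'n \<Rightarrow> nat" where "bij_betw f UNIV T"
    using finite_same_card_bij[of "UNIV :: 'n set" T] by auto
  hence "\<exists>f :: 'n \<Rightarrow> nat. inj f \<and> range f \<subseteq> {p. prime p}"
    using T by (auto simp: bij_betw_def)
  hence "inj (var_prime :: 'n::finite \<Rightarrow> nat) \<and> range (var_prime :: 'n \<Rightarrow> nat) \<subseteq> {p. prime p}"
    unfolding var_prime_def by (rule someI_ex)
  thus "inj (var_prime :: 'n::finite \<Rightarrow> nat)" "prime (var_prime i)" by auto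
qed

definition mon_code :: "('n::finite \<Rightarrow>\<^sub>0 nat) \<Rightarrow> nat" where
  "mon_code m = (\<Prod>i\<in>UNIV. var_prime i ^ lookup m i)"

lemma mon_code_add: "mon_code (m + m') = mon_code m * mon_code m'"
  by (simp add: mon_code_def lookup_add power_add prod.distrib)

lemma mon_code_pos: "mon_code m > 0"
  unfolding mon_code_def by (intro prod_pos) (simp add: prime_gt_0_nat var_prime(2))

text \<open>Unique factorisation recovers each exponent as the multiplicity of the prime of its
  variable.\<close>

lemma mon_code_eq_iff [simp]: "mon_code m = mon_code m' \<longleftrightarrow> m = (m' :: 'n::finite \<Rightarrow>\<^sub>0 nat)"
proof
  have *: "mon_code m = (\<Prod>p\<in>range (var_prime :: 'n \<Rightarrow> nat). p ^ lookup m (inv var_prime p))"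
    for m :: "'n \<Rightarrow>\<^sub>0 nat"
    by (subst prod.reindex) (simp_all add: mon_code_def var_prime(1))
  have mult: "lookup m i = multiplicity (var_prime i) (mon_code m)" for m :: "'n \<Rightarrow>\<^sub>0 nat" and i
    unfolding * by (subst multiplicity_prod_prime_powers) (auto simp: var_prime)
  assume "mon_code m = mon_code m'"
  thus "m = m'" by (intro poly_mapping_eqI) (simp add: mult)
qed auto

text \<open>Negating the codes makes \<open>arg_min_on\<close> select the key with the largest code.
  The value at the zero polynomial is unspecified.\<close>

definition lead_mon :: "('n::finite, 'k::zero) mpoly \<Rightarrow> 'n \<Rightarrow>\<^sub>0 nat" where
  "lead_mon p = arg_min_on (\<lambda>m. - int (mon_code m)) (keys p)"

lemma lead_mon_keys: "p \<noteq> 0 \<Longrightarrow> lead_mon p \<in> keys p"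
  unfolding lead_mon_def by (rule arg_min_if_finite) auto

lemma lead_mon_max: "m \<in> keys p \<Longrightarrow> mon_code m \<le> mon_code (lead_mon p)"
  unfolding lead_mon_def
  using arg_min_if_finite(2)[of "keys p" "\<lambda>m. - int (mon_code m)"] by force

lemma lead_mon_eqI:
  assumes "m \<in> keys p" "\<And>m'. m' \<in> keys p \<Longrightarrow> mon_code m' \<le> mon_code m"
  shows "lead_mon p = m"
proof -
  have "p \<noteq> 0" using assms(1) by auto
  hence "mon_code (lead_mon p) = mon_code m"
    using assms lead_mon_keys lead_mon_max by (metis antisym)
  thus ?thesis by simp
qed

text \<open>Codes multiply, so every other pair of monomials has a product with a smaller code and
  contributes nothing here. Hence the polynomial ring is a domain.\<close>

lemma lookup_mult_lead:
  fixes p q :: "('n::finite, 'k::field) mpoly"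
  shows "lookup (p * q) (lead_mon p + lead_mon q) =
    lookup p (lead_mon p) * lookup q (lead_mon q)"
proof -
  define a b where "a = lead_mon p" and "b = lead_mon q"
  define P Q where "P = single a (lookup p a)"
    and "Q = single b (lookup q b)"
  have kp: "mon_code m < mon_code a" if "m \<in> keys (p - P)" for m
  proof -
    have "m \<noteq> a" "m \<in> keys p"
      using that by (auto simp: P_def in_keys_iff lookup_minus lookup_single when_def split: if_splits)
    thus ?thesis using lead_mon_max[of m p] by (auto simp: a_def order.order_iff_strict)
  qed
  have kq: "mon_code m < mon_code b" if "m \<in> keys (q - Q)" for m
  proof -
    have "m \<noteq> b" "m \<in> keys q"
      using that by (auto simp: Q_def in_keys_iff lookup_minus lookup_single when_def split: if_splits)
    thus ?thesis using lead_mon_max[of m q] by (auto simp: b_def order.order_iff_strict)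
  qed
  have kq': "mon_code m \<le> mon_code b" if "m \<in> keys q" for m
    using lead_mon_max[OF that] by (simp add: b_def)
  have "a + b \<notin> keys (P * (q - Q))"
  proof
    assume "a + b \<in> keys (P * (q - Q))"
    then obtain x y where "a + b = x + y" "x \<in> keys P" "y \<in> keys (q - Q)"
      using keys_mult[of P "q - Q"] by blast
    thus False using kq[of y] by (auto simp: P_def split: if_splits)
  qed
  moreover have "a + b \<notin> keys ((p - P) * q)"
  proof
    assume "a + b \<in> keys ((p - P) * q)"
    then obtain x y where "a + b = x + y" "x \<in> keys (p - P)" "y \<in> keys q"
      using keys_mult[of "p - P" q] by blast
    hence "mon_code x * mon_code y < mon_code a * mon_code b"
      using kp[of x] kq'[of y] mon_code_pos[of y] mon_code_pos[of b]
      by (intro mult_less_le_imp_less) auto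
    with \<open>a + b = x + y\<close> show False by (metis mon_code_add less_irrefl)
  qed
  moreover have "p * q = P * Q + (P * (q - Q) + (p - P) * q)"
    by (simp add: algebra_simps)
  moreover have "lookup (P * Q) (a + b) = lookup p a * lookup q b"
    by (simp add: P_def Q_def mult_single)
  ultimately show ?thesis
    by (simp add: lookup_add in_keys_iff a_def b_def)
qed

lemma mpoly_mult_eq_0_iff [simp]:
  fixes p q :: "('n::finite, 'k::field) mpoly"
  shows "p * q = 0 \<longleftrightarrow> p = 0 \<or> q = 0"
proof
  assume "p * q = 0"
  hence "lookup p (lead_mon p) * lookup q (lead_mon q) = 0"
    using lookup_mult_lead[of p q] by simp
  thus "p = 0 \<or> q = 0" using lead_mon_keys[of p] lead_mon_keys[of q] by (auto simp: in_keys_iff)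
qed auto

lemma mpoly_mult_left_cancel:
  fixes p q r :: "('n::finite, 'k::field) mpoly"
  shows "r \<noteq> 0 \<Longrightarrow> r * p = r * q \<longleftrightarrow> p = q"
  using mpoly_mult_eq_0_iff[of r "p - q"] by (auto simp: algebra_simps)

lemma is_prime_ideal_zero: "is_prime_ideal ({0} :: ('n::finite, 'k::field) mpoly set)"
proof -
  have "(1 :: ('n, 'k) mpoly) \<notin> {0}" by simp
  hence "{0 :: ('n, 'k) mpoly} \<noteq> UNIV" by blast
  thus ?thesis by (simp add: is_prime_ideal_def)
qed

section \<open>Dickson's lemma and Hilbert's basis theorem\<close>

lemma dickson:
  fixes f :: "nat \<Rightarrow> ('n::finite \<Rightarrow> nat)"
  shows "\<exists>i j. i < j \<and> f i \<le> f j"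
proof -
  \<comment> \<open>Passing to a subsequence for one coordinate after another makes all coordinates
    nondecreasing at once.\<close>
  have "\<exists>g. strict_mono g \<and> (\<forall>k\<in>A. incseq (\<lambda>i. f (g i) k))" if "finite A" for A :: "'n set"
    using that
  proof (induction A)
    case empty
    show ?case by (rule exI[of _ id]) (auto simp: strict_mono_def)
  next
    case (insert k A)
    then obtain g where g: "strict_mono g" "\<forall>k\<in>A. incseq (\<lambda>i. f (g i) k)" by auto
    have "\<exists>h. strict_mono h \<and> incseq (\<lambda>i. f (g (h i)) k)"
    proof -
      obtain h where h: "strict_mono h" "monoseq (\<lambda>i. f (g (h i)) k)"
        using seq_monosub[of "\<lambda>i. f (g i) k"] by auto
      show ?thesis
      proof (cases "incseq (\<lambda>i. f (g (h i)) k)")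
        case True thus ?thesis using h by auto
      next
        case False
        hence dec: "decseq (\<lambda>i. f (g (h i)) k)" using h(2) by (simp add: monoseq_iff)
        \<comment> \<open>A decreasing sequence of natural numbers is constant from the point where
          it attains its minimum.\<close>
        obtain i0 where i0: "\<And>i. f (g (h i0)) k \<le> f (g (h i)) k"
          using ex_has_least_nat[of "\<lambda>_. True" 0 "\<lambda>i. f (g (h i)) k"] by auto
        have "f (g (h (i + i0))) k = f (g (h i0)) k" for i
          using i0[of "i + i0"] decseqD[OF dec, of i0 "i + i0"] by simp
        moreover have "strict_mono (\<lambda>i. h (i + i0))" using h(1) by (auto simp: strict_mono_def)
        ultimately show ?thesis by (intro exI[of _ "\<lambda>i. h (i + i0)"]) (simp add: incseq_def)
      qed
    qed
    then obtain h where h: "strict_mono h" "incseq (\<lambda>i. f (g (h i)) k)" by auto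
    show ?case
      using g h by (intro exI[of _ "g \<circ> h"])
        (auto simp: strict_mono_def incseq_def strict_mono_less_eq)
  qed
  from this[of UNIV] obtain g where "strict_mono g" "\<And>k. incseq (\<lambda>i. f (g i) k)" by auto
  hence "g 0 < g 1" "f (g 0) \<le> f (g 1)" by (auto simp: strict_mono_def incseq_def le_fun_def)
  thus ?thesis by blast
qed

definition lead_mons :: "('n::finite, 'k::field) mpoly set \<Rightarrow> ('n \<Rightarrow>\<^sub>0 nat) set" where
  "lead_mons I = lead_mon ` (I - {0})"

lemma lead_mons_add:
  assumes "is_ideal I" "m \<in> lead_mons I"
  shows "m' + m \<in> lead_mons I"
proof -
  obtain p where p: "p \<in> I" "p \<noteq> 0" "m = lead_mon p" using assms by (auto simp: lead_mons_def)
  define t where "t = single m' (1 :: 'b)"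
  have "t \<noteq> 0" by (metis t_def lookup_single_eq lookup_zero zero_neq_one)
  have lt: "lead_mon t = m'" by (rule lead_mon_eqI) (auto simp: t_def)
  have "lead_mon (t * p) = m' + m"
  proof (rule lead_mon_eqI)
    show "m' + m \<in> keys (t * p)"
      using lookup_mult_lead[of t p] lead_mon_keys[OF p(2)] p(3) lt by (simp add: in_keys_iff t_def)
    fix k assume "k \<in> keys (t * p)"
    then obtain y where "k = m' + y" "y \<in> keys p"
      using keys_mult[of t p] by (auto simp: t_def)
    thus "mon_code k \<le> mon_code (m' + m)" using lead_mon_max[of y p] p(3) by (simp add: mon_code_add)
  qed
  moreover have "t * p \<in> I - {0}" using p assms \<open>t \<noteq> 0\<close> by (simp add: is_ideal_mult)
  ultimately show ?thesis unfolding lead_mons_def by (metis imageI)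
qed

lemma lead_mons_mono: "I \<subseteq> J \<Longrightarrow> lead_mons I \<subseteq> lead_mons J"
  by (auto simp: lead_mons_def)

text \<open>Without a new leading monomial, each element of J could be reduced to 0 by subtracting
  multiples of elements of I with the same leading monomial.\<close>

lemma lead_mons_strict:
  assumes I: "is_ideal I" and J: "is_ideal J" and "I \<subset> J"
  shows "\<exists>m. m \<in> lead_mons J - lead_mons I"
proof (rule ccontr)
  assume neg: "\<nexists>m. m \<in> lead_mons J - lead_mons I"
  have "p \<in> I" if "p \<in> J" for p
    using that
  \<comment> \<open>Codes are positive, so the value 0 for the zero polynomial makes a reduction to
    zero a descent as well.\<close>
  proof (induction "if p = 0 then 0 else mon_code (lead_mon p)" arbitrary: p rule: less_induct)
    case less
    show ?case
    proof (cases "p = 0")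
      case False
      hence "lead_mon p \<in> lead_mons J" using less.prems by (auto simp: lead_mons_def)
      hence "lead_mon p \<in> lead_mons I" using neg by blast
      then obtain q where q: "q \<in> I" "q \<noteq> 0" "lead_mon q = lead_mon p"
        unfolding lead_mons_def by (elim imageE) (metis Diff_iff singletonI)
      define m where "m = lead_mon p"
      define c where "c = lookup p m / lookup q m"
      define r where "r = p - single 0 c * q"
      have qm: "lookup q m \<noteq> 0"
        using lead_mon_keys[OF q(2)] q(3) by (simp add: in_keys_iff m_def)
      have lk: "lookup r k = lookup p k - c * lookup q k" for k
        by (simp add: r_def lookup_minus map.rep_eq when_def flip: mult_map_scale_conv_mult)
      have "r \<in> J"
        unfolding r_def using less.prems q(1) assms by (intro is_ideal_diff is_ideal_mult) auto
      have "r = 0 \<or> mon_code (lead_mon r) < mon_code m"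
      proof (cases "r = 0")
        case False
        hence k: "lead_mon r \<in> keys r" by (rule lead_mon_keys)
        hence "lead_mon r \<noteq> m" using qm by (auto simp: in_keys_iff lk c_def)
        moreover have "lead_mon r \<in> keys p \<or> lead_mon r \<in> keys q"
          using k by (auto simp: in_keys_iff lk)
        hence "mon_code (lead_mon r) \<le> mon_code m"
          using lead_mon_max[of "lead_mon r" p] lead_mon_max[of "lead_mon r" q] q(3) by (auto simp: m_def)
        ultimately show ?thesis by (auto simp: order.order_iff_strict)
      qed simp
      hence "r \<in> I"
        using less.hyps[of r] \<open>r \<in> J\<close> False is_ideal_0[OF I] mon_code_pos[of m] by (auto simp: m_def)
      hence "r + single 0 c * q \<in> I"
        using q(1) I by (intro is_ideal_add is_ideal_mult)
      thus ?thesis by (simp add: r_def)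
    qed (simp add: is_ideal_0 I)
  qed
  thus False using \<open>I \<subset> J\<close> by blast
qed

text \<open>Each strict inclusion in an ascending chain brings a new leading monomial. By Dickson's
  lemma one of these divides a later one, which is then not new.\<close>

theorem hilbert_basis:
  "wf {(J, I :: ('n::finite, 'k::field) mpoly set). is_ideal I \<and> is_ideal J \<and> I \<subset> J}"
proof (unfold wf_iff_no_infinite_down_chain, rule notI)
  assume "\<exists>f. \<forall>i. (f (Suc i), f i) \<in> {(J, I :: ('n, 'k) mpoly set). is_ideal I \<and> is_ideal J \<and> I \<subset> J}"
  then obtain f :: "nat \<Rightarrow> ('n, 'k) mpoly set" where f: "\<And>i. is_ideal (f i)" "\<And>i. f i \<subset> f (Suc i)"
    by blast
  have "\<forall>i. \<exists>m. m \<in> lead_mons (f (Suc i)) - lead_mons (f i)"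
    using lead_mons_strict[OF f(1) f(1) f(2)] by blast
  from choice[OF this] obtain m where m: "\<And>i. m i \<in> lead_mons (f (Suc i)) - lead_mons (f i)"
    by blast
  obtain i j where ij: "i < j" "lookup (m i) \<le> lookup (m j)"
    using dickson[of "\<lambda>i. lookup (m i)"] by (elim exE conjE)
  have "f (Suc i) \<subseteq> f j"
    by (rule lift_Suc_mono_le[of f]) (use f(2) ij(1) in \<open>simp_all add: psubset_imp_subset\<close>)
  from lead_mons_mono[OF this] have "m i \<in> lead_mons (f j)" using m[of i] by blast
  hence "(m j - m i) + m i \<in> lead_mons (f j)" by (intro lead_mons_add f(1))
  moreover have "(m j - m i) + m i = m j"
    using ij(2) by (intro poly_mapping_eqI) (simp add: lookup_add lookup_minus le_fun_def)
  ultimately show False using m[of j] by auto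
qed

lemma maximal_ideal_exists:
  fixes I :: "('n::finite, 'k::field) mpoly set"
  assumes "is_ideal I" "P I"
  obtains J where "is_ideal J" "I \<subseteq> J" "P J" "\<And>J'. is_ideal J' \<Longrightarrow> J \<subset> J' \<Longrightarrow> \<not> P J'"
proof -
  let ?Q = "{J. is_ideal J \<and> I \<subseteq> J \<and> P J}"
  have "I \<in> ?Q" using assms by auto
  from wfE_min[OF hilbert_basis this] obtain J where
    J: "J \<in> ?Q" "\<And>J'. (J', J) \<in> {(J, I). is_ideal I \<and> is_ideal J \<and> I \<subset> J} \<Longrightarrow> J' \<notin> ?Q" by blast
  show ?thesis using J by (intro that[of J]) auto
qed

section \<open>Dimensions of quotient spaces\<close>

lemma quot_basis_subset: "quot_basis V W B \<Longrightarrow> B \<subseteq> V"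
  and quot_basis_independent: "quot_basis V W B \<Longrightarrow> finite T \<Longrightarrow> T \<subseteq> B \<Longrightarrow>
    (\<Sum>b\<in>T. kscale (u b) b) \<in> W \<Longrightarrow> b \<in> T \<Longrightarrow> u b = 0"
  and quot_basis_spanning: "quot_basis V W B \<Longrightarrow> v \<in> V \<Longrightarrow> \<exists>x\<in>module.span kscale B. v - x \<in> W"
  unfolding quot_basis_def by blast+

lemma quot_basis_not_mem: "quot_basis V W B \<Longrightarrow> b \<in> B \<Longrightarrow> b \<notin> W"
  using quot_basis_independent[of V W B "{b}" "\<lambda>_. 1" b] by auto

text \<open>Representatives of the elements of T in the span of B are again distinct and
  independent, since a relation among them is a relation among the elements of T modulo W.\<close>

lemma quot_basis_card_le_spanning:
  fixes V W :: "('n, 'k::field) mpoly set"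
  assumes W: "kspace.subspace W" and B: "\<And>v. v \<in> V \<Longrightarrow> \<exists>x\<in>kspace.span B. v - x \<in> W" "finite B"
    and T: "quot_basis V W B'" "T \<subseteq> B'" "finite T"
  shows "card T \<le> card B"
proof -
  have "\<exists>x\<in>kspace.span B. t - x \<in> W" if "t \<in> T" for t
    using B(1) quot_basis_subset[OF T(1)] T(2) that by blast
  then obtain x where x: "\<And>t. t \<in> T \<Longrightarrow> x t \<in> kspace.span B" "\<And>t. t \<in> T \<Longrightarrow> t - x t \<in> W"
    by metis
  have comb: "(\<Sum>b\<in>S. kscale (u b) b) \<in> W" if "S \<subseteq> T" "(\<Sum>b\<in>S. kscale (u b) (x b)) = 0" for S u
  proof -
    have "(\<Sum>b\<in>S. kscale (u b) (b - x b)) \<in> W"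
      using that(1) x(2) by (intro kspace.subspace_sum[OF W] kspace.subspace_scale[OF W]) auto
    thus ?thesis using that(2) by (simp add: kspace.scale_right_diff_distrib sum_subtractf)
  qed
  have inj: "inj_on x T"
  proof (rule inj_onI, rule ccontr)
    fix a b assume ab: "a \<in> T" "b \<in> T" "x a = x b" "a \<noteq> b"
    define u where "u = (\<lambda>t. if t = a then 1 else - 1 :: 'k)"
    have "(\<Sum>t\<in>{a, b}. kscale (u t) (x t)) = 0" using ab by (simp add: u_def)
    hence "(\<Sum>t\<in>{a, b}. kscale (u t) t) \<in> W" using comb[of "{a, b}" u] ab by auto
    hence "u a = 0" using quot_basis_independent[OF T(1), of "{a, b}" u a] ab T(2) by auto
    thus False by (simp add: u_def)
  qed
  have "kspace.independent (x ` T)"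
  proof (unfold kspace.independent_explicit_module, intro allI impI)
    fix S u v assume S: "finite S" "S \<subseteq> x ` T" "(\<Sum>v\<in>S. kscale (u v) v) = 0" "v \<in> S"
    define S' where "S' = {b \<in> T. x b \<in> S}"
    have S': "S = x ` S'" "S' \<subseteq> T" using S(2) by (auto simp: S'_def)
    have "(\<Sum>b\<in>S'. kscale (u (x b)) (x b)) = 0"
      using S(3) inj_on_subset[OF inj S'(2)] unfolding S'(1) by (simp add: sum.reindex)
    hence "(\<Sum>b\<in>S'. kscale (u (x b)) b) \<in> W" using comb S'(2) by auto
    hence "u (x b) = 0" if "b \<in> S'" for b
      using quot_basis_independent[OF T(1), of S' "\<lambda>b. u (x b)" b] S'(2) T that
        finite_subset[OF S'(2)] by auto
    thus "u v = 0" using S(4) S'(1) by auto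
  qed
  moreover have "x ` T \<subseteq> kspace.span B" using x by auto
  ultimately have "card (x ` T) \<le> card B" using kspace.independent_span_bound[OF B(2)] by blast
  thus ?thesis using card_image[OF inj] by simp
qed

lemma quot_basis_card_le:
  assumes "kspace.subspace W" "quot_basis V W B" "finite B" "quot_basis V W B'" "T \<subseteq> B'" "finite T"
  shows "card T \<le> card B"
  by (rule quot_basis_card_le_spanning[OF assms(1) quot_basis_spanning[OF assms(2)] assms(3-6)])

lemma quot_basis_card_eq:
  assumes W: "kspace.subspace W" and B: "quot_basis V W B" "finite B" and B': "quot_basis V W B'"
  shows "card B' = card B"
proof -
  have fin: "finite B'"
  proof (rule ccontr)
    assume "infinite B'"
    from infinite_arbitrarily_large[OF this, of "Suc (card B)"]
    obtain T where T: "T \<subseteq> B'" "finite T" "card T = Suc (card B)" by blast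
    thus False using quot_basis_card_le[OF W B B' T(1,2)] by simp
  qed
  show ?thesis
    using quot_basis_card_le[OF W B B' subset_refl fin] quot_basis_card_le[OF W B' fin B(1) subset_refl B(2)]
    by simp
qed

lemma quot_dim_eq: "kspace.subspace W \<Longrightarrow> quot_basis V W B \<Longrightarrow> finite B \<Longrightarrow> quot_dim V W = card B"
  unfolding quot_dim_def by (rule someI2[of _ B]) (auto intro: quot_basis_card_eq)

text \<open>Carried along as a hypothesis because \<open>quot_dim\<close> has the default value 0 on
  infinite-dimensional quotients.\<close>

definition fin_quot :: "('n, 'k::field) mpoly set \<Rightarrow> ('n, 'k) mpoly set \<Rightarrow> bool" where
  "fin_quot V W \<longleftrightarrow> (\<exists>B. finite B \<and> quot_basis V W B)"

lemma quot_dim_le_spanning: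
  fixes V W :: "('n, 'k::field) mpoly set"
  assumes W: "kspace.subspace W" and B: "\<And>v. v \<in> V \<Longrightarrow> \<exists>x\<in>kspace.span B. v - x \<in> W" "finite B"
    and "fin_quot V W"
  shows "quot_dim V W \<le> card B"
proof -
  obtain T where T: "finite T" "quot_basis V W T" using assms(4) by (auto simp: fin_quot_def)
  show ?thesis
    using quot_basis_card_le_spanning[OF W B T(2) subset_refl T(1)] quot_dim_eq[OF W T(2,1)] by simp
qed

text \<open>A basis of W extends to one of V, and the added vectors represent a basis of the
  quotient.\<close>

lemma quot_basis_exists:
  assumes V: "kspace.subspace V" and W: "kspace.subspace W" and "W \<subseteq> V" and T: "finite T" "V \<subseteq> kspace.span T"
  shows "fin_quot V W"
proof -
  obtain C where C: "C \<subseteq> W" "kspace.independent C" "W \<subseteq> kspace.span C"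
    using kspace.maximal_independent_subset[of W] by blast
  obtain D where D: "C \<subseteq> D" "D \<subseteq> V" "kspace.independent D" "V \<subseteq> kspace.span D"
    using kspace.maximal_independent_subset_extend[of C V] C \<open>W \<subseteq> V\<close> by blast
  have fin: "finite D" using kspace.independent_span_bound[OF T(1) D(3)] D(2) T(2) by blast
  have WC: "W = kspace.span C" using C W by (metis kspace.span_subspace)
  have indep: "u b = 0" if S: "S \<subseteq> D - C" "(\<Sum>b\<in>S. kscale (u b) b) \<in> W" "b \<in> S" for S u b
  proof -
    have finC: "finite C" using D(1) fin finite_subset by blast
    obtain w where w: "(\<Sum>b\<in>S. kscale (u b) b) = (\<Sum>c\<in>C. kscale (w c) c)"
      using S(2) kspace.span_finite[OF finC] unfolding WC by auto
    define z where "z = (\<lambda>b. if b \<in> S then u b else - w b)"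
    have "(\<Sum>b\<in>S \<union> C. kscale (z b) b) = (\<Sum>b\<in>S. kscale (z b) b) + (\<Sum>b\<in>C. kscale (z b) b)"
      using S(1) finC fin by (intro sum.union_disjoint) (auto intro: finite_subset)
    also have "(\<Sum>b\<in>S. kscale (z b) b) = (\<Sum>b\<in>S. kscale (u b) b)" by (simp add: z_def)
    also have "(\<Sum>b\<in>C. kscale (z b) b) = (\<Sum>b\<in>C. - kscale (w b) b)"
      using S(1) by (intro sum.cong) (auto simp: z_def)
    finally have "(\<Sum>b\<in>S \<union> C. kscale (z b) b) = 0" using w by (simp add: sum_negf)
    hence "z b = 0" using kspace.independentD[OF D(3), of "S \<union> C" z b] S D(1) fin
      by (auto intro: finite_subset)
    thus ?thesis using S(3) by (simp add: z_def)
  qed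
  have "quot_basis V W (D - C)"
    unfolding quot_basis_def
  proof (intro conjI allI impI ballI)
    fix S u b assume "finite S \<and> S \<subseteq> D - C \<and> (\<Sum>b\<in>S. kscale (u b) b) \<in> W" "b \<in> S"
    thus "u b = 0" using indep[of S u b] by blast
  next
    fix v assume "v \<in> V"
    hence "v \<in> kspace.span ((D - C) \<union> C)" using D by (metis Diff_partition Un_commute subsetD)
    then obtain x y where "v = x + y" "x \<in> kspace.span (D - C)" "y \<in> kspace.span C"
      unfolding kspace.span_Un by blast
    thus "\<exists>x\<in>module.span kscale (D - C). v - x \<in> W" by (intro bexI[of _ x]) (simp_all add: WC)
  qed (use D in auto)
  thus ?thesis using fin by (auto simp: fin_quot_def)
qed

lemma quot_dim_trans:
  assumes U: "kspace.subspace U" and W: "kspace.subspace W" and "W \<subseteq> U" "U \<subseteq> V"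
    and "fin_quot V U" "fin_quot U W"
  shows "quot_dim V W = quot_dim V U + quot_dim U W"
proof -
  obtain B1 B2 where B: "quot_basis V U B1" "finite B1" "quot_basis U W B2" "finite B2"
    using assms(5,6) by (auto simp: fin_quot_def)
  have B2U: "B2 \<subseteq> U" using quot_basis_subset[OF B(3)] .
  have disj: "B1 \<inter> B2 = {}" using quot_basis_not_mem[OF B(1)] B2U by blast
  have "quot_basis V W (B1 \<union> B2)"
    unfolding quot_basis_def
  proof (intro conjI allI impI ballI)
    show "B1 \<union> B2 \<subseteq> V" using quot_basis_subset[OF B(1)] B2U assms(4) by blast
  next
    fix T u b assume T: "finite T \<and> T \<subseteq> B1 \<union> B2 \<and> (\<Sum>b\<in>T. kscale (u b) b) \<in> W" and b: "b \<in> T"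
    have "T = (T \<inter> B1) \<union> (T \<inter> B2)" using T by blast
    hence "(\<Sum>b\<in>T. kscale (u b) b) = (\<Sum>b\<in>(T \<inter> B1) \<union> (T \<inter> B2). kscale (u b) b)" by simp
    also have "\<dots> = (\<Sum>b\<in>T \<inter> B1. kscale (u b) b) + (\<Sum>b\<in>T \<inter> B2. kscale (u b) b)"
      using T disj by (intro sum.union_disjoint) auto
    finally have sum: "(\<Sum>b\<in>T. kscale (u b) b) = \<dots>" .
    have s2: "(\<Sum>b\<in>T \<inter> B2. kscale (u b) b) \<in> U"
      using B2U by (intro kspace.subspace_sum[OF U] kspace.subspace_scale[OF U]) auto
    have "(\<Sum>b\<in>T. kscale (u b) b) - (\<Sum>b\<in>T \<inter> B2. kscale (u b) b) \<in> U"
      using T assms(3) s2 by (intro kspace.subspace_diff[OF U]) auto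
    hence "(\<Sum>b\<in>T \<inter> B1. kscale (u b) b) \<in> U" by (simp add: sum)
    hence u1: "u b = 0" if "b \<in> T \<inter> B1" for b
      using quot_basis_independent[OF B(1), of "T \<inter> B1" u b] T that by auto
    hence "(\<Sum>b\<in>T \<inter> B2. kscale (u b) b) \<in> W" using T sum by simp
    hence "u b = 0" if "b \<in> T \<inter> B2" for b
      using quot_basis_independent[OF B(3), of "T \<inter> B2" u b] T that by auto
    thus "u b = 0" using u1 T b by blast
  next
    fix v assume "v \<in> V"
    then obtain x where x: "x \<in> kspace.span B1" "v - x \<in> U" using quot_basis_spanning[OF B(1)] by blast
    then obtain y where y: "y \<in> kspace.span B2" "v - x - y \<in> W" using quot_basis_spanning[OF B(3)] by blast
    have "x + y \<in> kspace.span (B1 \<union> B2)"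
      using x y by (intro kspace.span_add) (auto intro: kspace.span_mono[THEN subsetD])
    thus "\<exists>x\<in>module.span kscale (B1 \<union> B2). v - x \<in> W"
      using y by (intro bexI[of _ "x + y"]) (simp add: diff_diff_eq)
  qed
  thus ?thesis using quot_dim_eq[OF W] quot_dim_eq[OF U] B disj by (simp add: card_Un_disjoint quot_dim_eq W U)
qed

section \<open>Multiplication by a fixed polynomial on quotients\<close>

lemma kscale_mult: "g * kscale a p = kscale a (g * p)"
  by (simp add: kscale_def mult.left_commute)

lemma kscale_mult_left: "kscale a p * g = kscale a (p * g)"
  by (simp add: kscale_def mult.assoc)

lemma lookup_kscale [simp]: "lookup (kscale a p) m = a * lookup p m"
  by (simp add: kscale_def map.rep_eq when_def flip: mult_map_scale_conv_mult)

lemma kspace_linear_mult: "module_hom kscale kscale ((*) g)"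
  for g :: "('n::finite, 'k::field) mpoly"
  by unfold_locales (simp_all add: distrib_left kscale_mult)

lemma subspace_mult_image:
  fixes g :: "('n::finite, 'k::field) mpoly"
  assumes "kspace.subspace V"
  shows "kspace.subspace ((*) g ` V)"
  using assms by (rule module_hom.subspace_image[OF kspace_linear_mult])

text \<open>Multiplication by g induces an isomorphism from V' / W' onto U / W. This is how colon
  ideals enter the dimension counts.\<close>

lemma quot_basis_mult:
  fixes g :: "('n::finite, 'k::field) mpoly"
  assumes g: "g \<noteq> 0" and W: "kspace.subspace W"
    and U: "U = {w + g * s | w s. w \<in> W \<and> s \<in> V'}" and W': "W' = {s \<in> V'. g * s \<in> W}"
    and V': "kspace.subspace V'" and B: "quot_basis V' W' B"
  shows "quot_basis U W ((*) g ` B)"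
  unfolding quot_basis_def
proof (intro conjI allI impI ballI)
  have inj: "inj_on ((*) g) A" for A
    using g by (intro inj_onI) (simp add: mpoly_mult_left_cancel)
  show "(*) g ` B \<subseteq> U"
    using quot_basis_subset[OF B] kspace.subspace_0[OF W] unfolding U by force
  fix T u b assume T: "finite T \<and> T \<subseteq> (*) g ` B \<and> (\<Sum>b\<in>T. kscale (u b) b) \<in> W" and b: "b \<in> T"
  then obtain S where S: "T = (*) g ` S" "S \<subseteq> B" by (auto simp: subset_image_iff)
  have finS: "finite S" using T S(1) inj finite_imageD by blast
  have "(\<Sum>b\<in>T. kscale (u b) b) = (\<Sum>s\<in>S. kscale (u (g * s)) (g * s))"
    unfolding S(1) using inj by (subst sum.reindex) auto
  also have "\<dots> = g * (\<Sum>s\<in>S. kscale (u (g * s)) s)" by (simp add: sum_distrib_left kscale_mult)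
  finally have "(\<Sum>s\<in>S. kscale (u (g * s)) s) \<in> W'"
    unfolding W' using T S(2) quot_basis_subset[OF B]
    by (auto intro!: kspace.subspace_sum[OF V'] kspace.subspace_scale[OF V'])
  hence "u (g * s) = 0" if "s \<in> S" for s
    using quot_basis_independent[OF B finS S(2), of "\<lambda>s. u (g * s)" s] that by auto
  thus "u b = 0" using b S(1) by auto
next
  fix v assume "v \<in> U"
  then obtain w s where ws: "v = w + g * s" "w \<in> W" "s \<in> V'" unfolding U by blast
  then obtain x where x: "x \<in> kspace.span B" "s - x \<in> W'" using quot_basis_spanning[OF B] by blast
  have "g * x \<in> kspace.span ((*) g ` B)"
    using x(1) by (simp add: module_hom.span_image[OF kspace_linear_mult])
  moreover have "v - g * x = w + g * (s - x)" using ws by (simp add: algebra_simps)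
  ultimately show "\<exists>x\<in>module.span kscale ((*) g ` B). v - x \<in> W"
    using x(2) ws(2) kspace.subspace_add[OF W] unfolding W' by (intro bexI[of _ "g * x"]) auto
qed

lemma quot_dim_mult:
  fixes g :: "('n::finite, 'k::field) mpoly"
  assumes g: "g \<noteq> 0" and W: "kspace.subspace W" and W'': "kspace.subspace W'"
    and U: "U = {w + g * s | w s. w \<in> W \<and> s \<in> V'}" and W': "W' = {s \<in> V'. g * s \<in> W}"
    and V': "kspace.subspace V'" and fin: "fin_quot V' W'"
  shows "fin_quot U W" "quot_dim U W = quot_dim V' W'"
proof -
  obtain B where B: "quot_basis V' W' B" "finite B" using fin by (auto simp: fin_quot_def)
  have gB: "quot_basis U W ((*) g ` B)" using quot_basis_mult[OF g W U W' V' B(1)] .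
  thus "fin_quot U W" using B(2) by (auto simp: fin_quot_def)
  have "card ((*) g ` B) = card B"
    using g by (intro card_image inj_onI) (simp add: mpoly_mult_left_cancel)
  thus "quot_dim U W = quot_dim V' W'"
    using quot_dim_eq[OF W gB] quot_dim_eq[OF W'' B(1)] B(2) by simp
qed

lemma quot_dim_eq_0_iff:
  assumes W: "kspace.subspace W" and fin: "fin_quot V W"
  shows "quot_dim V W = 0 \<longleftrightarrow> V \<subseteq> W"
proof -
  obtain B where B: "quot_basis V W B" "finite B" using fin by (auto simp: fin_quot_def)
  have "V \<subseteq> W" if "B = {}" using quot_basis_spanning[OF B(1)] that by auto
  moreover have "B = {}" if "V \<subseteq> W"
    using quot_basis_subset[OF B(1)] quot_basis_not_mem[OF B(1)] that by blast
  ultimately show ?thesis using quot_dim_eq[OF W B] B(2) by auto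
qed


section \<open>Graded ideals\<close>

lemma mon_deg_add: "mon_deg (m + m') = mon_deg m + mon_deg m'"
  by (simp add: mon_deg_def lookup_add sum.distrib)

lemma mon_deg_zero [simp]: "mon_deg 0 = 0"
  by (simp add: mon_deg_def)

text \<open>Common form of \<open>hom_comp\<close> and \<open>trunc\<close>, so that their behaviour
  on products is settled once.\<close>

definition restr :: "(('n \<Rightarrow>\<^sub>0 nat) \<Rightarrow> bool) \<Rightarrow> ('n, 'k::comm_monoid_add) mpoly \<Rightarrow> ('n, 'k) mpoly" where
  "restr P p = (\<Sum>m\<in>{m\<in>keys p. P m}. single m (lookup p m))"

lemma lookup_restr: "lookup (restr P p) m = (if P m then lookup p m else 0)"
proof -
  have "lookup (restr P p) m =
      (\<Sum>m'\<in>{m\<in>keys p. P m}. if m' = m then lookup p m else 0)"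
    unfolding restr_def lookup_sum by (intro sum.cong) (auto simp: lookup_single when_def)
  thus ?thesis by (auto simp: in_keys_iff)
qed

lemma keys_restr: "keys (restr P p) = {m \<in> keys p. P m}"
  by (auto simp: in_keys_iff lookup_restr split: if_splits)

text \<open>The hypothesis says that the first factor alone decides whether a product monomial is
  kept, as happens when q is a form and P depends on the degree.\<close>

lemma restr_mult:
  fixes p q :: "('n, 'k::comm_ring_1) mpoly"
  assumes "\<And>m k. m \<in> keys p \<Longrightarrow> k \<in> keys q \<Longrightarrow> P (m + k) \<longleftrightarrow> P' m"
  shows "restr P (p * q) = restr P' p * q"
proof -
  let ?r = "restr P' p"
  have "P x" if x: "x \<in> keys (?r * q)" for x
    using subsetD[OF keys_mult x] assms by (auto simp: keys_restr)
  moreover have "\<not> P x" if x: "x \<in> keys ((p - ?r) * q)" for x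
  proof -
    obtain a b where "x = a + b" "a \<in> keys (p - ?r)" "b \<in> keys q"
      using subsetD[OF keys_mult x] by auto
    thus ?thesis using assms[of a b] by (auto simp: in_keys_iff lookup_minus lookup_restr split: if_splits)
  qed
  moreover have "p * q = ?r * q + (p - ?r) * q" by (simp add: algebra_simps)
  ultimately show ?thesis
    by (intro poly_mapping_eqI) (auto simp: lookup_restr lookup_add in_keys_iff)
qed

lemma restr_add: "restr P (p + q) = restr P p + restr P q"
  by (intro poly_mapping_eqI) (simp add: lookup_restr lookup_add)

lemma restr_kscale: "restr P (kscale a p) = kscale a (restr P p)"
  by (intro poly_mapping_eqI) (simp add: lookup_restr)

lemma restr_zero [simp]: "restr P 0 = 0"
  by (intro poly_mapping_eqI) (simp add: lookup_restr)

lemma hom_comp_restr: "hom_comp d p = restr (\<lambda>m. mon_deg m = d) p"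
  by (simp add: hom_comp_def restr_def)

lemma lookup_hom_comp:
  "lookup (hom_comp d p) m = (if mon_deg m = d then lookup p m else 0)"
  by (simp add: hom_comp_restr lookup_restr)

lemma hom_comp_zero [simp]: "hom_comp d 0 = 0"
  by (simp add: hom_comp_restr)

lemma hom_comp_forms: "hom_comp d p \<in> forms d"
  by (simp add: hom_comp_restr forms_def keys_restr)

lemma hom_comp_add: "hom_comp d (p + q) = hom_comp d p + hom_comp d q"
  by (simp add: hom_comp_restr restr_add)

lemma hom_comp_sum: "hom_comp d (sum f A) = (\<Sum>x\<in>A. hom_comp d (f x))"
  by (induction A rule: infinite_finite_induct) (simp_all add: hom_comp_add)

lemma hom_comp_form: "p \<in> forms e \<Longrightarrow> hom_comp d p = (if d = e then p else 0)"
  by (intro poly_mapping_eqI) (auto simp: lookup_hom_comp forms_def in_keys_iff)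

lemma hom_comp_mult_form:
  fixes p q :: "('n::finite, 'k::comm_ring_1) mpoly"
  assumes "q \<in> forms e"
  shows "hom_comp (d + e) (p * q) = hom_comp d p * q"
  unfolding hom_comp_restr using assms
  by (intro restr_mult) (auto simp: forms_def mon_deg_add)

lemma hom_comp_mult_form_less:
  fixes p q :: "('n::finite, 'k::comm_ring_1) mpoly"
  assumes "q \<in> forms e" "d < e"
  shows "hom_comp d (p * q) = 0"
proof -
  have "hom_comp d (p * q) = restr (\<lambda>_. False) p * q"
    unfolding hom_comp_restr using assms by (intro restr_mult) (auto simp: forms_def mon_deg_add)
  thus ?thesis by (simp add: restr_def)
qed

definition polys_le :: "nat \<Rightarrow> ('n::finite, 'k::zero) mpoly set" where
  "polys_le d = {p. \<forall>m\<in>keys p. mon_deg m \<le> d}"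

lemma hom_comp_eq_0:
  assumes "p \<in> polys_le D" "D < d"
  shows "hom_comp d p = 0"
proof (intro poly_mapping_eqI)
  fix m
  have "lookup p m = 0" if "mon_deg m = d"
    using assms that unfolding polys_le_def by (cases "m \<in> keys p") (force, simp add: in_keys_iff)
  thus "lookup (hom_comp d p) m = lookup 0 m" by (simp add: lookup_hom_comp)
qed

definition trunc :: "nat \<Rightarrow> ('n::finite, 'k::comm_monoid_add) mpoly \<Rightarrow> ('n, 'k) mpoly" where
  "trunc d = restr (\<lambda>m. mon_deg m \<le> d)"

lemma trunc_polys_le: "trunc d p \<in> polys_le d"
  by (simp add: trunc_def polys_le_def keys_restr)

lemma trunc_id: "p \<in> polys_le d \<Longrightarrow> trunc d p = p"
  by (intro poly_mapping_eqI) (auto simp: trunc_def lookup_restr polys_le_def in_keys_iff)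

lemma trunc_add: "trunc d (p + q) = trunc d p + trunc d q"
  by (simp add: trunc_def restr_add)

lemma trunc_mult_form:
  fixes p q :: "('n::finite, 'k::comm_ring_1) mpoly"
  assumes "q \<in> forms e"
  shows "trunc (d + e) (p * q) = trunc d p * q"
  unfolding trunc_def using assms
  by (intro restr_mult) (auto simp: forms_def mon_deg_add)

lemma trunc_mult_form_less:
  fixes p q :: "('n::finite, 'k::comm_ring_1) mpoly"
  assumes "q \<in> forms e" "d < e"
  shows "trunc d (p * q) = 0"
proof -
  have "trunc d (p * q) = restr (\<lambda>_. False) p * q"
    unfolding trunc_def using assms by (intro restr_mult) (auto simp: forms_def mon_deg_add)
  thus ?thesis by (simp add: restr_def)
qed

lemma trunc_sum: "trunc d p = (\<Sum>j\<le>d. hom_comp j p)"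
  by (intro poly_mapping_eqI) (auto simp: trunc_def lookup_restr lookup_sum lookup_hom_comp)

lemma polys_le_exists: "\<exists>d. p \<in> polys_le d"
  by (rule exI[of _ "\<Sum>m\<in>keys p. mon_deg m"])
    (auto simp: polys_le_def intro: member_le_sum)

lemma polys_le_mono: "d \<le> d' \<Longrightarrow> polys_le d \<subseteq> polys_le d'"
  by (force simp: polys_le_def)

lemma forms_polys_le: "forms d \<subseteq> polys_le d"
  by (auto simp: forms_def polys_le_def)

lemma one_polys_le [simp]: "1 \<in> polys_le d"
  by (simp add: polys_le_def)

lemma polys_le_mult:
  fixes p q :: "('n::finite, 'k::comm_ring_1) mpoly"
  shows "p \<in> polys_le d \<Longrightarrow> q \<in> polys_le d' \<Longrightarrow> p * q \<in> polys_le (d + d')"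
  using keys_mult[of p q] by (force simp: polys_le_def mon_deg_add)

lemma forms_mult:
  fixes p q :: "('n::finite, 'k::comm_ring_1) mpoly"
  shows "p \<in> forms d \<Longrightarrow> q \<in> forms d' \<Longrightarrow> p * q \<in> forms (d + d')"
  using keys_mult[of p q] by (force simp: forms_def mon_deg_add)

lemma hom_comp_exists:
  assumes "\<And>d. hom_comp d p \<in> J" "is_ideal J"
  shows "p \<in> J"
proof -
  obtain d where "p \<in> polys_le d" using polys_le_exists by blast
  hence "p = (\<Sum>j\<le>d. hom_comp j p)" by (metis trunc_id trunc_sum)
  thus ?thesis using assms is_ideal_sum by metis
qed

lemma graded_ideal_is_ideal: "graded_ideal I \<Longrightarrow> is_ideal I"
  and graded_ideal_hom_comp: "graded_ideal I \<Longrightarrow> p \<in> I \<Longrightarrow> hom_comp d p \<in> I"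
  by (simp_all add: graded_ideal_def)

lemma graded_ideal_trunc: "graded_ideal I \<Longrightarrow> p \<in> I \<Longrightarrow> trunc d p \<in> I"
  by (simp add: trunc_sum is_ideal_sum graded_ideal_is_ideal graded_ideal_hom_comp)

lemma graded_ideal_adj:
  fixes J :: "('n::finite, 'k::comm_ring_1) mpoly set"
  assumes "graded_ideal J" "g \<in> forms e"
  shows "graded_ideal (adj J g)"
  unfolding graded_ideal_def
proof (intro conjI ballI allI)
  fix p d assume "p \<in> adj J g"
  then obtain s where s: "p - s * g \<in> J" using assms by (auto simp: mem_adj_iff graded_ideal_is_ideal)
  have "hom_comp d p = hom_comp d (p - s * g) + hom_comp d (s * g)"
    by (simp flip: hom_comp_add)
  moreover have "hom_comp d (p - s * g) \<in> adj J g"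
    using graded_ideal_hom_comp[OF assms(1) s] adj_superset by blast
  moreover have "hom_comp d (s * g) \<in> adj J g"
  proof (cases "e \<le> d")
    case True
    hence "hom_comp d (s * g) = hom_comp (d - e) s * g" using hom_comp_mult_form[OF assms(2), of "d - e" s] by simp
    thus ?thesis by (simp add: is_ideal_mult adj_mem)
  qed (simp add: hom_comp_mult_form_less[OF assms(2)] is_ideal_0)
  ultimately show "hom_comp d p \<in> adj J g" by (simp add: is_ideal_add)
qed auto

lemma graded_ideal_colon:
  fixes J :: "('n::finite, 'k::comm_ring_1) mpoly set"
  assumes "graded_ideal J" "g \<in> forms e"
  shows "graded_ideal (ideal_colon J g)"
  unfolding graded_ideal_def
proof (intro conjI ballI allI)
  fix p d assume "p \<in> ideal_colon J g"
  thus "hom_comp d p \<in> ideal_colon J g"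
    using graded_ideal_hom_comp[OF assms(1), of "p * g" "d + e"] hom_comp_mult_form[OF assms(2), of d p]
    by (simp add: ideal_colon_def)
qed (simp add: is_ideal_colon assms graded_ideal_is_ideal)

lemma graded_ideal_zero: "graded_ideal {0}"
  by (simp add: graded_ideal_def)

lemma graded_ideal_ideal_gen:
  fixes A :: "('n::finite, 'k::comm_ring_1) mpoly set"
  assumes "A \<subseteq> (\<Union>d. forms d)"
  shows "graded_ideal (ideal_gen A)"
  unfolding graded_ideal_def
proof (intro conjI ballI allI)
  fix p d assume "p \<in> ideal_gen A"
  hence "\<forall>d. hom_comp d p \<in> ideal_gen A"
    unfolding ideal_gen_def
  proof (induction rule: ring_module.span_induct_alt)
    case (step c x y)
    have "{x} \<subseteq> (\<Union>d. forms d)" using assms step by blast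
    then obtain e where e: "x \<in> forms e" by blast
    have "x \<in> ring_module.span A" using step by (simp add: ring_module.span_base)
    moreover have "hom_comp d (c * x) = 0 \<or> hom_comp d (c * x) = hom_comp (d - e) c * x" for d
      using hom_comp_mult_form[OF e, of "d - e" c] hom_comp_mult_form_less[OF e, of d c]
      by (cases "e \<le> d") auto
    ultimately have "hom_comp d (c * x) \<in> ring_module.span A" for d
      by (metis ring_module.span_scale ring_module.span_zero)
    thus ?case using step by (simp add: hom_comp_add ring_module.span_add)
  qed (simp add: ring_module.span_zero)
  thus "hom_comp d p \<in> ideal_gen A" by blast
qed auto

text \<open>If p and q are outside J, let i and j be the lowest degrees of components outside J. In
  degree i + j of p q, every other product of components lies in J.\<close>

lemma graded_prime_idealI:
  fixes J :: "('n::finite, 'k::comm_ring_1) mpoly set"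
  assumes J: "graded_ideal J" "J \<noteq> UNIV"
    and forms: "\<And>a b d e. a \<in> forms d \<Longrightarrow> b \<in> forms e \<Longrightarrow> a * b \<in> J \<Longrightarrow> a \<in> J \<or> b \<in> J"
  shows "is_prime_ideal J"
  unfolding is_prime_ideal_def
proof (intro conjI allI impI)
  note I = graded_ideal_is_ideal[OF J(1)]
  fix p q assume pq: "p * q \<in> J"
  show "p \<in> J \<or> q \<in> J"
  proof (rule ccontr)
    assume neg: "\<not> (p \<in> J \<or> q \<in> J)"
    define i where "i = (LEAST i. hom_comp i p \<notin> J)"
    define j where "j = (LEAST j. hom_comp j q \<notin> J)"
    have ex: "\<exists>i. hom_comp i p \<notin> J" "\<exists>j. hom_comp j q \<notin> J"
      using neg hom_comp_exists[OF _ I] by blast+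
    have ij: "hom_comp i p \<notin> J" "hom_comp j q \<notin> J"
      unfolding i_def j_def using LeastI_ex[OF ex(1)] LeastI_ex[OF ex(2)] by blast+
    have less: "hom_comp a p \<in> J" if "a < i" for a using not_less_Least[of a "\<lambda>i. hom_comp i p \<notin> J"] that by (auto simp: i_def)
    have less': "hom_comp b q \<in> J" if "b < j" for b using not_less_Least[of b "\<lambda>i. hom_comp i q \<notin> J"] that by (auto simp: j_def)
    obtain D where D: "q \<in> polys_le D" using polys_le_exists by blast
    have "hom_comp (i + j) (p * q) = (\<Sum>b\<le>D. hom_comp (i + j) (p * hom_comp b q))"
      using arg_cong[OF trunc_id[OF D], of "\<lambda>q. hom_comp (i + j) (p * q)"]
      by (simp add: trunc_sum sum_distrib_left hom_comp_sum)
    \<comment> \<open>The range is enlarged so that it certainly contains j, whose summand is split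
      off next.\<close>
    also have "\<dots> = (\<Sum>b\<le>D + j. hom_comp (i + j) (p * hom_comp b q))"
    proof (rule sum.mono_neutral_left)
      have "hom_comp b q = 0" if "b > D" for b
        using D that by (rule hom_comp_eq_0)
      thus "\<forall>b\<in>{..D + j} - {..D}. hom_comp (i + j) (p * hom_comp b q) = 0" by simp
    qed auto
    also have "\<dots> = hom_comp (i + j) (p * hom_comp j q) + (\<Sum>b\<in>{..D + j} - {j}. hom_comp (i + j) (p * hom_comp b q))"
      by (rule sum.remove) auto
    finally have eq: "hom_comp (i + j) (p * q) = hom_comp i p * hom_comp j q + (\<Sum>b\<in>{..D + j} - {j}. hom_comp (i + j) (p * hom_comp b q))"
      by (simp add: hom_comp_mult_form[OF hom_comp_forms])
    have "hom_comp (i + j) (p * hom_comp b q) \<in> J" if "b \<noteq> j" for b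
    proof (cases "b < j")
      case True
      thus ?thesis using graded_ideal_hom_comp[OF J(1) is_ideal_mult[OF I less']] by simp
    next
      case False
      show ?thesis
      proof (cases "b \<le> i + j")
        case True
        hence "hom_comp (i + j) (p * hom_comp b q) = hom_comp (i + j - b) p * hom_comp b q"
          using hom_comp_mult_form[OF hom_comp_forms[of b q], of "i + j - b" p] by simp
        moreover have "i + j - b < i" using False that True by auto
        ultimately show ?thesis using less is_ideal_mult_right[OF I] by simp
      qed (simp add: hom_comp_mult_form_less[OF hom_comp_forms] is_ideal_0[OF I])
    qed
    hence "(\<Sum>b\<in>{..D + j} - {j}. hom_comp (i + j) (p * hom_comp b q)) \<in> J"
      by (intro is_ideal_sum[OF I]) auto
    moreover have "hom_comp (i + j) (p * q) \<in> J" using graded_ideal_hom_comp[OF J(1) pq] .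
    ultimately have "hom_comp i p * hom_comp j q \<in> J"
      using eq is_ideal_diff[OF I] by (metis add_diff_cancel_right')
    thus False using forms[OF hom_comp_forms hom_comp_forms] ij by blast
  qed
qed (use J graded_ideal_is_ideal in auto)

lemma maximal_graded_ideal_exists:
  fixes I :: "('n::finite, 'k::field) mpoly set"
  assumes "graded_ideal I" "P I"
  obtains J where "graded_ideal J" "I \<subseteq> J" "P J" "\<And>J'. graded_ideal J' \<Longrightarrow> J \<subset> J' \<Longrightarrow> \<not> P J'"
proof -
  obtain J where "is_ideal J" "I \<subseteq> J" "graded_ideal J \<and> P J"
    "\<And>J'. is_ideal J' \<Longrightarrow> J \<subset> J' \<Longrightarrow> \<not> (graded_ideal J' \<and> P J')"
    using maximal_ideal_exists[of I "\<lambda>J. graded_ideal J \<and> P J"] assms graded_ideal_is_ideal by blast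
  thus ?thesis using that graded_ideal_is_ideal by metis
qed

section \<open>The affine Hilbert function\<close>

lemma is_ideal_subspace: "is_ideal I \<Longrightarrow> kspace.subspace I"
  for I :: "('n, 'k::field) mpoly set"
  by (intro kspace.subspaceI) (auto simp: kscale_def is_ideal_0 is_ideal_add is_ideal_mult)

lemma subspace_polys_le: "kspace.subspace (polys_le d :: ('n::finite, 'k::field) mpoly set)"
proof (rule kspace.subspaceI)
  fix p q :: "('n, 'k) mpoly" assume "p \<in> polys_le d" "q \<in> polys_le d"
  thus "p + q \<in> polys_le d" using Poly_Mapping.keys_add[of p q] by (force simp: polys_le_def)
qed (auto simp: polys_le_def in_keys_iff)

lemma subspace_forms: "kspace.subspace (forms d :: ('n::finite, 'k::field) mpoly set)"
proof (rule kspace.subspaceI)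
  fix p q :: "('n, 'k) mpoly" assume "p \<in> forms d" "q \<in> forms d"
  thus "p + q \<in> forms d" using Poly_Mapping.keys_add[of p q] by (force simp: forms_def)
qed (auto simp: forms_def in_keys_iff)

lemma finite_mon_deg_le: "finite {m :: 'n::finite \<Rightarrow>\<^sub>0 nat. mon_deg m \<le> d}"
proof (rule finite_imageD)
  have "lookup m i \<le> d" if "mon_deg m \<le> d" for m :: "'n \<Rightarrow>\<^sub>0 nat" and i
    using that member_le_sum[of i UNIV "lookup m"] by (auto simp: mon_deg_def)
  hence "lookup ` {m :: 'n \<Rightarrow>\<^sub>0 nat. mon_deg m \<le> d} \<subseteq> PiE UNIV (\<lambda>_. {..d})"
    by auto
  thus "finite (lookup ` {m :: 'n \<Rightarrow>\<^sub>0 nat. mon_deg m \<le> d})"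
    by (rule finite_subset) (intro finite_PiE, simp_all)
  show "inj_on lookup {m :: 'n \<Rightarrow>\<^sub>0 nat. mon_deg m \<le> d}"
    by (simp add: inj_on_def poly_mapping.lookup_inject)
qed

lemma mpoly_sum_monomials:
  fixes p :: "('n, 'k::field) mpoly"
  shows "p = (\<Sum>m\<in>keys p. kscale (lookup p m) (single m 1))"
  by (intro poly_mapping_eqI)
    (simp add: lookup_sum lookup_single when_def in_keys_iff if_distrib cong: if_cong)

lemma polys_le_span:
  "polys_le d \<subseteq> kspace.span ((\<lambda>m. single m 1) ` {m. mon_deg m \<le> d})"
proof
  fix p :: "('a::finite, 'b::field) mpoly" assume "p \<in> polys_le d"
  hence "(\<Sum>m\<in>keys p. kscale (lookup p m) (single m 1)) \<in>
      kspace.span ((\<lambda>m. single m 1) ` {m. mon_deg m \<le> d})"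
    by (intro kspace.span_sum kspace.span_scale kspace.span_base) (auto simp: polys_le_def)
  thus "p \<in> kspace.span ((\<lambda>m. single m 1) ` {m. mon_deg m \<le> d})"
    using mpoly_sum_monomials[of p] by simp
qed

lemma fin_quot_polys_le:
  fixes V W :: "('n::finite, 'k::field) mpoly set"
  assumes "kspace.subspace V" "kspace.subspace W" "W \<subseteq> V" "V \<subseteq> polys_le d"
  shows "fin_quot V W"
  using quot_basis_exists[OF assms(1-3) finite_imageI[OF finite_mon_deg_le]] assms(4) polys_le_span by blast

definition adim :: "('n::finite, 'k::field) mpoly set \<Rightarrow> nat \<Rightarrow> nat" where
  "adim J d = quot_dim (polys_le d) (J \<inter> polys_le d)"

lemma subspace_cut: "is_ideal J \<Longrightarrow> kspace.subspace (J \<inter> polys_le d)"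
  for J :: "('n::finite, 'k::field) mpoly set"
  by (intro kspace.subspace_inter is_ideal_subspace subspace_polys_le)

lemma subspace_sum_image:
  fixes g :: "('n::finite, 'k::field) mpoly"
  assumes "kspace.subspace W" "kspace.subspace V"
  shows "kspace.subspace {w + g * s | w s. w \<in> W \<and> s \<in> V}"
proof -
  have "{w + g * s | w s. w \<in> W \<and> s \<in> V} = {x + y | x y. x \<in> W \<and> y \<in> (*) g ` V}" by blast
  thus ?thesis using kspace.subspace_sums[OF assms(1) subspace_mult_image[OF assms(2)]] by simp
qed

text \<open>Between the truncations of J and J' lies the space of all w + g s with s of degree at
  most d - a. Modulo J it is isomorphic to the truncation of S/(J : g) at d - a. It may miss
  elements of J' whose representations need larger degrees, hence only an inequality in
  general.\<close>

lemma adim_mult_le: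
  fixes J J' :: "('n::finite, 'k::field) mpoly set"
  assumes J: "is_ideal J" and J': "is_ideal J'" and g: "g \<noteq> 0" "g \<in> polys_le a" and "a \<le> d"
    and sub: "J \<subseteq> J'" "g \<in> J'"
  shows "adim J' d + adim (ideal_colon J g) (d - a) \<le> adim J d"
    and "J' \<inter> polys_le d \<subseteq> {w + g * s | w s. w \<in> J \<inter> polys_le d \<and> s \<in> polys_le (d - a)} \<Longrightarrow>
      adim J' d + adim (ideal_colon J g) (d - a) = adim J d"
proof -
  let ?V = "polys_le d :: ('n, 'k) mpoly set"
  let ?W = "J \<inter> polys_le d"
  let ?U = "{w + g * s | w s. w \<in> ?W \<and> s \<in> (polys_le (d - a) :: ('n, 'k) mpoly set)}"
  have UJ: "?U \<subseteq> J' \<inter> polys_le d"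
  proof safe
    fix w s :: "('n, 'k) mpoly" assume ws: "w \<in> J" "w \<in> polys_le d" "s \<in> polys_le (d - a)"
    show "w + g * s \<in> J'" using ws sub by (intro is_ideal_add[OF J'] is_ideal_mult_right[OF J']) auto
    have "g * s \<in> polys_le d" using polys_le_mult[OF g(2) ws(3)] assms(5) by simp
    thus "w + g * s \<in> polys_le d" using kspace.subspace_add[OF subspace_polys_le] ws by blast
  qed
  have sU: "kspace.subspace ?U" by (intro subspace_sum_image subspace_cut J subspace_polys_le)
  have WU: "?W \<subseteq> ?U"
  proof
    fix w assume "w \<in> ?W"
    thus "w \<in> ?U" using kspace.subspace_0[OF subspace_polys_le, of "d - a"]
      by (intro CollectI exI[of _ w] exI[of _ 0]) auto
  qed
  have colon: "ideal_colon J g \<inter> polys_le (d - a) = {s \<in> polys_le (d - a). g * s \<in> ?W}"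
    using polys_le_mult[OF g(2), of _ "d - a"] assms(5) by (auto simp: ideal_colon_def mult.commute)
  have fin: "fin_quot (polys_le (d - a)) (ideal_colon J g \<inter> polys_le (d - a))"
    by (intro fin_quot_polys_le[OF subspace_polys_le]) (auto intro: subspace_cut is_ideal_colon[OF J])
  have iso: "quot_dim ?U ?W = adim (ideal_colon J g) (d - a)"
    unfolding adim_def
    by (rule quot_dim_mult(2)[OF g(1) subspace_cut[OF J] _ refl colon subspace_polys_le fin])
      (intro subspace_cut is_ideal_colon J)
  have fins: "fin_quot ?V (J' \<inter> polys_le d)" "fin_quot (J' \<inter> polys_le d) ?U" "fin_quot ?U ?W"
      "fin_quot (J' \<inter> polys_le d) ?W"
    using sub by (intro fin_quot_polys_le[where d = d] subspace_polys_le subspace_cut J J' sU UJ WU subset_refl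
      Int_lower2 Int_mono order_trans[OF UJ Int_lower2])+
  have 1: "adim J d = adim J' d + quot_dim (J' \<inter> polys_le d) ?W"
    unfolding adim_def
    using quot_dim_trans[OF subspace_cut[OF J'] subspace_cut[OF J] _ _ fins(1,4)] sub by auto
  have 2: "quot_dim (J' \<inter> polys_le d) ?W = quot_dim (J' \<inter> polys_le d) ?U + quot_dim ?U ?W"
    by (rule quot_dim_trans[OF sU subspace_cut[OF J] WU UJ fins(2,3)])
  show "adim J' d + adim (ideal_colon J g) (d - a) \<le> adim J d" using 1 2 iso by simp
  assume "J' \<inter> polys_le d \<subseteq> ?U"
  hence "quot_dim (J' \<inter> polys_le d) ?U = 0" using quot_dim_eq_0_iff[OF sU fins(2)] by simp
  thus "adim J' d + adim (ideal_colon J g) (d - a) = adim J d" using 1 2 iso by simp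
qed

lemma adim_quotient:
  assumes "is_ideal J" "is_ideal J'" "J \<subseteq> J'"
  shows "adim J d = adim J' d + quot_dim (J' \<inter> polys_le d) (J \<inter> polys_le d)"
  unfolding adim_def
  by (rule quot_dim_trans)
    (use assms in \<open>auto intro!: fin_quot_polys_le[where d = d] subspace_polys_le subspace_cut\<close>)

lemma adim_antimono: "is_ideal J \<Longrightarrow> is_ideal J' \<Longrightarrow> J \<subseteq> J' \<Longrightarrow> adim J' d \<le> adim J d"
  using adim_quotient[of J J' d] by simp

lemma adim_strict_antimono:
  assumes "is_ideal J" "is_ideal J'" "J \<subseteq> J'" "u \<in> J'" "u \<notin> J" "u \<in> polys_le d"
  shows "adim J' d < adim J d"
proof -
  have fin: "fin_quot (J' \<inter> polys_le d) (J \<inter> polys_le d)"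
    using assms by (auto intro!: fin_quot_polys_le[where d = d] subspace_cut)
  have "quot_dim (J' \<inter> polys_le d) (J \<inter> polys_le d) \<noteq> 0"
    using quot_dim_eq_0_iff[OF subspace_cut fin] assms by blast
  thus ?thesis using adim_quotient[OF assms(1-3), of d] by simp
qed

lemma adim_UNIV [simp]: "adim UNIV d = 0"
  using quot_dim_eq_0_iff[OF subspace_polys_le fin_quot_polys_le[OF subspace_polys_le subspace_polys_le]]
  by (auto simp: adim_def)

lemma adim_pos:
  assumes "is_ideal J" "J \<noteq> UNIV"
  shows "adim J d > 0"
  using adim_strict_antimono[of J UNIV 1 d] assms is_ideal_UNIV_iff[of J] by simp

text \<open>Modulo J, the space U is the image of the polynomials of degree at most d. The kernel of
  that map is the part of J in degrees up to d, whatever d' is.\<close>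

lemma adim_filtration:
  assumes J: "is_ideal J" and "d \<le> d'"
  defines "U \<equiv> {w + s | w s. w \<in> J \<inter> polys_le d' \<and> s \<in> polys_le d}"
  shows "kspace.subspace U" "J \<inter> polys_le d' \<subseteq> U" "U \<subseteq> polys_le d'"
    and "adim J d' = quot_dim (polys_le d') U + adim J d"
proof -
  have eq: "U = {w + 1 * s | w s. w \<in> J \<inter> polys_le d' \<and> s \<in> polys_le d}" by (simp add: U_def)
  show sU: "kspace.subspace U" unfolding eq by (intro subspace_sum_image subspace_cut J subspace_polys_le)
  show WU: "J \<inter> polys_le d' \<subseteq> U"
  proof
    fix w assume "w \<in> J \<inter> polys_le d'"
    thus "w \<in> U" using kspace.subspace_0[OF subspace_polys_le, of d]
      unfolding U_def by (intro CollectI exI[of _ w] exI[of _ 0]) auto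
  qed
  show UV: "U \<subseteq> polys_le d'"
    unfolding U_def using polys_le_mono[OF assms(2)] kspace.subspace_add[OF subspace_polys_le] by blast
  have "fin_quot (polys_le d) (J \<inter> polys_le d)"
    by (intro fin_quot_polys_le[where d = d]) (auto intro: subspace_polys_le subspace_cut J)
  hence "quot_dim U (J \<inter> polys_le d') = adim J d"
    unfolding adim_def eq using polys_le_mono[OF assms(2)]
    by (intro quot_dim_mult(2)[OF _ subspace_cut[OF J] _ refl _ subspace_polys_le])
      (auto intro: subspace_cut J)
  moreover have "adim J d' = quot_dim (polys_le d') U + quot_dim U (J \<inter> polys_le d')"
    unfolding adim_def
    by (rule quot_dim_trans[OF sU subspace_cut[OF J] WU UV])
      (use WU UV in \<open>auto intro!: fin_quot_polys_le[where d = d'] sU subspace_cut J subspace_polys_le\<close>)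
  ultimately show "adim J d' = quot_dim (polys_le d') U + adim J d" by simp
qed

lemma adim_mono: "is_ideal J \<Longrightarrow> d \<le> d' \<Longrightarrow> adim J d \<le> adim J d'"
  using adim_filtration(4)[of J d d'] by simp

text \<open>Once \<open>adim J\<close> is constant, every polynomial is congruent modulo J to one of
  degree at most d, so a basis of that truncation serves for all of S/J.\<close>

lemma quot_dim_UNIV:
  assumes J: "is_ideal J" and const: "\<And>d'. d' \<ge> d \<Longrightarrow> adim J d' = adim J d"
  shows "quot_dim UNIV J = adim J d"
proof -
  have cover: "\<exists>w\<in>J. v - w \<in> polys_le d" for v
  proof -
    obtain d0 where "v \<in> polys_le d0" using polys_le_exists by blast
    hence v: "v \<in> polys_le (max d d0)" using polys_le_mono[of d0 "max d d0"] by auto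
    let ?U = "{w + s | w s. w \<in> J \<inter> polys_le (max d d0) \<and> s \<in> polys_le d}"
    note f = adim_filtration[OF J max.cobounded1[of d d0]]
    have "quot_dim (polys_le (max d d0)) ?U = 0" using f(4) const[of "max d d0"] by simp
    moreover have "fin_quot (polys_le (max d d0)) ?U"
      using f by (intro fin_quot_polys_le[where d = "max d d0"] subspace_polys_le) auto
    ultimately have "polys_le (max d d0) \<subseteq> ?U" using quot_dim_eq_0_iff[OF f(1)] by blast
    with v obtain w s where "v = w + s" "w \<in> J" "s \<in> polys_le d" by blast
    thus ?thesis by (intro bexI[of _ w]) auto
  qed
  obtain B where B: "finite B" "quot_basis (polys_le d) (J \<inter> polys_le d) B"
    using fin_quot_polys_le[OF subspace_polys_le subspace_cut[OF J], of d] by (auto simp: fin_quot_def)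
  have "quot_basis UNIV J B"
    unfolding quot_basis_def
  proof (intro conjI allI impI ballI)
    fix T u b assume T: "finite T \<and> T \<subseteq> B \<and> (\<Sum>b\<in>T. kscale (u b) b) \<in> J" "b \<in> T"
    have "(\<Sum>b\<in>T. kscale (u b) b) \<in> polys_le d"
      using T quot_basis_subset[OF B(2)] by (intro kspace.subspace_sum kspace.subspace_scale subspace_polys_le) auto
    thus "u b = 0" using quot_basis_independent[OF B(2), of T u b] T by auto
  next
    fix v
    obtain w where w: "w \<in> J" "v - w \<in> polys_le d" using cover by blast
    then obtain x where x: "x \<in> kspace.span B" "v - w - x \<in> J" using quot_basis_spanning[OF B(2)] by blast
    have "v - x = (v - w - x) + w" by simp
    hence "v - x \<in> J" using is_ideal_add[OF J x(2) w(1)] by metis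
    thus "\<exists>x\<in>module.span kscale B. v - x \<in> J" using x(1) by blast
  qed simp
  hence "quot_dim UNIV J = card B" using quot_dim_eq[OF is_ideal_subspace[OF J]] B(1) by blast
  thus ?thesis using quot_dim_eq[OF subspace_cut[OF J] B(2,1)] by (simp add: adim_def)
qed

text \<open>For graded J, taking the top component identifies the quotient by U in
  \<open>adim_filtration\<close> with the graded piece of degree d + 1.\<close>

lemma hilbert_fun_Suc:
  fixes J :: "('n::finite, 'k::field) mpoly set"
  assumes J: "graded_ideal J"
  shows "adim J (Suc d) = hilbert_fun J (Suc d) + adim J d"
proof -
  note I = graded_ideal_is_ideal[OF J]
  let ?U = "{w + s | w s. w \<in> J \<inter> polys_le (Suc d) \<and> s \<in> polys_le d}"
  note f = adim_filtration[OF I le_SucI[OF order_refl[of d]]]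
  have dec: "\<exists>s\<in>polys_le d. v = hom_comp (Suc d) v + s" if "v \<in> polys_le (Suc d)" for v :: "('n, 'k) mpoly"
  proof
    show "v = hom_comp (Suc d) v + trunc d v"
      using trunc_id[OF that] by (simp add: trunc_sum add.commute)
  qed (rule trunc_polys_le)
  have fU: "hom_comp (Suc d) v \<in> J" if "v \<in> ?U" for v
  proof -
    from that obtain w s where ws: "v = w + s" "w \<in> J" "s \<in> polys_le d" by blast
    have "hom_comp (Suc d) s = 0"
      using ws(3) by (rule hom_comp_eq_0) simp
    thus ?thesis using ws graded_ideal_hom_comp[OF J] by (simp add: hom_comp_add)
  qed
  have sW: "kspace.subspace (J \<inter> forms (Suc d))"
    by (intro kspace.subspace_inter is_ideal_subspace I subspace_forms)
  have "fin_quot (forms (Suc d)) (J \<inter> forms (Suc d))"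
    using forms_polys_le by (intro fin_quot_polys_le[where d = "Suc d"] sW subspace_forms) auto
  then obtain B where B: "finite B" "quot_basis (forms (Suc d)) (J \<inter> forms (Suc d)) B"
    by (auto simp: fin_quot_def)
  have Bf: "B \<subseteq> forms (Suc d)" using quot_basis_subset[OF B(2)] .
  have "quot_basis (polys_le (Suc d)) ?U B"
    unfolding quot_basis_def
  proof (intro conjI allI impI ballI)
    show "B \<subseteq> polys_le (Suc d)" using Bf forms_polys_le by blast
    fix T u b assume T: "finite T \<and> T \<subseteq> B \<and> (\<Sum>b\<in>T. kscale (u b) b) \<in> ?U" "b \<in> T"
    have form: "(\<Sum>b\<in>T. kscale (u b) b) \<in> forms (Suc d)"
      using T Bf by (intro kspace.subspace_sum kspace.subspace_scale subspace_forms) auto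
    have "hom_comp (Suc d) (\<Sum>b\<in>T. kscale (u b) b) \<in> J" using T fU by blast
    hence "(\<Sum>b\<in>T. kscale (u b) b) \<in> J \<inter> forms (Suc d)" using hom_comp_form[OF form, of "Suc d"] form by simp
    thus "u b = 0" using quot_basis_independent[OF B(2), of T u b] T by auto
  next
    fix v :: "('n, 'k) mpoly" assume v: "v \<in> polys_le (Suc d)"
    obtain s where s: "s \<in> polys_le d" "v = hom_comp (Suc d) v + s" using dec[OF v] by blast
    obtain x where x: "x \<in> kspace.span B" "hom_comp (Suc d) v - x \<in> J \<inter> forms (Suc d)"
      using quot_basis_spanning[OF B(2) hom_comp_forms] by blast
    have "v - x = (hom_comp (Suc d) v - x) + s" using s(2) by (simp add: algebra_simps)
    hence "v - x \<in> ?U" using x(2) s(1) forms_polys_le by blast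
    thus "\<exists>x\<in>module.span kscale B. v - x \<in> ?U" using x(1) by blast
  qed
  hence "quot_dim (polys_le (Suc d)) ?U = card B" using quot_dim_eq[OF f(1)] B(1) by blast
  moreover have "hilbert_fun J (Suc d) = card B"
    using quot_dim_eq[OF sW B(2,1)] by (simp add: hilbert_fun_def)
  ultimately show ?thesis using f(4) by simp
qed

text \<open>Numerical form of the exact sequence 0 -> S/(J : g) -> S/J -> S/(J + (g)) -> 0 with
  shift e. Homogeneity lets a representation w + s g be truncated term by term, which is the
  equality case of \<open>adim_mult_le\<close>.\<close>

lemma adim_adj:
  assumes J: "graded_ideal J" and g: "g \<in> forms e" and "e \<le> d"
  shows "adim J d = adim (adj J g) d + adim (ideal_colon J g) (d - e)"
proof (cases "g = 0")
  case True
  \<comment> \<open>\<open>adim_mult_le\<close> requires g to be nonzero; here the colon ideal is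
    everything and contributes 0.\<close>
  have "ideal_colon J 0 = UNIV" using is_ideal_0[OF graded_ideal_is_ideal[OF J]] by (simp add: ideal_colon_def)
  thus ?thesis
    using True adj_absorb[OF graded_ideal_is_ideal[OF J]] is_ideal_0[OF graded_ideal_is_ideal[OF J]] by simp
next
  case False
  note I = graded_ideal_is_ideal[OF J]
  have "adj J g \<inter> polys_le d \<subseteq> {w + g * s | w s. w \<in> J \<inter> polys_le d \<and> s \<in> polys_le (d - e)}"
  proof
    fix p assume p: "p \<in> adj J g \<inter> polys_le d"
    then obtain s where s: "p - s * g \<in> J" using mem_adj_iff[OF I] by blast
    have "p = trunc d ((p - s * g) + s * g)" using trunc_id[of p d] p by simp
    also have "\<dots> = trunc d (p - s * g) + trunc d (s * g)" by (rule trunc_add)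
    also have "trunc d (s * g) = g * trunc (d - e) s"
      using trunc_mult_form[OF g, of "d - e" s] assms(3) by (simp add: mult.commute)
    finally have "p = trunc d (p - s * g) + g * trunc (d - e) s" .
    moreover have "trunc d (p - s * g) \<in> J \<inter> polys_le d"
      using graded_ideal_trunc[OF J s] trunc_polys_le by blast
    ultimately show "p \<in> {w + g * s | w s. w \<in> J \<inter> polys_le d \<and> s \<in> polys_le (d - e)}"
      using trunc_polys_le by blast
  qed
  thus ?thesis
    using adim_mult_le(2)[OF I is_ideal_adj False subsetD[OF forms_polys_le g] assms(3) adj_superset adj_mem]
    by simp
qed

lemma adim_adj_less:
  assumes J: "graded_ideal J" and g: "g \<in> forms e" and "d < e"
  shows "adim (adj J g) d = adim J d"
proof -
  note I = graded_ideal_is_ideal[OF J]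
  have "p \<in> J" if "p \<in> adj J g" "p \<in> polys_le d" for p
  proof -
    obtain s where s: "p - s * g \<in> J" using mem_adj_iff[OF I] \<open>p \<in> adj J g\<close> by blast
    have "p = trunc d ((p - s * g) + s * g)" using trunc_id[of p d] that by simp
    also have "\<dots> = trunc d (p - s * g)" using trunc_mult_form_less[OF g assms(3)] by (subst trunc_add) simp
    finally show ?thesis using graded_ideal_trunc[OF J s, of d] by argo
  qed
  hence "adj J g \<inter> polys_le d = J \<inter> polys_le d" using adj_superset by blast
  thus ?thesis by (simp add: adim_def)
qed

lemma adim_adj_le:
  assumes J: "graded_ideal J" and g: "g \<in> forms e" and "e \<le> d"
  shows "adim J d \<le> adim (adj J g) d + adim J (d - e)"
  using adim_adj[OF assms]
    adim_antimono[OF _ is_ideal_colon ideal_colon_superset, of J g "d - e"] graded_ideal_is_ideal[OF J] by simp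

text \<open>Multiplication by some g in Q outside P is injective on S/P and has its image in
  Q/P.\<close>

lemma adim_prime_less:
  assumes P: "is_prime_ideal P" and Q: "is_ideal Q" and "P \<subset> Q"
  obtains a where "a > 0" "\<And>d. a \<le> d \<Longrightarrow> adim Q d + adim P (d - a) \<le> adim P d"
proof -
  obtain g where g: "g \<in> Q" "g \<notin> P" using assms by blast
  obtain a0 where "g \<in> polys_le a0" using polys_le_exists by blast
  hence a: "g \<in> polys_le (Suc a0)" using polys_le_mono[of a0 "Suc a0"] by auto
  have "g \<noteq> 0" using g is_ideal_0[OF is_prime_ideal_is_ideal[OF P]] by auto
  hence "adim Q d + adim P (d - Suc a0) \<le> adim P d" if "Suc a0 \<le> d" for d
    using adim_mult_le(1)[OF is_prime_ideal_is_ideal[OF P] Q _ a that] assms(3) g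
      is_prime_ideal_colon[OF P g(2)] by auto
  thus ?thesis using that[of "Suc a0"] by simp
qed

section \<open>Growth of the affine Hilbert function\<close>

text \<open>Stands for the statement that S/J has dimension at most t. The summand 1 keeps the bound
  meaningful at d = 0.\<close>

definition growth_le :: "('n::finite, 'k::field) mpoly set \<Rightarrow> nat \<Rightarrow> bool" where
  "growth_le J t \<longleftrightarrow> (\<exists>C::nat. \<forall>d. adim J d \<le> C * (d + 1) ^ t)"

text \<open>
  For a graded ideal, the infimum of all \<open>\<rho>\<close> with \<open>mult_le J t \<rho>\<close> is the multiplicity of the
  quotient ring if its dimension is \<open>t\<close>.
\<close>

definition mult_le :: "('n::finite, 'k::field) mpoly set \<Rightarrow> nat \<Rightarrow> real \<Rightarrow> bool" where
  "mult_le J t \<rho> \<longleftrightarrow> (\<exists>C::nat. \<forall>d. real (adim J d) \<le> \<rho> * real ((d + C) choose t))"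

lemma growth_leI: "(\<And>d. adim J d \<le> C * (d + 1) ^ t) \<Longrightarrow> growth_le J t"
  by (auto simp: growth_le_def)

lemma growth_le_UNIV [simp]: "growth_le UNIV t"
  by (simp add: growth_le_def)

lemma growth_le_mono:
  assumes "growth_le J t" "t \<le> t'"
  shows "growth_le J t'"
proof -
  obtain C where C: "\<And>d. adim J d \<le> C * (d + 1) ^ t" using assms by (auto simp: growth_le_def)
  have "C * (d + 1) ^ t \<le> C * (d + 1) ^ t'" for d using assms(2) by (intro mult_le_mono power_increasing) auto
  thus ?thesis using growth_leI[of J C t'] C le_trans by blast
qed

lemma growth_le_antimono:
  assumes "growth_le J t" "is_ideal J" "is_ideal J'" "J \<subseteq> J'"
  shows "growth_le J' t"
  using assms(1) adim_antimono[OF assms(2-4)] unfolding growth_le_def by (meson le_trans)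

lemma mult_le_growth_le:
  assumes "mult_le J t \<rho>"
  shows "growth_le J t"
proof -
  obtain C where C: "\<And>d. real (adim J d) \<le> \<rho> * real ((d + C) choose t)" using assms by (auto simp: mult_le_def)
  define R where "R = nat \<lceil>\<bar>\<rho>\<bar>\<rceil>"
  show ?thesis
  proof (rule growth_leI)
    fix d
    have "(d + C) choose t \<le> (d + C) ^ t"
    proof (cases "t \<le> d + C")
      case True thus ?thesis by (rule binomial_le_pow)
    qed (simp add: binomial_eq_0)
    also have "\<dots> \<le> ((C + 1) * (d + 1)) ^ t" by (intro power_mono) auto
    finally have *: "(d + C) choose t \<le> (C + 1) ^ t * (d + 1) ^ t" by (simp only: power_mult_distrib)
    have "real (adim J d) \<le> \<rho> * real ((d + C) choose t)" by (rule C)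
    also have "\<dots> \<le> real R * real ((d + C) choose t)"
      unfolding R_def by (intro mult_right_mono) linarith+
    finally have "adim J d \<le> R * ((d + C) choose t)" by (simp flip: of_nat_mult)
    also have "\<dots> \<le> R * ((C + 1) ^ t * (d + 1) ^ t)" using * by (intro mult_le_mono) auto
    finally show "adim J d \<le> (R * (C + 1) ^ t) * (d + 1) ^ t" by (simp add: mult.assoc)
  qed
qed

text \<open>The right-hand side is the product (d + 1) ... (d + t).\<close>

lemma power_le_fact_binomial: "(d + 1) ^ t \<le> fact t * ((d + t) choose t)"
proof (induction t)
  case (Suc t)
  have "(d + 1) ^ Suc t \<le> (fact t * ((d + t) choose t)) * (d + Suc t)"
    using Suc by (simp only: power_Suc2) (intro mult_le_mono, auto)
  also have "\<dots> = fact t * (Suc (d + t) * ((d + t) choose t))" by (simp only: add_Suc_right mult_ac)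
  also have "\<dots> = fact t * (Suc t * (Suc (d + t) choose Suc t))" by (simp only: Suc_times_binomial)
  also have "\<dots> = fact (Suc t) * ((d + Suc t) choose Suc t)"
    by (simp only: fact_Suc of_nat_id add_Suc_right mult_ac)
  finally show ?case .
qed simp

lemma growth_le_mult_le:
  assumes "growth_le J t"
  obtains \<rho> where "\<rho> \<ge> 0" "mult_le J t \<rho>"
proof -
  obtain C where C: "\<And>d. adim J d \<le> C * (d + 1) ^ t" using assms by (auto simp: growth_le_def)
  have "adim J d \<le> C * fact t * ((d + t) choose t)" for d
    using le_trans[OF C[of d] mult_le_mono[OF le_refl power_le_fact_binomial]] by (simp add: mult.assoc)
  hence "real (adim J d) \<le> real (C * fact t) * real ((d + t) choose t)" for d
    by (simp only: of_nat_mult[symmetric] of_nat_le_iff)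
  hence "mult_le J t (real (C * fact t))" unfolding mult_le_def by blast
  thus ?thesis using that[of "real (C * fact t)"] by simp
qed

lemma binomial_shift_ge: "(x choose Suc t) + e * (x choose t) \<le> (x + e) choose Suc t"
proof (induction e)
  case (Suc e)
  have "x choose t \<le> (x + e) choose t" by (rule binomial_right_mono) simp
  thus ?case using Suc by simp
qed simp

text \<open>Descending from d in steps of e, \<open>adim_adj_le\<close> sums about d / e values of
  \<open>adim (adj J g)\<close>, whence the factor 1 / e. The summation is done by
  \<open>binomial_shift_ge\<close>, whose shift by e explains the constant C + e.\<close>

lemma mult_le_step:
  assumes J: "graded_ideal J" and g: "g \<in> forms e" and e: "e > 0" and "\<rho> \<ge> 0"
    and le: "mult_le (adj J g) t \<rho>"
  shows "mult_le J (Suc t) (\<rho> / e)"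
proof -
  obtain C where C: "\<And>d. real (adim (adj J g) d) \<le> \<rho> * real ((d + C) choose t)"
    using le by (auto simp: mult_le_def)
  have "real e * real (adim J d) \<le> \<rho> * real ((d + (C + e)) choose Suc t)" for d
  proof (induction d rule: less_induct)
    case (less d)
    have *: "real (((d + C) choose Suc t) + e * ((d + C) choose t)) \<le> real ((d + (C + e)) choose Suc t)"
      using binomial_shift_ge[of "d + C" t e] by (simp only: of_nat_le_iff add.assoc)
    hence **: "\<rho> * real ((d + C) choose Suc t) + real e * (\<rho> * real ((d + C) choose t)) \<le> \<rho> * real ((d + (C + e)) choose Suc t)"
      using mult_left_mono[OF * \<open>\<rho> \<ge> 0\<close>] by (simp add: distrib_left mult.left_commute)
    have 1: "real e * real (adim (adj J g) d) \<le> real e * (\<rho> * real ((d + C) choose t))"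
      by (intro mult_left_mono C) simp
    show ?case
    proof (cases "d < e")
      case True
      have "\<rho> * real ((d + C) choose Suc t) \<ge> 0" using assms by simp
      thus ?thesis using ** 1 adim_adj_less[OF J g True] by simp
    next
      case False
      have "real e * real (adim J (d - e)) \<le> \<rho> * real ((d - e + (C + e)) choose Suc t)"
        by (rule less) (use e False in simp)
      also have "d - e + (C + e) = d + C" using False by simp
      finally have "real e * real (adim J (d - e)) \<le> \<rho> * real ((d + C) choose Suc t)" .
      moreover have "real (adim J d) \<le> real (adim (adj J g) d) + real (adim J (d - e))"
        using adim_adj_le[OF J g, of d] False by simp
      hence "real e * real (adim J d) \<le> real e * real (adim (adj J g) d) + real e * real (adim J (d - e))"
        unfolding distrib_left[symmetric] by (intro mult_left_mono) auto
      ultimately show ?thesis using ** 1 by linarith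
    qed
  qed
  thus ?thesis unfolding mult_le_def using e by (intro exI[of _ "C + e"]) (simp add: field_simps)
qed

lemma growth_le_step:
  assumes J: "graded_ideal J" and g: "g \<in> forms e" and e: "e > 0" and le: "growth_le (adj J g) t"
  shows "growth_le J (Suc t)"
  using growth_le_mult_le[OF le] mult_le_step[OF J g e] mult_le_growth_le by metis

text \<open>Iterating \<open>adim_prime_less\<close> fits j copies of a truncation of S/Q into S/P,
  at the cost of raising the degree by j a.\<close>

lemma adim_prime_mult:
  assumes P: "is_prime_ideal P" and Q: "is_ideal Q" and "P \<subset> Q"
  obtains a where "\<And>d j. j * adim Q d \<le> adim P (d + j * a)"
proof -
  obtain a where a: "a > 0" "\<And>d. a \<le> d \<Longrightarrow> adim Q d + adim P (d - a) \<le> adim P d"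
    using adim_prime_less[OF assms] by blast
  have "j * adim Q d \<le> adim P (d + j * a)" for d j
  proof (induction j)
    case (Suc j)
    have "adim Q d \<le> adim Q (d + Suc j * a)" using Q by (intro adim_mono) auto
    thus ?case using Suc a(2)[of "d + Suc j * a"] by simp
  qed simp
  thus ?thesis using that by blast
qed

text \<open>With j = d + 1 copies, the degree on the side of P is still linear in d, so dividing by
  d + 1 saves one order of growth.\<close>

lemma growth_le_prime:
  assumes P: "is_prime_ideal P" and Q: "is_ideal Q" and "P \<subset> Q" and le: "growth_le P (Suc t)"
  shows "growth_le Q t"
proof -
  obtain a where a: "\<And>d j. j * adim Q d \<le> adim P (d + j * a)" using adim_prime_mult[OF assms(1-3)] by blast
  obtain C where C: "\<And>d. adim P d \<le> C * (d + 1) ^ Suc t" using le by (auto simp: growth_le_def)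
  show ?thesis
  proof (rule growth_leI)
    fix d
    have "(d + 1) * adim Q d \<le> C * (d + (d + 1) * a + 1) ^ Suc t"
      using a[of "d + 1" d] C[of "d + (d + 1) * a"] by (rule le_trans)
    also have "d + (d + 1) * a + 1 = (a + 1) * (d + 1)" by simp
    also have "C * ((a + 1) * (d + 1)) ^ Suc t = (d + 1) * (C * (a + 1) ^ Suc t * (d + 1) ^ t)"
      by (simp only: power_mult_distrib power_Suc mult_ac)
    finally show "adim Q d \<le> (C * (a + 1) ^ Suc t) * (d + 1) ^ t" by (simp only: mult_le_cancel1)
  qed
qed

text \<open>If \<open>adim P\<close> were bounded by C, then C + 1 copies of the positive number
  \<open>adim Q 0\<close> would not fit.\<close>

lemma not_growth_le_0_prime:
  assumes P: "is_prime_ideal P" and Q: "is_ideal Q" "Q \<noteq> UNIV" and "P \<subset> Q"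
  shows "\<not> growth_le P 0"
proof
  assume "growth_le P 0"
  then obtain C where C: "\<And>d. adim P d \<le> C" by (auto simp: growth_le_def)
  obtain a where a: "\<And>d j. j * adim Q d \<le> adim P (d + j * a)" using adim_prime_mult[OF P Q(1) assms(4)] by blast
  have "Suc C * adim Q 0 \<le> C" using a[of "Suc C" 0] C le_trans by blast
  thus False using adim_pos[OF Q, of 0] by (cases "adim Q 0") auto
qed

lemma growth_le_chain:
  fixes C :: "nat \<Rightarrow> ('n::finite, 'k::field) mpoly set"
  assumes "prime_chain m C" "growth_le (C 0) t"
  shows "m \<le> t \<and> growth_le (C m) (t - m)"
  using assms
proof (induction m)
  case (Suc m)
  hence "prime_chain m C" by (auto simp: prime_chain_def)
  hence IH: "m \<le> t" "growth_le (C m) (t - m)" using Suc by auto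
  have C: "is_prime_ideal (C m)" "is_prime_ideal (C (Suc m))" "C m \<subset> C (Suc m)"
    using Suc.prems(1) by (auto simp: prime_chain_def)
  have "t - m \<noteq> 0"
    using not_growth_le_0_prime[OF C(1) is_prime_ideal_is_ideal[OF C(2)] _ C(3)] IH(2) C(2)
    by (auto simp: is_prime_ideal_def)
  then obtain t' where t': "t - m = Suc t'" by (cases "t - m") auto
  hence "growth_le (C (Suc m)) t'"
    using growth_le_prime[OF C(1) is_prime_ideal_is_ideal[OF C(2)] C(3)] IH(2) by simp
  moreover have "t - Suc m = t'" "Suc m \<le> t" using t' by auto
  ultimately show ?case by simp
qed simp

section \<open>Growth, Krull dimension and primes\<close>

lemma quot_krull_dim_le:
  assumes "is_ideal Q" "growth_le Q k"
  shows "quot_krull_dim Q \<le> enat k"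
  unfolding quot_krull_dim_def
proof (rule Sup_least, safe)
  fix n C assume C: "prime_chain n C" "Q \<subseteq> C 0"
  hence "is_ideal (C 0)" by (auto simp: prime_chain_def is_prime_ideal_def)
  hence "growth_le (C 0) k" using growth_le_antimono assms C by blast
  thus "enat n \<le> enat k" using growth_le_chain[OF C(1)] by simp
qed

text \<open>A graded ideal J maximal among those of faster growth is prime: if a b lies in J but
  neither factor does, then J + (b) and J : b are strictly larger, and by \<open>adim_adj\<close>
  their slower growth bounds that of J.\<close>

lemma prime_of_growth:
  assumes I: "graded_ideal I" and "\<not> growth_le I t"
  obtains J where "graded_ideal J" "is_prime_ideal J" "I \<subseteq> J" "\<not> growth_le J t"
proof -
  obtain J where J: "graded_ideal J" "I \<subseteq> J" "\<not> growth_le J t"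
    and max: "\<And>J'. graded_ideal J' \<Longrightarrow> J \<subset> J' \<Longrightarrow> growth_le J' t"
    using maximal_graded_ideal_exists[where P = "\<lambda>J. \<not> growth_le J t", OF assms] by (metis (no_types))
  note IJ = graded_ideal_is_ideal[OF J(1)]
  have "is_prime_ideal J"
  proof (rule graded_prime_idealI[OF J(1)])
    show "J \<noteq> UNIV" using J(3) by auto
    fix a b d e assume ab: "a \<in> forms d" "b \<in> forms e" "a * b \<in> J"
    show "a \<in> J \<or> b \<in> J"
    proof (rule ccontr)
      assume neg: "\<not> (a \<in> J \<or> b \<in> J)"
      have "J \<subset> adj J b" using adj_superset[of J b] adj_mem[of b J] neg by blast
      hence "growth_le (adj J b) t" using max graded_ideal_adj[OF J(1) ab(2)] by blast
      then obtain C1 where C1: "\<And>n. adim (adj J b) n \<le> C1 * (n + 1) ^ t" by (auto simp: growth_le_def)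
      have "a \<in> ideal_colon J b" using ab(3) by (simp add: ideal_colon_def)
      hence "J \<subset> ideal_colon J b" using ideal_colon_superset[OF IJ, of b] neg by blast
      hence "growth_le (ideal_colon J b) t" using max graded_ideal_colon[OF J(1) ab(2)] by blast
      then obtain C2 where C2: "\<And>n. adim (ideal_colon J b) n \<le> C2 * (n + 1) ^ t" by (auto simp: growth_le_def)
      have "adim J n \<le> (C1 + C2) * (n + 1) ^ t" for n
      proof (cases "n < e")
        case True
        thus ?thesis using adim_adj_less[OF J(1) ab(2)] C1[of n] by (simp add: distrib_right)
      next
        case False
        have "adim (ideal_colon J b) (n - e) \<le> adim (ideal_colon J b) n"
          by (intro adim_mono is_ideal_colon IJ) simp
        thus ?thesis using adim_adj[OF J(1) ab(2), of n] False C1[of n] C2[of n]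
          by (simp add: distrib_right)
      qed
      hence "growth_le J t" by (rule growth_leI)
      thus False using J(3) by blast
    qed
  qed
  thus ?thesis using that J by blast
qed

section \<open>Ideals generated by linear forms\<close>

definition var :: "'n \<Rightarrow> ('n, 'k::field) mpoly" where
  "var i = single (single i 1) 1"

definition mon_subst :: "('n::finite \<Rightarrow> ('n, 'k::field) mpoly) \<Rightarrow> ('n \<Rightarrow>\<^sub>0 nat) \<Rightarrow> ('n, 'k) mpoly" where
  "mon_subst \<psi> m = (\<Prod>i\<in>UNIV. \<psi> i ^ lookup m i)"

definition subst :: "('n::finite \<Rightarrow> ('n, 'k::field) mpoly) \<Rightarrow> ('n, 'k) mpoly \<Rightarrow> ('n, 'k) mpoly" where
  "subst \<psi> p = (\<Sum>m\<in>keys p. kscale (lookup p m) (mon_subst \<psi> m))"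

lemma mon_subst_add: "mon_subst \<psi> (m + m') = mon_subst \<psi> m * mon_subst \<psi> m'"
  by (simp add: mon_subst_def lookup_add power_add prod.distrib)

lemma mon_subst_0 [simp]: "mon_subst \<psi> 0 = 1"
  by (simp add: mon_subst_def)

lemma mon_subst_single [simp]: "mon_subst \<psi> (single i 1) = \<psi> i"
proof -
  have "mon_subst \<psi> (single i 1) = (\<Prod>j\<in>UNIV. if j = i then \<psi> j else 1)"
    unfolding mon_subst_def by (intro prod.cong) (auto simp: lookup_single when_def)
  thus ?thesis by simp
qed

lemma subst_superset:
  assumes "finite A" "keys p \<subseteq> A"
  shows "subst \<psi> p = (\<Sum>m\<in>A. kscale (lookup p m) (mon_subst \<psi> m))"
  unfolding subst_def using assms by (intro sum.mono_neutral_left) (auto simp: in_keys_iff)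

lemma subst_add: "subst \<psi> (p + q) = subst \<psi> p + subst \<psi> q"
  using Poly_Mapping.keys_add[of p q]
  by (subst (1 2 3) subst_superset[of "keys p \<union> keys q"])
    (auto simp: lookup_add kspace.scale_left_distrib sum.distrib)

lemma subst_zero [simp]: "subst \<psi> 0 = 0"
  by (simp add: subst_def)

lemma subst_sum: "subst \<psi> (sum f A) = (\<Sum>x\<in>A. subst \<psi> (f x))"
  by (induction A rule: infinite_finite_induct) (simp_all add: subst_add)

lemma subst_single: "subst \<psi> (single m c) = kscale c (mon_subst \<psi> m)"
  by (subst subst_superset[of "{m}"]) auto

lemma subst_one: "subst \<psi> 1 = 1"
  using subst_single[of \<psi> 0 1] by simp

lemma mpoly_sum_single: "p = (\<Sum>m\<in>keys p. single m (lookup p m))"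
  by (intro poly_mapping_eqI) (simp add: lookup_sum lookup_single when_def in_keys_iff)

lemma subst_mult: "subst \<psi> (p * q) = subst \<psi> p * subst \<psi> q"
proof -
  have "p * q = (\<Sum>m\<in>keys p. \<Sum>k\<in>keys q.
      single m (lookup p m) * single k (lookup q k))"
    using arg_cong2[OF mpoly_sum_single[of p] mpoly_sum_single[of q], of "(*)"] by (simp only: sum_product)
  hence "subst \<psi> (p * q) = (\<Sum>m\<in>keys p. \<Sum>k\<in>keys q.
      kscale (lookup p m) (mon_subst \<psi> m) * kscale (lookup q k) (mon_subst \<psi> k))"
    by (simp add: subst_sum mult_single subst_single mon_subst_add kscale_mult kscale_mult_left mult.commute)
  also have "\<dots> = subst \<psi> p * subst \<psi> q" by (simp add: subst_def sum_product)
  finally show ?thesis .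
qed

lemma mon_deg_eq_1: "mon_deg m = 1 \<Longrightarrow> \<exists>i. m = single i 1"
proof -
  assume "mon_deg m = 1"
  then obtain i where "lookup m i = 1" "\<And>j. i \<noteq> j \<Longrightarrow> lookup m j = 0"
    using sum_eq_1_iff[of UNIV "lookup m"] by (auto simp: mon_deg_def)
  hence "m = single i 1"
    by (intro poly_mapping_eqI) (auto simp: lookup_single when_def)
  thus ?thesis ..
qed

lemma mon_induct [case_names zero add]:
  fixes m :: "'n::finite \<Rightarrow>\<^sub>0 nat"
  assumes "P 0" "\<And>m i. P m \<Longrightarrow> P (m + single i 1)"
  shows "P m"
proof (induction "mon_deg m" arbitrary: m)
  case 0
  hence "m = 0" by (intro poly_mapping_eqI) (simp add: mon_deg_def)
  thus ?case using assms(1) by simp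
next
  case (Suc n)
  then obtain i where i: "lookup m i > 0"
    by (metis mon_deg_def neq0_conv sum.neutral nat.distinct(1))
  define m' where "m' = m - single i 1"
  have m: "m = m' + single i 1"
    using i by (intro poly_mapping_eqI) (auto simp: m'_def lookup_add lookup_minus lookup_single when_def)
  have "mon_deg (single i 1) = 1" by (simp add: mon_deg_def lookup_single when_def)
  hence "mon_deg m' = n" using Suc.hyps(2) m by (simp add: mon_deg_add)
  thus ?case using Suc.hyps(1) assms(2) m by metis
qed

lemma var_forms: "var i \<in> forms 1"
  by (simp add: var_def forms_def mon_deg_def lookup_single when_def)

lemma subst_cong_ideal:
  assumes J: "is_ideal J" and \<psi>: "\<And>i. var i - \<psi> i \<in> J"
  shows "p - subst \<psi> p \<in> J"
proof -
  have mon: "single m 1 - mon_subst \<psi> m \<in> J" for m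
  proof (induction m rule: mon_induct)
    case (add m i)
    let ?a = "single m (1 :: 'b)" and ?a' = "mon_subst \<psi> m"
    have "single (m + single i 1) 1 = ?a * var i"
      by (simp add: var_def mult_single)
    moreover have "mon_subst \<psi> (m + single i 1) = ?a' * \<psi> i"
      by (simp only: mon_subst_add mon_subst_single)
    moreover have "?a * var i - ?a' * \<psi> i = (?a - ?a') * var i + ?a' * (var i - \<psi> i)"
      by (simp add: algebra_simps)
    moreover have "(?a - ?a') * var i + ?a' * (var i - \<psi> i) \<in> J"
      using add \<psi> by (intro is_ideal_add[OF J] is_ideal_mult[OF J] is_ideal_mult_right[OF J])
    ultimately show ?case by simp
  qed (simp add: is_ideal_0[OF J])
  have "p - subst \<psi> p = (\<Sum>m\<in>keys p.
      kscale (lookup p m) (single m 1 - mon_subst \<psi> m))"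
    using mpoly_sum_monomials[of p]
    by (simp add: subst_def kspace.scale_right_diff_distrib sum_subtractf)
  also have "\<dots> \<in> J"
    using mon by (intro is_ideal_sum[OF J] kspace.subspace_scale[OF is_ideal_subspace[OF J]])
  finally show ?thesis .
qed

text \<open>
  Eliminating variables realises an ideal generated by linear forms as the kernel of an
  endomorphism of the polynomial ring.
\<close>

lemma linear_ideal_kernel:
  fixes J :: "('n::finite, 'k::field) mpoly set"
  assumes "generated_by_linear_forms J"
  obtains \<psi> where "\<And>p. p \<in> J \<longleftrightarrow> subst \<psi> p = 0"
proof -
  obtain L where L: "L \<subseteq> forms 1" "J = ideal_gen L" using assms by (auto simp: generated_by_linear_forms_def)
  have I: "is_ideal J" by (simp add: L)
  have sJ: "kspace.subspace J" by (rule is_ideal_subspace[OF I])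
  \<comment> \<open>A maximal B with this property consists of variables independent modulo J, and
    every other variable is congruent to a combination of them.\<close>
  let ?Q = "\<lambda>B :: 'n set. J \<inter> kspace.span (var ` B) \<subseteq> {0}"
  have "?Q {}" by simp
  then obtain B where B: "?Q B" "\<And>B'. B \<subset> B' \<Longrightarrow> \<not> ?Q B'"
    using finite_has_maximal2[of "{B. ?Q B}" "{}"] by (metis (no_types, lifting) finite mem_Collect_eq psubsetE)
  have "\<exists>w\<in>kspace.span (var ` B). var i - w \<in> J" for i
  proof (cases "i \<in> B")
    case True
    thus ?thesis using is_ideal_0[OF I] by (intro bexI[of _ "var i"] kspace.span_base) auto
  next
    case False
    hence "\<not> ?Q (insert i B)" by (intro B(2)) auto
    then obtain v where v: "v \<in> J" "v \<in> kspace.span (insert (var i) (var ` B))" "v \<noteq> 0" by auto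
    then obtain a where a: "v - kscale a (var i) \<in> kspace.span (var ` B)"
      by (auto simp: kspace.span_insert)
    have "a \<noteq> 0" using a v B(1) by auto
    define w where "w = kscale (- inverse a) (v - kscale a (var i))"
    have "var i - w = kscale (inverse a) v"
      using \<open>a \<noteq> 0\<close> by (simp add: w_def kspace.scale_right_diff_distrib)
    hence "var i - w \<in> J" using v(1) kspace.subspace_scale[OF sJ] by simp
    moreover have "w \<in> kspace.span (var ` B)" unfolding w_def using a by (rule kspace.span_scale)
    ultimately show ?thesis by blast
  qed
  then obtain \<psi> where \<psi>: "\<And>i. \<psi> i \<in> kspace.span (var ` B)" "\<And>i. var i - \<psi> i \<in> J" by metis
  have cong: "p - subst \<psi> p \<in> J" for p by (rule subst_cong_ideal[OF I \<psi>(2)])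
  have "subst \<psi> v = 0" if v: "v \<in> L" for v
  proof -
    have "kscale (lookup v m) (mon_subst \<psi> m) \<in> kspace.span (var ` B)"
      if "m \<in> keys v" for m
    proof -
      have "mon_deg m = 1" using that v L(1) by (auto simp: forms_def)
      then obtain i where "m = single i 1" using mon_deg_eq_1 by blast
      hence "mon_subst \<psi> m = \<psi> i" by (simp only: mon_subst_single)
      thus ?thesis using \<psi>(1) by (simp add: kspace.span_scale)
    qed
    \<comment> \<open>A linear form goes to a combination of variables from B congruent to it modulo
      J. For v in L this image lies in J and so vanishes.\<close>
    hence "subst \<psi> v \<in> kspace.span (var ` B)" unfolding subst_def by (rule kspace.span_sum)
    moreover have "v \<in> J" using v L(2) ideal_gen_superset by blast
    hence "v - (v - subst \<psi> v) \<in> J" by (rule is_ideal_diff[OF I _ cong])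
    hence "subst \<psi> v \<in> J" by simp
    ultimately show ?thesis using B(1) by blast
  qed
  moreover have "is_ideal {p. subst \<psi> p = 0}"
    by (rule is_idealI) (simp_all add: subst_add subst_mult)
  ultimately have "J \<subseteq> {p. subst \<psi> p = 0}" unfolding L(2) by (intro ideal_gen_minimal) auto
  moreover have "p \<in> J" if "subst \<psi> p = 0" for p using cong[of p] that by simp
  ultimately show ?thesis using that[of \<psi>] by blast
qed

lemma linear_ideal_prime:
  fixes J :: "('n::finite, 'k::field) mpoly set"
  assumes "generated_by_linear_forms J"
  shows "is_prime_ideal J"
proof -
  obtain \<psi> where \<psi>: "\<And>p. p \<in> J \<longleftrightarrow> subst \<psi> p = 0" using linear_ideal_kernel[OF assms] by blast
  have "is_ideal J" using assms by (auto simp: generated_by_linear_forms_def)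
  moreover have "1 \<notin> J" by (simp add: \<psi> subst_one)
  ultimately show ?thesis by (auto simp: is_prime_ideal_def \<psi> subst_mult)
qed

lemma linear_ideal_graded:
  assumes "generated_by_linear_forms J"
  shows "graded_ideal J"
proof -
  obtain L where L: "L \<subseteq> forms 1" "J = ideal_gen L" using assms by (auto simp: generated_by_linear_forms_def)
  show ?thesis unfolding L(2) using L(1) by (intro graded_ideal_ideal_gen) blast
qed

lemma linear_ideal_zero: "generated_by_linear_forms {0}"
  unfolding generated_by_linear_forms_def by (intro exI[of _ "{}"]) simp

lemma linear_ideal_adj:
  "generated_by_linear_forms J \<Longrightarrow> l \<in> forms 1 \<Longrightarrow> generated_by_linear_forms (adj J l)"
  unfolding generated_by_linear_forms_def by (metis adj_ideal_gen insert_subset)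

section \<open>The maximal ideal and chains of independent linear forms\<close>

definition max_ideal :: "('n::finite, 'k::field) mpoly set" where
  "max_ideal = ideal_gen (range var)"

lemma linear_ideal_max_ideal: "generated_by_linear_forms max_ideal"
  unfolding generated_by_linear_forms_def max_ideal_def using var_forms by blast

lemma mon_max_ideal:
  fixes m :: "'n::finite \<Rightarrow>\<^sub>0 nat"
  shows "m \<noteq> 0 \<Longrightarrow> (single m 1 :: ('n, 'k::field) mpoly) \<in> max_ideal"
proof (induction m rule: mon_induct)
  case (add m i)
  have "(var i :: ('n, 'k) mpoly) \<in> max_ideal"
    unfolding max_ideal_def using ideal_gen_superset by blast
  hence "single m 1 * (var i :: ('n, 'k) mpoly) \<in> max_ideal"
    by (simp add: max_ideal_def is_ideal_mult)
  thus ?case by (simp add: var_def mult_single)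
qed simp

lemma max_ideal_const: "p - kscale (lookup p 0) 1 \<in> max_ideal"
proof -
  let ?q = "p - kscale (lookup p 0) 1"
  have I: "is_ideal max_ideal" by (simp add: max_ideal_def)
  have "0 \<notin> keys ?q" by (simp add: in_keys_iff lookup_minus)
  hence "(\<Sum>m\<in>keys ?q. kscale (lookup ?q m) (single m 1)) \<in> max_ideal"
    by (intro is_ideal_sum[OF I] kspace.subspace_scale[OF is_ideal_subspace[OF I]] mon_max_ideal) metis
  thus ?thesis using mpoly_sum_monomials[of ?q] by simp
qed

lemma linear_form_max_ideal: "l \<in> forms 1 \<Longrightarrow> l \<in> max_ideal"
  using max_ideal_const[of l] by (cases "0 \<in> keys l") (force simp: forms_def, simp add: in_keys_iff)

lemma linear_ideal_le_max_ideal: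
  assumes "generated_by_linear_forms J"
  shows "J \<subseteq> max_ideal"
proof -
  obtain L where L: "L \<subseteq> forms 1" "J = ideal_gen L" using assms by (auto simp: generated_by_linear_forms_def)
  show ?thesis unfolding L(2) using L(1) linear_form_max_ideal
    by (intro ideal_gen_minimal) (auto simp: max_ideal_def)
qed

lemma adim_max_ideal: "adim (max_ideal :: ('n::finite, 'k::field) mpoly set) d = 1"
proof -
  let ?m = "max_ideal :: ('n, 'k) mpoly set"
  have I: "is_ideal ?m" by (simp add: max_ideal_def)
  have not1: "kscale c 1 \<notin> ?m" if "c \<noteq> 0" for c
  proof
    assume "kscale c 1 \<in> ?m"
    hence "kscale (inverse c) (kscale c 1) \<in> ?m"
      using kspace.subspace_scale[OF is_ideal_subspace[OF I]] by blast
    hence "1 \<in> ?m" using that by simp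
    thus False using linear_ideal_prime[OF linear_ideal_max_ideal] is_ideal_UNIV_iff[OF I]
      by (auto simp: is_prime_ideal_def)
  qed
  have "quot_basis (polys_le d) (?m \<inter> polys_le d) {1}"
    unfolding quot_basis_def
  proof (intro conjI allI impI ballI)
    fix T u b assume T: "finite T \<and> T \<subseteq> {1 :: ('n, 'k) mpoly} \<and> (\<Sum>b\<in>T. kscale (u b) b) \<in> ?m \<inter> polys_le d" "b \<in> T"
    hence "T = {1}" by blast
    thus "u b = 0" using T not1 by auto
  next
    fix v :: "('n, 'k) mpoly" assume v: "v \<in> polys_le d"
    have "kscale (lookup v 0) 1 \<in> polys_le d"
      by (intro kspace.subspace_scale[OF subspace_polys_le]) simp
    hence "v - kscale (lookup v 0) 1 \<in> ?m \<inter> polys_le d"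
      using max_ideal_const[of v] kspace.subspace_diff[OF subspace_polys_le v] by blast
    thus "\<exists>x\<in>kspace.span {1}. v - x \<in> ?m \<inter> polys_le d"
      by (intro bexI[of _ "kscale (lookup v 0) 1"] kspace.span_scale kspace.span_base) auto
  qed simp
  from quot_dim_eq[OF subspace_cut[OF I] this] show ?thesis by (simp add: adim_def)
qed

text \<open>When J is generated by linear forms, this is linear independence modulo J. Such a list
  is both a regular sequence on S/J and the source of a strict chain of primes.\<close>

fun lin_chain :: "('n::finite, 'k::field) mpoly set \<Rightarrow> ('n, 'k) mpoly list \<Rightarrow> bool" where
  "lin_chain J [] \<longleftrightarrow> True"
| "lin_chain J (l # ls) \<longleftrightarrow> l \<in> forms 1 \<and> l \<notin> J \<and> lin_chain (adj J l) ls"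

lemma lin_chain_append: "lin_chain J (ls @ ls') \<longleftrightarrow> lin_chain J ls \<and> lin_chain (adjs J ls) ls'"
  by (induction ls arbitrary: J) auto

lemma lin_chain_forms: "lin_chain J ls \<Longrightarrow> set ls \<subseteq> forms 1"
  by (induction ls arbitrary: J) auto

lemma linear_ideal_adjs:
  "generated_by_linear_forms J \<Longrightarrow> set ls \<subseteq> forms 1 \<Longrightarrow> generated_by_linear_forms (adjs J ls)"
  by (induction ls arbitrary: J) (auto simp: linear_ideal_adj)

lemma lin_chain_prime_chain:
  assumes "generated_by_linear_forms J" "lin_chain J ls"
  shows "prime_chain (length ls) (\<lambda>i. adjs J (take i ls))"
  using assms
proof (induction ls arbitrary: J)
  case Nil
  thus ?case by (simp add: prime_chain_def linear_ideal_prime)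
next
  case (Cons l ls)
  have J: "generated_by_linear_forms (adj J l)" using Cons.prems by (simp add: linear_ideal_adj)
  have IH: "prime_chain (length ls) (\<lambda>i. adjs (adj J l) (take i ls))" using Cons.IH[OF J] Cons.prems by simp
  have less: "J \<subset> adj J l" using Cons.prems adj_superset[of J l] adj_mem[of l J] by auto
  have "is_prime_ideal (adjs J (take i (l # ls)))" if "i \<le> Suc (length ls)" for i
    using IH that Cons.prems(1) by (cases i) (auto simp: prime_chain_def linear_ideal_prime)
  moreover have "adjs J (take i (l # ls)) \<subset> adjs J (take (Suc i) (l # ls))" if "i < Suc (length ls)" for i
  proof (cases i)
    case 0 thus ?thesis using less by simp
  next
    case (Suc j) thus ?thesis using IH that by (auto simp: prime_chain_def)
  qed
  ultimately show ?case by (simp add: prime_chain_def)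
qed

text \<open>Noetherian induction replaces a dimension count: generators of P outside J are adjoined
  until P is reached.\<close>

lemma lin_chain_extend:
  assumes "generated_by_linear_forms P" "generated_by_linear_forms J" "J \<subseteq> P"
  shows "\<exists>ls. lin_chain J ls \<and> adjs J ls = P"
proof -
  obtain L where L: "L \<subseteq> forms 1" "P = ideal_gen L" using assms(1) by (auto simp: generated_by_linear_forms_def)
  have "is_ideal P" by (simp add: L)
  from assms(2,3) show ?thesis
  proof (induction J rule: wf_induct_rule[OF hilbert_basis])
    case (1 J)
    note I = graded_ideal_is_ideal[OF linear_ideal_graded[OF 1(2)]]
    show ?case
    proof (cases "L \<subseteq> J")
      case True
      hence "J = P" using ideal_gen_minimal[OF True I] 1(3) L(2) by blast
      thus ?thesis by (intro exI[of _ "[]"]) simp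
    next
      case False
      then obtain l where l: "l \<in> L" "l \<notin> J" by blast
      have "J \<subset> adj J l" using l(2) adj_superset[of J l] adj_mem[of l J] by blast
      moreover have "adj J l \<subseteq> P"
        using l(1) 1(3) L(2) ideal_gen_superset[of L] \<open>is_ideal P\<close> by (intro adj_minimal) auto
      moreover have "generated_by_linear_forms (adj J l)" using l L 1(2) by (intro linear_ideal_adj) auto
      ultimately obtain ls where "lin_chain (adj J l) ls" "adjs (adj J l) ls = P"
        using 1(1)[of "adj J l"] I by auto
      thus ?thesis using l L by (intro exI[of _ "l # ls"]) auto
    qed
  qed
qed

text \<open>Each l is a nonzerodivisor because the ideal before it is prime, so
  \<open>adim_adj\<close> becomes Pascal's rule.\<close>

lemma adim_lin_chain:
  assumes "generated_by_linear_forms J" "lin_chain J ls" "adjs J ls = max_ideal"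
  shows "adim J d = (d + length ls) choose length ls"
  using assms
proof (induction ls arbitrary: J d)
  case Nil
  thus ?case by (simp add: adim_max_ideal)
next
  case (Cons l ls)
  have l: "l \<in> forms 1" "l \<notin> J" using Cons.prems by auto
  have IH: "adim (adj J l) d = (d + length ls) choose length ls" for d
    using Cons.IH[OF linear_ideal_adj[OF Cons.prems(1) l(1)]] Cons.prems by simp
  note J = linear_ideal_graded[OF Cons.prems(1)]
  have colon: "ideal_colon J l = J"
    by (rule is_prime_ideal_colon[OF linear_ideal_prime[OF Cons.prems(1)] l(2)])
  show ?case
  proof (induction d)
    case 0
    thus ?case using adim_adj_less[OF J l(1), of 0] IH[of 0] by simp
  next
    case (Suc d)
    thus ?case using adim_adj[OF J l(1), of "Suc d"] IH[of "Suc d"] colon by simp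
  qed
qed

lemma adim_zero_exists: "\<exists>N. \<forall>d. adim ({0} :: ('n::finite, 'k::field) mpoly set) d = (d + N) choose N"
proof -
  have "is_ideal (max_ideal :: ('n, 'k) mpoly set)" by (simp add: max_ideal_def)
  hence "{0} \<subseteq> (max_ideal :: ('n, 'k) mpoly set)" using is_ideal_0 by blast
  then obtain ls where "lin_chain {0} ls" "adjs {0} ls = (max_ideal :: ('n, 'k) mpoly set)"
    using lin_chain_extend[OF linear_ideal_max_ideal linear_ideal_zero] by blast
  thus ?thesis using adim_lin_chain[OF linear_ideal_zero] by blast
qed

section \<open>Hilbert polynomials and the degree\<close>

lemma binomial_tendsto:
  "(\<lambda>d. real ((d + c) choose k) / real d ^ k) \<longlonglongrightarrow> 1 / fact k"
proof (induction k)
  case (Suc k)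
  have rec: "real (x choose Suc k) = real (x choose k) * (real x - real k) / real (Suc k)" for x
    using gbinomial_mult_1[of "real x" k] by (simp add: field_simps binomial_gbinomial)
  have "(\<lambda>d. 1 + (real c - real k) / real d) \<longlonglongrightarrow> 1 + 0"
    by (intro tendsto_intros lim_const_over_n)
  hence "(\<lambda>d. (real ((d + c) choose k) / real d ^ k) * (1 + (real c - real k) / real d) / real (Suc k))
      \<longlonglongrightarrow> 1 / fact k * (1 + 0) / real (Suc k)"
    by (intro tendsto_intros Suc) auto
  also have "1 / fact k * (1 + 0) / real (Suc k) = 1 / fact (Suc k)" by simp
  finally show ?case
  proof (rule Lim_transform_eventually)
    show "\<forall>\<^sub>F d in sequentially. (real ((d + c) choose k) / real d ^ k) * (1 + (real c - real k) / real d) / real (Suc k)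
        = real ((d + c) choose Suc k) / real d ^ Suc k"
      using eventually_gt_at_top[of 0] by eventually_elim (simp only: rec, simp add: field_simps)
  qed
qed simp

section \<open>Finite differences and eventual polynomiality\<close>

definition fdiff :: "(nat \<Rightarrow> int) \<Rightarrow> nat \<Rightarrow> int" where
  "fdiff h d = h (Suc d) - h d"

text \<open>Vanishing differences are stable under sums, shifts and summation. Integer coefficients
  in the binomial basis are recovered by \<open>eventually_polynomial_newton\<close>.\<close>

definition eventually_polynomial :: "(nat \<Rightarrow> int) \<Rightarrow> bool" where
  "eventually_polynomial h \<longleftrightarrow> (\<exists>t. \<forall>\<^sub>F d in sequentially. (fdiff ^^ t) h d = 0)"

lemma eventually_polynomial_const: "eventually_polynomial (\<lambda>d. c)"
  unfolding eventually_polynomial_def by (intro exI[of _ 1]) (simp add: fdiff_def)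

lemma fdiff_add: "(fdiff ^^ t) (\<lambda>d. h d + h' d) d = (fdiff ^^ t) h d + (fdiff ^^ t) h' d"
  by (induction t arbitrary: d) (simp_all add: fdiff_def)

lemma fdiff_shift: "(fdiff ^^ t) (\<lambda>d. h (d + s)) d = (fdiff ^^ t) h (d + s)"
  by (induction t arbitrary: d) (simp_all add: fdiff_def)

lemma fdiff_mono:
  assumes "\<forall>\<^sub>F d in sequentially. (fdiff ^^ t) h d = 0" "t \<le> t'"
  shows "\<forall>\<^sub>F d in sequentially. (fdiff ^^ t') h d = 0"
  using assms(2)
proof (induction t' rule: dec_induct)
  case (step n)
  hence "\<forall>\<^sub>F d in sequentially. (fdiff ^^ n) h (Suc d) = 0"
    by (subst (asm) eventually_sequentially_Suc[symmetric])
  with step(3) show ?case by eventually_elim (simp add: fdiff_def[of "(fdiff ^^ n) h"])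
qed (use assms in simp)

lemma eventually_polynomial_add:
  assumes "eventually_polynomial h" "eventually_polynomial h'"
  shows "eventually_polynomial (\<lambda>d. h d + h' d)"
proof -
  obtain t t' where t: "\<forall>\<^sub>F d in sequentially. (fdiff ^^ t) h d = 0" "\<forall>\<^sub>F d in sequentially. (fdiff ^^ t') h' d = 0"
    using assms by (auto simp: eventually_polynomial_def)
  have "\<forall>\<^sub>F d in sequentially. (fdiff ^^ max t t') (\<lambda>d. h d + h' d) d = 0"
    using fdiff_mono[OF t(1), of "max t t'", simplified] fdiff_mono[OF t(2), of "max t t'", simplified]
    unfolding fdiff_add by eventually_elim simp
  thus ?thesis unfolding eventually_polynomial_def by blast
qed

lemma eventually_polynomial_shift_iff:
  "eventually_polynomial (\<lambda>d. h (Suc d)) \<longleftrightarrow> eventually_polynomial h"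
  unfolding eventually_polynomial_def using fdiff_shift[of _ h 1]
  by (simp add: eventually_sequentially_Suc[of "\<lambda>d. (fdiff ^^ t) h d = 0" for t])

lemma eventually_polynomial_fdiff:
  assumes "eventually_polynomial (\<lambda>d. h (Suc d) - h d)"
  shows "eventually_polynomial h"
proof -
  have "(\<lambda>d. h (Suc d) - h d) = fdiff h" by (simp add: fdiff_def fun_eq_iff)
  then obtain t where "\<forall>\<^sub>F d in sequentially. (fdiff ^^ Suc t) h d = 0"
    using assms by (auto simp: eventually_polynomial_def funpow_Suc_right simp del: funpow.simps)
  thus ?thesis unfolding eventually_polynomial_def by blast
qed

text \<open>Summing the formula for the first difference turns each \<open>d choose i\<close> into
  \<open>d choose Suc i\<close>. The new coefficient of index 0 is the constant of summation, fitted
  at \<open>d0\<close>.\<close>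

lemma eventually_polynomial_newton:
  assumes "\<forall>\<^sub>F d in sequentially. (fdiff ^^ t) h d = 0"
  shows "\<exists>a. \<forall>\<^sub>F d in sequentially. h d = (\<Sum>i<t. a i * int (d choose i))"
  using assms
proof (induction t arbitrary: h)
  case (Suc t)
  hence "\<forall>\<^sub>F d in sequentially. (fdiff ^^ t) (fdiff h) d = 0"
    by (simp add: funpow_Suc_right del: funpow.simps)
  from Suc.IH[OF this] obtain a d0 where
    a: "\<And>d. d \<ge> d0 \<Longrightarrow> fdiff h d = (\<Sum>i<t. a i * int (d choose i))"
    by (auto simp: eventually_sequentially)
  define C where "C = h d0 - (\<Sum>i<t. a i * int (d0 choose Suc i))"
  have "h d = C + (\<Sum>i<t. a i * int (d choose Suc i))" if "d \<ge> d0" for d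
    using that
  proof (induction d rule: dec_induct)
    case (step n)
    have "h (Suc n) = h n + fdiff h n" by (simp add: fdiff_def)
    thus ?case using step a[of n] by (simp add: sum.distrib algebra_simps)
  qed (simp add: C_def)
  hence "h d = (\<Sum>i<Suc t. (case i of 0 \<Rightarrow> C | Suc j \<Rightarrow> a j) * int (d choose i))" if "d \<ge> d0" for d
    using that by (simp add: sum.lessThan_Suc_shift del: sum.lessThan_Suc)
  thus ?case unfolding eventually_sequentially by blast
qed simp

text \<open>
  The Hilbert-Serre theorem by Noetherian induction: a variable \<open>x\<close> outside \<open>J\<close> reduces \<open>J\<close> to the
  larger ideals \<open>J + (x)\<close> and, unless it equals \<open>J\<close>, \<open>J : x\<close>.
\<close>

lemma adim_eventually_polynomial:
  fixes J :: "('n::finite, 'k::field) mpoly set"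
  assumes "graded_ideal J"
  shows "eventually_polynomial (\<lambda>d. int (adim J d))"
proof (rule ccontr)
  define E where "E = (\<lambda>J :: ('n, 'k) mpoly set. eventually_polynomial (\<lambda>d. int (adim J d)))"
  assume "\<not> eventually_polynomial (\<lambda>d. int (adim J d))"
  hence "\<not> E J" by (simp add: E_def)
  then obtain M where M: "graded_ideal M" "J \<subseteq> M" "\<not> E M"
    and max: "\<And>J'. graded_ideal J' \<Longrightarrow> M \<subset> J' \<Longrightarrow> E J'"
    using maximal_graded_ideal_exists[where P = "\<lambda>J. \<not> E J", OF assms] by (metis (no_types))
  note M = M[unfolded E_def] and max = max[unfolded E_def]
  note I = graded_ideal_is_ideal[OF M(1)]
  show False
  proof (cases "range var \<subseteq> M")
    case True
    have "is_ideal (max_ideal :: ('n, 'k) mpoly set)" by (simp add: max_ideal_def)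
    moreover have "max_ideal \<subseteq> M" unfolding max_ideal_def using True by (intro ideal_gen_minimal I)
    ultimately have "adim M d \<le> 1" for d
      using adim_antimono[OF _ I, of max_ideal d] by (simp add: adim_max_ideal)
    moreover have "M \<noteq> UNIV"
      using M(3) eventually_polynomial_const[of 0] by auto
    ultimately have "adim M d = 1" for d using adim_pos[OF I] by (metis One_nat_def Suc_leI le_antisym)
    thus False using M(3) eventually_polynomial_const[of 1] by simp
  next
    case False
    then obtain i where i: "var i \<notin> M" by auto
    let ?x = "var i :: ('n, 'k) mpoly"
    have rec: "int (adim M (Suc d)) = int (adim (adj M ?x) (Suc d)) + int (adim (ideal_colon M ?x) d)" for d
      using adim_adj[OF M(1) var_forms[of i], of "Suc d"] by simp
    have "M \<subset> adj M ?x" using i adj_superset[of M ?x] adj_mem[of ?x M] by blast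
    hence 1: "eventually_polynomial (\<lambda>d. int (adim (adj M ?x) (Suc d)))"
      unfolding eventually_polynomial_shift_iff[of "\<lambda>d. int (adim (adj M ?x) d)"]
      by (intro max graded_ideal_adj[OF M(1) var_forms])
    show False
    proof (cases "ideal_colon M ?x = M")
      case True
      hence "eventually_polynomial (\<lambda>d. int (adim M (Suc d)) - int (adim M d))" using 1 rec by simp
      thus False using M(3) eventually_polynomial_fdiff[of "\<lambda>d. int (adim M d)"] by blast
    next
      case False
      hence "M \<subset> ideal_colon M ?x" using ideal_colon_superset[OF I, of ?x] by blast
      hence "eventually_polynomial (\<lambda>d. int (adim (ideal_colon M ?x) d))"
        by (intro max graded_ideal_colon[OF M(1) var_forms])
      from eventually_polynomial_add[OF 1 this]
      have "eventually_polynomial (\<lambda>d. int (adim M (Suc d)))" by (simp add: rec)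
      thus False using M(3) eventually_polynomial_shift_iff[of "\<lambda>d. int (adim M d)"] by blast
    qed
  qed
qed

lemma binomial_sum_tendsto:
  fixes a :: "nat \<Rightarrow> int"
  shows "(\<lambda>d. real_of_int (\<Sum>i\<le>j. a i * int (d choose i)) / real d ^ j) \<longlonglongrightarrow> a j / fact j"
proof -
  have "(\<lambda>d. real (d choose i) / real d ^ j) \<longlonglongrightarrow> (if i = j then 1 / fact j else 0)" if "i \<le> j" for i
  proof (cases "i = j")
    case True thus ?thesis using binomial_tendsto[of 0 j] by simp
  next
    case False
    hence "(\<lambda>d. (1 / real d) ^ (j - i)) \<longlonglongrightarrow> 0 ^ (j - i)" by (intro tendsto_power lim_1_over_n)
    from tendsto_mult[OF binomial_tendsto[of 0 i] this]
    have "(\<lambda>d. real (d choose i) / real d ^ i * (1 / real d) ^ (j - i)) \<longlonglongrightarrow> 0"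
      using False that by (simp add: power_0_left)
    moreover have "real (d choose i) / real d ^ i * (1 / real d) ^ (j - i) = real (d choose i) / real d ^ j" for d
      using that by (simp add: power_divide flip: power_add)
    ultimately show ?thesis using False by simp
  qed
  hence "(\<lambda>d. \<Sum>i\<le>j. real_of_int (a i) * (real (d choose i) / real d ^ j)) \<longlonglongrightarrow>
      (\<Sum>i\<le>j. real_of_int (a i) * (if i = j then 1 / fact j else 0))"
    by (intro tendsto_sum tendsto_mult_left) auto
  moreover have "(\<Sum>i\<le>j. real_of_int (a i) * (if i = j then 1 / fact j else 0)) = a j / fact j"
    by (simp add: if_distrib cong: if_cong)
  ultimately show ?thesis by (simp add: sum_divide_distrib)
qed

text \<open>A nonzero coefficient of largest index j > k would be j! times the limit of
  \<open>adim J d / d ^ j\<close>, and the growth bound makes this limit 0.\<close>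

lemma adim_newton:
  assumes J: "graded_ideal J" and growth: "growth_le J k"
  obtains a where "\<forall>\<^sub>F d in sequentially. int (adim J d) = (\<Sum>i\<le>k. a i * int (d choose i))"
proof -
  obtain t a where a: "\<forall>\<^sub>F d in sequentially. int (adim J d) = (\<Sum>i<t. a i * int (d choose i))"
    using eventually_polynomial_newton adim_eventually_polynomial[OF J] unfolding eventually_polynomial_def by blast
  \<comment> \<open>Padding with zeros allows sums of length t and k + 1 to be compared without
    knowing which is longer.\<close>
  define b where "b = (\<lambda>i. if i < t then a i else 0)"
  have sum_b: "(\<Sum>i<t. a i * int (d choose i)) = (\<Sum>i\<le>j. b i * int (d choose i))"
    if "\<And>i. i > j \<Longrightarrow> b i = 0" for d j
  proof -
    have "(\<Sum>i<t. a i * int (d choose i)) = (\<Sum>i\<le>t + j. b i * int (d choose i))"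
      by (intro sum.mono_neutral_cong_left) (auto simp: b_def)
    also have "\<dots> = (\<Sum>i\<le>j. b i * int (d choose i))"
      using that by (intro sum.mono_neutral_right) auto
    finally show ?thesis .
  qed
  have "b i = 0" if "i > k" for i
  proof (rule ccontr)
    assume "b i \<noteq> 0"
    define j where "j = Max {i. b i \<noteq> 0}"
    have "finite {i. b i \<noteq> 0}" by (rule finite_subset[of _ "{..<t}"]) (auto simp: b_def)
    hence j: "b j \<noteq> 0" "j \<ge> i" "\<And>i. i > j \<Longrightarrow> b i = 0"
      using \<open>b i \<noteq> 0\<close> Max_in[of "{i. b i \<noteq> 0}"] Max_ge[of "{i. b i \<noteq> 0}"] unfolding j_def by (blast, blast, fastforce)
    have "\<forall>\<^sub>F d in sequentially. int (adim J d) = (\<Sum>i\<le>j. b i * int (d choose i))"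
      using a sum_b[OF j(3)] by simp
    hence "\<forall>\<^sub>F d in sequentially. real_of_int (\<Sum>i\<le>j. b i * int (d choose i)) / real d ^ j = real (adim J d) / real d ^ j"
      by eventually_elim (metis of_int_of_nat_eq)
    from Lim_transform_eventually[OF binomial_sum_tendsto this]
    have lim: "(\<lambda>d. real (adim J d) / real d ^ j) \<longlonglongrightarrow> b j / fact j" .
    obtain C where C: "\<And>d. adim J d \<le> C * (d + 1) ^ k" using growth by (auto simp: growth_le_def)
    have "real (adim J d) / real d ^ j \<le> real C * 2 ^ k * (1 / real d)" if "d > 0" for d
    proof -
      have "real (adim J d) \<le> real (C * (d + 1) ^ k)" using C by (simp only: of_nat_le_iff)
      also have "\<dots> \<le> real C * (2 * real d) ^ k"
        unfolding of_nat_mult of_nat_power using that by (intro mult_left_mono power_mono) auto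
      finally have "real (adim J d) / real d ^ j \<le> real C * 2 ^ k * real d ^ k / real d ^ j"
        by (intro divide_right_mono) (auto simp: power_mult_distrib mult.assoc)
      also have "\<dots> \<le> real C * 2 ^ k * real d ^ k / real d ^ Suc k"
        using j(2) \<open>i > k\<close> that by (intro divide_left_mono power_increasing mult_nonneg_nonneg) auto
      also have "\<dots> = real C * 2 ^ k * (1 / real d)" using that by (simp add: field_simps)
      finally show ?thesis .
    qed
    hence le: "\<forall>\<^sub>F d in sequentially. real (adim J d) / real d ^ j \<le> real C * 2 ^ k * (1 / real d)"
      by (intro eventually_mono[OF eventually_gt_at_top[of 0]]) auto
    have lim0: "(\<lambda>d. real C * 2 ^ k * (1 / real d)) \<longlonglongrightarrow> real C * 2 ^ k * 0"
      by (intro tendsto_mult_left lim_1_over_n)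
    have ge: "\<forall>\<^sub>F d in sequentially. 0 \<le> real (adim J d) / real d ^ j" by simp
    have "(\<lambda>d. real (adim J d) / real d ^ j) \<longlonglongrightarrow> 0"
      using tendsto_sandwich[OF ge le tendsto_const lim0[unfolded mult_zero_right]] .
    from LIMSEQ_unique[OF this lim] show False using j(1) by simp
  qed
  thus ?thesis using that[of b] a sum_b[of k] by simp
qed

text \<open>Both values are the coefficient of index k: directly for \<open>adim\<close>, and as the
  coefficient of index k - 1 of its first difference, the Hilbert function. For k = 0 it is the
  eventual value of \<open>adim\<close>. Being an integer and a limit of nonnegative terms, it is a
  natural number.\<close>

lemma adim_degree:
  assumes J: "graded_ideal J" and growth: "growth_le J k" and dim: "quot_krull_dim J = enat k"
  obtains n :: nat where "quot_degree J = real n" "(\<lambda>d. fact k * real (adim J d) / real d ^ k) \<longlonglongrightarrow> real n"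
proof -
  obtain a where a: "\<forall>\<^sub>F d in sequentially. int (adim J d) = (\<Sum>i\<le>k. a i * int (d choose i))"
    using adim_newton[OF J growth] by blast
  hence "\<forall>\<^sub>F d in sequentially. real_of_int (\<Sum>i\<le>k. a i * int (d choose i)) / real d ^ k = real (adim J d) / real d ^ k"
    by eventually_elim (metis of_int_of_nat_eq)
  from Lim_transform_eventually[OF binomial_sum_tendsto this]
  have "(\<lambda>d. fact k * (real (adim J d) / real d ^ k)) \<longlonglongrightarrow> fact k * (a k / fact k)"
    by (rule tendsto_mult_left)
  hence lim: "(\<lambda>d. fact k * real (adim J d) / real d ^ k) \<longlonglongrightarrow> a k" by simp
  have "real_of_int (a k) \<ge> 0" by (rule LIMSEQ_le_const[OF lim]) auto
  then obtain n where n: "a k = int n" using nonneg_int_cases by auto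
  have "quot_degree J = real n"
  proof (cases k)
    case 0
    obtain d0 where d0: "\<And>d. d \<ge> d0 \<Longrightarrow> adim J d = n" using a n 0 by (auto simp: eventually_sequentially)
    have "quot_dim UNIV J = adim J d0"
      by (rule quot_dim_UNIV[OF graded_ideal_is_ideal[OF J]]) (simp add: d0)
    thus ?thesis using dim 0 d0 by (simp add: quot_degree_def)
  next
    case (Suc k')
    have "\<forall>\<^sub>F d in sequentially. int (adim J (Suc d)) = (\<Sum>i\<le>k. a i * int (Suc d choose i))"
      using a eventually_sequentially_Suc[of "\<lambda>d. int (adim J d) = (\<Sum>i\<le>k. a i * int (d choose i))"] by simp
    with a have "\<forall>\<^sub>F d in sequentially. real_of_int (\<Sum>i\<le>k'. a (Suc i) * int (d choose i)) / real d ^ k' =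
        real (hilbert_fun J (Suc d)) / real d ^ k'"
    proof eventually_elim
      case (elim d)
      have "int (hilbert_fun J (Suc d)) = int (adim J (Suc d)) - int (adim J d)"
        using hilbert_fun_Suc[OF J, of d] by simp
      also have "\<dots> = (\<Sum>i\<le>k'. a (Suc i) * int (d choose i))"
        unfolding elim Suc sum.atMost_Suc_shift by (simp add: distrib_left sum.distrib)
      finally show ?case by (metis of_int_of_nat_eq)
    qed
    from Lim_transform_eventually[OF binomial_sum_tendsto this]
    have 1: "(\<lambda>d. real (hilbert_fun J (Suc d)) / real d ^ k') \<longlonglongrightarrow> a k / fact k'" by (simp add: Suc)
    have "(\<lambda>d. (real d / real (Suc d)) ^ k') \<longlonglongrightarrow> 1 ^ k'" by (intro tendsto_power LIMSEQ_n_over_Suc_n)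
    from tendsto_mult[OF 1 this]
    have "(\<lambda>d. real (hilbert_fun J (Suc d)) / real d ^ k' * (real d / real (Suc d)) ^ k') \<longlonglongrightarrow> a k / fact k'"
      by simp
    hence "(\<lambda>d. real (hilbert_fun J (Suc d)) / real (Suc d) ^ k') \<longlonglongrightarrow> a k / fact k'"
      by (rule Lim_transform_eventually)
        (use eventually_gt_at_top[of 0] in \<open>eventually_elim, simp add: power_divide\<close>)
    hence "(\<lambda>d. real (hilbert_fun J d) / real d ^ k') \<longlonglongrightarrow> a k / fact k'" by (rule LIMSEQ_imp_Suc)
    from limI[OF this] show ?thesis using dim Suc n by (simp add: quot_degree_def)
  qed
  thus ?thesis using that lim n by simp
qed

lemma quot_degree_le:
  assumes J: "graded_ideal J" and dim: "quot_krull_dim J = enat k" and le: "mult_le J k \<rho>"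
  shows "quot_degree J \<le> \<rho>"
proof -
  obtain n where n: "quot_degree J = real n" "(\<lambda>d. fact k * real (adim J d) / real d ^ k) \<longlonglongrightarrow> real n"
    using adim_degree[OF J mult_le_growth_le[OF le] dim] by blast
  obtain C where C: "\<And>d. real (adim J d) \<le> \<rho> * real ((d + C) choose k)" using le by (auto simp: mult_le_def)
  have "(\<lambda>d. (\<rho> * fact k) * (real ((d + C) choose k) / real d ^ k)) \<longlonglongrightarrow> (\<rho> * fact k) * (1 / fact k)"
    by (intro tendsto_mult_left binomial_tendsto)
  hence lim: "(\<lambda>d. (\<rho> * fact k) * (real ((d + C) choose k) / real d ^ k)) \<longlonglongrightarrow> \<rho>" by simp
  have "fact k * real (adim J d) / real d ^ k \<le> (\<rho> * fact k) * (real ((d + C) choose k) / real d ^ k)" for d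
  proof -
    have "fact k * real (adim J d) \<le> fact k * (\<rho> * real ((d + C) choose k))"
      by (intro mult_left_mono C) simp
    from divide_right_mono[OF this, of "real d ^ k"] show ?thesis by (simp add: mult_ac)
  qed
  hence "real n \<le> \<rho>" by (intro LIMSEQ_le[OF n(2) lim]) blast
  thus ?thesis using n(1) by simp
qed

text \<open>Strictness turns the limit into an inequality for all large d.\<close>

lemma mult_le_quot_degree:
  assumes J: "graded_ideal J" and growth: "growth_le J k" and dim: "quot_krull_dim J = enat k"
    and less: "quot_degree J < \<rho>"
  shows "mult_le J k \<rho>"
proof -
  obtain n where n: "quot_degree J = real n" "(\<lambda>d. fact k * real (adim J d) / real d ^ k) \<longlonglongrightarrow> real n"
    using adim_degree[OF J growth dim] by blast
  have "\<forall>\<^sub>F d in sequentially. fact k * real (adim J d) / real d ^ k < \<rho>"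
    using order_tendstoD(2)[OF n(2)] less n(1) by simp
  hence "\<forall>\<^sub>F d in sequentially. fact k * real (adim J d) / real d ^ k < \<rho> \<and> d > 0"
    using eventually_gt_at_top[of 0] by eventually_elim simp
  then obtain d0 where d0: "\<And>d. d \<ge> d0 \<Longrightarrow> fact k * real (adim J d) / real d ^ k < \<rho> \<and> d > 0"
    unfolding eventually_sequentially by blast
  have \<rho>: "\<rho> \<ge> 0" using less n(1) by simp
  have big: "real (adim J d) \<le> \<rho> * real ((d + k) choose k)" if "d \<ge> d0" for d
  proof -
    have "fact k * real (adim J d) = fact k * real (adim J d) / real d ^ k * real d ^ k"
      using d0[OF that] by simp
    also have "\<dots> \<le> \<rho> * real d ^ k" using d0[OF that] by (intro mult_right_mono) auto
    also have "\<dots> \<le> \<rho> * real (fact k * ((d + k) choose k))"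
    proof (rule mult_left_mono[OF _ \<rho>])
      have "real d ^ k \<le> real ((d + 1) ^ k)" unfolding of_nat_power by (intro power_mono) auto
      also have "\<dots> \<le> real (fact k * ((d + k) choose k))"
        using power_le_fact_binomial by (simp only: of_nat_le_iff)
      finally show "real d ^ k \<le> real (fact k * ((d + k) choose k))" .
    qed
    finally have "fact k * real (adim J d) \<le> fact k * (\<rho> * real ((d + k) choose k))"
      by (simp add: mult_ac)
    thus ?thesis by simp
  qed
  \<comment> \<open>So far the bound starts at \<open>d0\<close>. Monotonicity of
    \<open>adim\<close> carries it from d + d0 back to d, at the price of a larger shift.\<close>
  have "real (adim J d) \<le> \<rho> * real ((d + (k + d0)) choose k)" for d
  proof -
    have "real (adim J d) \<le> real (adim J (d + d0))"
      using adim_mono[OF graded_ideal_is_ideal[OF J], of d "d + d0"] by simp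
    also have "\<dots> \<le> \<rho> * real ((d + d0 + k) choose k)" by (rule big) simp
    finally show ?thesis by (simp add: ac_simps)
  qed
  thus ?thesis unfolding mult_le_def by blast
qed

lemma mult_le_adjs:
  assumes "graded_ideal J" "set gs \<subseteq> forms e" "e > 0" "\<rho> \<ge> 0" "mult_le (adjs J gs) t \<rho>"
  shows "mult_le J (t + length gs) (\<rho> / real e ^ length gs)"
  using assms
proof (induction gs arbitrary: J)
  case (Cons g gs)
  have "mult_le (adj J g) (t + length gs) (\<rho> / real e ^ length gs)"
    using Cons.prems by (intro Cons.IH graded_ideal_adj[of J g e]) auto
  from mult_le_step[OF Cons.prems(1) _ Cons.prems(3) _ this] show ?case
    using Cons.prems by (simp add: field_simps)
qed simp

lemma graded_ideal_adjs:
  fixes J :: "('n::finite, 'k::field) mpoly set"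
  shows "graded_ideal J \<Longrightarrow> set gs \<subseteq> forms e \<Longrightarrow> graded_ideal (adjs J gs)"
  by (induction gs arbitrary: J) (auto intro: graded_ideal_adj)


section \<open>Dimension and height\<close>

text \<open>
  The number \<open>N\<close> of variables enters only through the affine Hilbert function
  \<open>binom(d + N, N)\<close> of the polynomial ring.
\<close>

definition num_vars :: "'n::finite itself \<Rightarrow> 'k::field itself \<Rightarrow> nat" where
  "num_vars _ _ = (SOME N. \<forall>d. adim ({0} :: ('n, 'k) mpoly set) d = (d + N) choose N)"

lemma adim_zero:
  "adim ({0} :: ('n::finite, 'k::field) mpoly set) d =
    (d + num_vars TYPE('n) TYPE('k)) choose num_vars TYPE('n) TYPE('k)"
  using someI_ex[OF adim_zero_exists[where 'n = 'n and 'k = 'k]] unfolding num_vars_def by blast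

text \<open>The value at d = 1 is N + 1 and so determines N.\<close>

lemma num_vars_eqI:
  assumes "\<And>d. adim ({0} :: ('n::finite, 'k::field) mpoly set) d = (d + N) choose N"
  shows "num_vars TYPE('n) TYPE('k) = N"
  using adim_zero[of 1, where 'n = 'n and 'k = 'k] assms[of 1] by simp

lemma lin_chain_length:
  fixes ls :: "('n::finite, 'k::field) mpoly list"
  assumes "lin_chain {0} ls" "adjs {0} ls = max_ideal"
  shows "length ls = num_vars TYPE('n) TYPE('k)"
  using num_vars_eqI adim_lin_chain[OF linear_ideal_zero assms] by metis

lemma growth_le_zero: "growth_le ({0} :: ('n::finite, 'k::field) mpoly set) (num_vars TYPE('n) TYPE('k))"
  by (rule mult_le_growth_le[of _ _ 1]) (auto simp: mult_le_def adim_zero)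

lemma growth_le_num_vars:
  fixes J :: "('n::finite, 'k::field) mpoly set"
  assumes "is_ideal J"
  shows "growth_le J (num_vars TYPE('n) TYPE('k))"
  using growth_le_antimono[OF growth_le_zero _ assms] is_ideal_0[OF assms] by auto

text \<open>S has dimension N and multiplicity 1. Combined with \<open>mult_le_adjs\<close> this is
  the lower bound by the product of the degrees for ideals generated by N - t forms.\<close>

lemma mult_le_zero:
  assumes "mult_le ({0} :: ('n::finite, 'k::field) mpoly set) t \<rho>"
  shows "num_vars TYPE('n) TYPE('k) \<le> t" "t = num_vars TYPE('n) TYPE('k) \<Longrightarrow> \<rho> \<ge> 1"
proof -
  let ?N = "num_vars TYPE('n) TYPE('k)"
  obtain ls :: "('n, 'k) mpoly list" where ls: "lin_chain {0} ls" "adjs {0} ls = max_ideal"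
    using lin_chain_extend[OF linear_ideal_max_ideal linear_ideal_zero linear_ideal_le_max_ideal[OF linear_ideal_zero]]
    by blast
  show "?N \<le> t"
    using growth_le_chain[OF lin_chain_prime_chain[OF linear_ideal_zero ls(1)], of t] mult_le_growth_le[OF assms]
      lin_chain_length[OF ls] by simp
  assume t: "t = ?N"
  obtain C where C: "\<And>d. real ((d + ?N) choose ?N) \<le> \<rho> * real ((d + C) choose ?N)"
    using assms by (auto simp: mult_le_def adim_zero t)
  have "real ((d + ?N) choose ?N) / real d ^ ?N \<le> \<rho> * (real ((d + C) choose ?N) / real d ^ ?N)" for d
    using divide_right_mono[OF C, of "real d ^ ?N"] by simp
  hence "1 / fact ?N \<le> \<rho> * (1 / fact ?N)"
    by (intro LIMSEQ_le[OF binomial_tendsto tendsto_mult_left[OF binomial_tendsto]]) blast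
  thus "\<rho> \<ge> 1" by (simp add: divide_le_cancel)
qed

section \<open>Heights\<close>

lemma prime_height_ge: "prime_chain n C \<Longrightarrow> C n = P \<Longrightarrow> enat n \<le> prime_height P"
  unfolding prime_height_def by (rule Sup_upper) blast

text \<open>In \<open>enat\<close>, a supremum of at least c' + 1 forces a member of at least c' +
  1, since otherwise c' would be an upper bound. For c = 0 the one-element chain serves.\<close>

lemma prime_height_geE:
  assumes "enat c \<le> prime_height P" "is_prime_ideal P"
  obtains n C where "c \<le> n" "prime_chain n C" "C n = P"
proof (cases c)
  case 0
  show ?thesis by (rule that[of 0 "\<lambda>_. P"]) (use assms 0 in \<open>auto simp: prime_chain_def\<close>)
next
  case (Suc c')
  have "\<exists>n C. c \<le> n \<and> prime_chain n C \<and> C n = P"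
  proof (rule ccontr)
    assume neg: "\<nexists>n C. c \<le> n \<and> prime_chain n C \<and> C n = P"
    have "prime_height P \<le> enat c'"
      unfolding prime_height_def
    proof (rule Sup_least, safe)
      fix n C assume "prime_chain n C" "P = C n"
      thus "enat n \<le> enat c'" using neg Suc by (metis enat_ord_simps(1) not_less_eq_eq)
    qed
    thus False using assms(1) Suc by (metis enat_ord_simps(1) not_less_eq_eq order_refl order_trans)
  qed
  thus ?thesis using that by blast
qed

lemma prime_height_mono:
  assumes "is_prime_ideal Q" "P \<subseteq> Q"
  shows "prime_height P \<le> prime_height Q"
  unfolding prime_height_def[of P]
proof (rule Sup_least, safe)
  fix n C assume C: "prime_chain n C" "P = C n"
  show "enat n \<le> prime_height Q"
  proof (rule prime_height_ge)
    show "prime_chain n (C(n := Q))"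
      using C assms unfolding prime_chain_def
      by (auto simp: less_Suc_eq_le)
  qed simp
qed

lemma ideal_height_le: "is_prime_ideal P \<Longrightarrow> I \<subseteq> P \<Longrightarrow> ideal_height I \<le> prime_height P"
  unfolding ideal_height_def by (rule Inf_lower) blast

lemma ideal_height_prime_ge: "enat n \<le> prime_height P \<Longrightarrow> enat n \<le> ideal_height P"
  unfolding ideal_height_def using prime_height_mono order_trans by (intro Inf_greatest) blast

lemma ideal_height_attained:
  assumes "ideal_height I = enat c"
  obtains P where "is_prime_ideal P" "I \<subseteq> P" "prime_height P = enat c"
proof -
  let ?H = "{prime_height P | P. is_prime_ideal P \<and> I \<subseteq> P}"
  have "?H \<noteq> {}"
  proof
    assume "?H = {}"
    hence "ideal_height I = Inf {}" unfolding ideal_height_def by (rule arg_cong)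
    thus False using assms by (simp add: top_enat_def)
  qed
  hence "Inf ?H \<in> ?H" by (auto simp: Inf_enat_def intro: LeastI)
  thus ?thesis using that assms unfolding ideal_height_def by auto
qed

text \<open>Every prime over I ends a chain of length at least c, and each step of it lowers an
  order of growth that starts at no more than N. By \<open>prime_of_growth\<close>, faster growth of
  I would show up at such a prime.\<close>

lemma growth_le_height:
  fixes I :: "('n::finite, 'k::field) mpoly set"
  assumes I: "graded_ideal I" and c: "ideal_height I = enat c"
  shows "growth_le I (num_vars TYPE('n) TYPE('k) - c)" "c \<le> num_vars TYPE('n) TYPE('k)"
proof -
  let ?N = "num_vars TYPE('n) TYPE('k)"
  have chain: "c \<le> ?N \<and> growth_le P (?N - c)" if P: "is_prime_ideal P" "enat c \<le> prime_height P" for P :: "('n, 'k) mpoly set"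
  proof -
    obtain n C where C: "c \<le> n" "prime_chain n C" "C n = P" using prime_height_geE[OF P(2,1)] by blast
    have "is_ideal (C 0)" using C(2) by (auto simp: prime_chain_def is_prime_ideal_def)
    from growth_le_chain[OF C(2) growth_le_num_vars[OF this]] have "n \<le> ?N" "growth_le P (?N - n)"
      using C(3) by auto
    thus ?thesis using C(1) growth_le_mono[of P "?N - n" "?N - c"] by simp
  qed
  show "c \<le> ?N" using ideal_height_attained[OF c] chain by (metis order_refl)
  show "growth_le I (?N - c)"
  proof (rule ccontr)
    assume "\<not> growth_le I (?N - c)"
    then obtain J where J: "is_prime_ideal J" "I \<subseteq> J" "\<not> growth_le J (?N - c)"
      using prime_of_growth[OF I] by metis
    thus False using chain[OF J(1)] ideal_height_le[OF J(1,2)] c by simp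
  qed
qed

section \<open>Associated primes\<close>

lemma ass_prime_above_colon:
  fixes I :: "('n::finite, 'k::field) mpoly set"
  assumes I: "is_ideal I" and h: "h \<notin> I"
  obtains P where "P \<in> ass_primes I" "ideal_colon I h \<subseteq> P"
proof -
  \<comment> \<open>A maximal member of this family of proper colon ideals is prime.\<close>
  let ?Q = "\<lambda>J. \<exists>g. J = ideal_colon I g \<and> g \<notin> I"
  from maximal_ideal_exists[where P = ?Q, OF is_ideal_colon[OF I, of h]] h
  obtain J where J: "is_ideal J" "ideal_colon I h \<subseteq> J" "?Q J"
    "\<And>J'. is_ideal J' \<Longrightarrow> J \<subset> J' \<Longrightarrow> \<not> ?Q J'"
    by (metis (no_types, lifting))
  obtain g where g: "J = ideal_colon I g" "g \<notin> I" using J(3) by blast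
  have "is_prime_ideal J"
    unfolding is_prime_ideal_def
  proof (intro conjI allI impI J(1))
    show "J \<noteq> UNIV" using g is_ideal_UNIV_iff[OF J(1)] by (simp add: ideal_colon_def)
    fix a b assume ab: "a * b \<in> J"
    show "a \<in> J \<or> b \<in> J"
    proof (rule ccontr)
      assume neg: "\<not> (a \<in> J \<or> b \<in> J)"
      have "J \<subseteq> ideal_colon I (a * g)"
        using I by (auto simp: g(1) ideal_colon_def mult.left_commute[of _ a] intro: is_ideal_mult)
      moreover have "b \<in> ideal_colon I (a * g)"
        using ab by (simp add: g(1) ideal_colon_def mult_ac)
      ultimately have "J \<subset> ideal_colon I (a * g)" using neg by blast
      moreover have "a * g \<notin> I" using neg by (simp add: g(1) ideal_colon_def)
      ultimately show False using J(4)[OF is_ideal_colon[OF I]] by blast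
    qed
  qed
  hence "J \<in> ass_primes I" using g by (auto simp: ass_primes_def)
  thus ?thesis using that J(2) by blast
qed

text \<open>Localisation at P0 done by hand: let I : g be maximal among the colon ideals inside P0,
  and suppose a b lies in it but neither a nor b does. Then I : (a g) is larger, so it has an
  element u outside P0. Now I : (u g) contains a and still lies in P0, since u is outside P0; this
  contradicts maximality.\<close>

lemma ass_prime_below_prime:
  fixes I :: "('n::finite, 'k::field) mpoly set"
  assumes I: "is_ideal I" and P0: "is_prime_ideal P0" "I \<subseteq> P0"
  obtains P where "P \<in> ass_primes I" "P \<subseteq> P0"
proof -
  let ?Q = "\<lambda>J. \<exists>g. J = ideal_colon I g \<and> J \<subseteq> P0"
  have "?Q I" using P0(2) by (intro exI[of _ 1]) (simp add: ideal_colon_def)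
  from maximal_ideal_exists[where P = ?Q, OF I this]
  obtain J where J: "is_ideal J" "I \<subseteq> J" "?Q J"
    "\<And>J'. is_ideal J' \<Longrightarrow> J \<subset> J' \<Longrightarrow> \<not> ?Q J'"
    by (metis (no_types, lifting))
  obtain g where g: "J = ideal_colon I g" "J \<subseteq> P0" using J(3) by blast
  have "is_prime_ideal J"
    unfolding is_prime_ideal_def
  proof (intro conjI allI impI J(1))
    show "J \<noteq> UNIV" using g(2) P0(1) by (auto simp: is_prime_ideal_def)
    fix a b assume ab: "a * b \<in> J"
    show "a \<in> J \<or> b \<in> J"
    proof (rule ccontr)
      assume neg: "\<not> (a \<in> J \<or> b \<in> J)"
      have "J \<subseteq> ideal_colon I (a * g)"
        using I by (auto simp: g(1) ideal_colon_def mult.left_commute[of _ a] intro: is_ideal_mult)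
      moreover have "b \<in> ideal_colon I (a * g)"
        using ab by (simp add: g(1) ideal_colon_def mult_ac)
      ultimately have "J \<subset> ideal_colon I (a * g)" using neg by blast
      hence "\<not> ideal_colon I (a * g) \<subseteq> P0" using J(4)[OF is_ideal_colon[OF I]] by blast
      then obtain u where u: "u * (a * g) \<in> I" "u \<notin> P0" by (auto simp: ideal_colon_def)
      have "J \<subseteq> ideal_colon I (u * g)"
        using I by (auto simp: g(1) ideal_colon_def mult.left_commute[of _ u] intro: is_ideal_mult)
      moreover have "a \<in> ideal_colon I (u * g)"
        using u(1) by (simp add: ideal_colon_def mult_ac)
      ultimately have "J \<subset> ideal_colon I (u * g)" using neg by blast
      moreover have "ideal_colon I (u * g) \<subseteq> P0"
      proof
        fix s assume "s \<in> ideal_colon I (u * g)"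
        hence "s * u \<in> J" by (simp add: g(1) ideal_colon_def mult_ac)
        thus "s \<in> P0" using g(2) u(2) P0(1) by (auto simp: is_prime_ideal_def)
      qed
      ultimately show False using J(4)[OF is_ideal_colon[OF I]] by blast
    qed
  qed
  hence "J \<in> ass_primes I" using g by (auto simp: ass_primes_def)
  thus ?thesis using that g(2) by blast
qed

text \<open>The height of I is attained at a prime. That prime contains an associated one, and all
  associated primes share one height.\<close>

lemma unmixed_height_le:
  fixes I :: "('n::finite, 'k::field) mpoly set"
  assumes "unmixed I" "ideal_height I = enat c" "P \<in> ass_primes I"
  shows "ideal_height P \<le> enat c"
proof -
  have I: "is_ideal I" using assms(1) by (simp add: unmixed_def)
  obtain P0 where P0: "is_prime_ideal P0" "I \<subseteq> P0" "prime_height P0 = enat c"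
    using ideal_height_attained[OF assms(2)] by blast
  obtain P1 where P1: "P1 \<in> ass_primes I" "P1 \<subseteq> P0" using ass_prime_below_prime[OF I P0(1,2)] by blast
  have "ideal_height P = ideal_height P1" using assms(1,3) P1(1) unfolding unmixed_def by blast
  also have "\<dots> \<le> prime_height P0" by (rule ideal_height_le[OF P0(1) P1(2)])
  finally show ?thesis using P0(3) by simp
qed

text \<open>The growth of I bounds the dimension from above. From below, chains of linear primes
  lead from 0 to P and from P to the maximal ideal in N steps altogether; at most c of them are
  below P, so at least N - c primes steps remain above Q.\<close>

lemma krull_dim_below_linear_prime:
  fixes I Q P :: "('n::finite, 'k::field) mpoly set"
  assumes I: "graded_ideal I" "ideal_height I = enat c"
    and Q: "is_ideal Q" "I \<subseteq> Q" "Q \<subseteq> P"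
    and P: "generated_by_linear_forms P" "ideal_height P \<le> enat c"
  shows "quot_krull_dim Q = enat (num_vars TYPE('n) TYPE('k) - c)"
    "growth_le Q (num_vars TYPE('n) TYPE('k) - c)"
proof -
  let ?N = "num_vars TYPE('n) TYPE('k)"
  note IP = linear_ideal_prime[OF P(1), THEN is_prime_ideal_is_ideal]
  obtain ls where ls: "lin_chain {0} ls" "adjs {0} ls = P"
    using lin_chain_extend[OF P(1) linear_ideal_zero] is_ideal_0[OF IP] by blast
  obtain ls' where ls': "lin_chain P ls'" "adjs P ls' = max_ideal"
    using lin_chain_extend[OF linear_ideal_max_ideal P(1) linear_ideal_le_max_ideal[OF P(1)]] by blast
  have "enat (length ls) \<le> prime_height P"
    by (rule prime_height_ge[OF lin_chain_prime_chain[OF linear_ideal_zero ls(1)]]) (simp add: ls)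
  from order_trans[OF ideal_height_prime_ge[OF this] P(2)] have "length ls \<le> c" by simp
  moreover have "length ls + length ls' = ?N"
    using lin_chain_length[of "ls @ ls'"] ls ls' by (simp add: lin_chain_append)
  ultimately have "?N - c \<le> length ls'" by simp
  moreover have "enat (length ls') \<le> quot_krull_dim Q"
    unfolding quot_krull_dim_def
    using lin_chain_prime_chain[OF P(1) ls'(1)] Q(3) 
    by (intro Sup_upper CollectI exI[of _ "length ls'"] exI[of _ "\<lambda>i. adjs P (take i ls')"] conjI) auto
  ultimately have "enat (?N - c) \<le> quot_krull_dim Q"
    using order_trans[of "enat (?N - c)" "enat (length ls')"] by simp
  moreover show growth: "growth_le Q (?N - c)"
    using growth_le_antimono[OF growth_le_height(1)[OF I] graded_ideal_is_ideal[OF I(1)] Q(1,2)] .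
  ultimately show "quot_krull_dim Q = enat (?N - c)" using quot_krull_dim_le[OF Q(1) growth] by simp
qed

section \<open>The upper bound over infinite fields\<close>

lemma avoid_subspaces:
  fixes V :: "('n, 'k::field) mpoly set"
  assumes "infinite (UNIV :: 'k set)" and V: "kspace.subspace V"
    and "finite S" "\<And>p. p \<in> S \<Longrightarrow> kspace.subspace p \<and> \<not> V \<subseteq> p"
  shows "\<exists>v\<in>V. \<forall>p\<in>S. v \<notin> p"
  using assms(3,4)
proof (induction S)
  case empty
  thus ?case using kspace.subspace_0[OF V] by blast
next
  case (insert p S)
  then obtain v where v: "v \<in> V" "\<And>q. q \<in> S \<Longrightarrow> v \<notin> q" by blast
  show ?case
  proof (cases "v \<in> p")
    case False
    thus ?thesis using v by blast
  next
    case True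
    obtain w where w: "w \<in> V" "w \<notin> p" using insert.prems by blast
    have p: "kspace.subspace p" using insert.prems by blast
    \<comment> \<open>As v avoids the earlier subspaces q, the line w + a v meets each in at most
      one point. It misses p, which contains v but not w, so an infinite field leaves a suitable
      a.\<close>
    have "finite {a. w + kscale a v \<in> q}" if q: "q \<in> S" for q
    proof -
      have sq: "kspace.subspace q" using insert.prems q by blast
      have "a = b" if "w + kscale a v \<in> q" "w + kscale b v \<in> q" for a b
      proof (rule ccontr)
        assume "a \<noteq> b"
        have "kscale (inverse (a - b)) ((w + kscale a v) - (w + kscale b v)) \<in> q"
          by (intro kspace.subspace_scale[OF sq] kspace.subspace_diff[OF sq] that)
        moreover have "(w + kscale a v) - (w + kscale b v) = kscale (a - b) v"
          by (simp add: kspace.scale_left_diff_distrib)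
        ultimately have "v \<in> q" using \<open>a \<noteq> b\<close> by simp
        thus False using v(2)[OF q] by blast
      qed
      hence "{a. w + kscale a v \<in> q} = {} \<or> (\<exists>a. {a. w + kscale a v \<in> q} = {a})" by blast
      thus ?thesis by auto
    qed
    hence "finite (\<Union>q\<in>S. {a. w + kscale a v \<in> q})" using insert.hyps by blast
    then obtain a where a: "a \<notin> (\<Union>q\<in>S. {a. w + kscale a v \<in> q})"
      using ex_new_if_finite[OF assms(1)] by blast
    have "w + kscale a v \<notin> p"
    proof
      assume "w + kscale a v \<in> p"
      hence "(w + kscale a v) - kscale a v \<in> p"
        using True by (intro kspace.subspace_diff[OF p] kspace.subspace_scale[OF p])
      thus False using w by simp
    qed
    moreover have "w + kscale a v \<in> V"
      using v w by (intro kspace.subspace_add[OF V] kspace.subspace_scale[OF V])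
    ultimately show ?thesis using a by blast
  qed
qed

text \<open>A maximal counterexample M is not prime, so a b lies in M for forms a, b outside M.
  Every prime over M contains a or b, and the finite sets for M + (a) and M + (b) can be
  united.\<close>

lemma finite_minimal_graded_primes:
  fixes J :: "('n::finite, 'k::field) mpoly set"
  assumes "graded_ideal J"
  shows "\<exists>S. finite S \<and> (\<forall>p\<in>S. is_prime_ideal p \<and> J \<subseteq> p) \<and>
    (\<forall>P. is_prime_ideal P \<and> J \<subseteq> P \<longrightarrow> (\<exists>p\<in>S. p \<subseteq> P))"
proof (rule ccontr)
  define E where "E = (\<lambda>J :: ('n, 'k) mpoly set. \<exists>S. finite S \<and> (\<forall>p\<in>S. is_prime_ideal p \<and> J \<subseteq> p) \<and>
    (\<forall>P. is_prime_ideal P \<and> J \<subseteq> P \<longrightarrow> (\<exists>p\<in>S. p \<subseteq> P)))"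
  assume "\<not> ?thesis"
  hence "\<not> E J" by (simp add: E_def)
  then obtain M where M: "graded_ideal M" "J \<subseteq> M" "\<not> E M"
    and max: "\<And>J'. graded_ideal J' \<Longrightarrow> M \<subset> J' \<Longrightarrow> E J'"
    using maximal_graded_ideal_exists[where P = "\<lambda>J. \<not> E J", OF assms] by (metis (no_types))
  have "\<not> is_prime_ideal M"
    using M(3) unfolding E_def by (metis finite.emptyI finite_insert singletonD singletonI subset_refl)
  moreover have "M \<noteq> UNIV"
    using M(3) unfolding E_def is_prime_ideal_def by (metis empty_iff finite.emptyI top.extremum_uniqueI)
  ultimately obtain a b d e where ab: "a \<in> forms d" "b \<in> forms e" "a * b \<in> M" "a \<notin> M" "b \<notin> M"
    using graded_prime_idealI[OF M(1)] by metis
  have "M \<subset> adj M a" "M \<subset> adj M b" using ab adj_superset adj_mem by blast+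
  hence E: "E (adj M a)" "E (adj M b)"
    by (simp_all add: max[OF graded_ideal_adj[OF M(1) ab(1)]] max[OF graded_ideal_adj[OF M(1) ab(2)]])
  from E(1)[unfolded E_def] obtain S where S: "finite S" "\<forall>p\<in>S. is_prime_ideal p \<and> adj M a \<subseteq> p"
      "\<forall>P. is_prime_ideal P \<and> adj M a \<subseteq> P \<longrightarrow> (\<exists>p\<in>S. p \<subseteq> P)"
    by (elim exE conjE) (rule that)
  from E(2)[unfolded E_def] obtain T where T: "finite T" "\<forall>p\<in>T. is_prime_ideal p \<and> adj M b \<subseteq> p"
      "\<forall>P. is_prime_ideal P \<and> adj M b \<subseteq> P \<longrightarrow> (\<exists>p\<in>T. p \<subseteq> P)"
    by (elim exE conjE) (rule that)
  have "\<forall>p\<in>S \<union> T. is_prime_ideal p \<and> M \<subseteq> p"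
    using S(2) T(2) adj_superset[of M a] adj_superset[of M b] by blast
  moreover have "\<exists>p\<in>S \<union> T. p \<subseteq> P" if P: "is_prime_ideal P" "M \<subseteq> P" for P
  proof -
    have "a \<in> P \<or> b \<in> P" using P ab(3) by (auto simp: is_prime_ideal_def)
    hence "adj M a \<subseteq> P \<or> adj M b \<subseteq> P"
      using adj_minimal[OF P(2) _ is_prime_ideal_is_ideal[OF P(1)]] by blast
    thus ?thesis
    proof
      assume "adj M a \<subseteq> P"
      with P(1) S(3) have "\<exists>p\<in>S. p \<subseteq> P" by simp
      thus ?thesis by auto
    next
      assume "adj M b \<subseteq> P"
      with P(1) T(3) have "\<exists>p\<in>T. p \<subseteq> P" by simp
      thus ?thesis by auto
    qed
  qed
  ultimately have "E M" unfolding E_def using S(1) T(1) by (intro exI[of _ "S \<union> T"]) simp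
  thus False using M(3) by blast
qed

text \<open>It suffices that g avoids the finitely many primes p from
  \<open>finite_minimal_graded_primes\<close> whose growth exceeds t; the bound on J + (V) shows
  that none of them contains V. A prime over J + (g) of too large growth would strictly contain such
  a p, where the growth has already dropped. S collects further subspaces to be avoided.\<close>

lemma generic_form:
  fixes J :: "('n::finite, 'k::field) mpoly set"
  assumes K: "infinite (UNIV :: 'k set)" and J: "graded_ideal J"
    and V: "kspace.subspace V" "V \<subseteq> forms e"
    and growth: "growth_le J (Suc t)" "growth_le (ideal_gen (J \<union> V)) t"
    and S: "finite S" "\<And>p. p \<in> S \<Longrightarrow> kspace.subspace p \<and> \<not> V \<subseteq> p"
  obtains g where "g \<in> V" "\<And>p. p \<in> S \<Longrightarrow> g \<notin> p" "growth_le (adj J g) t"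
proof -
  note IJ = graded_ideal_is_ideal[OF J]
  obtain T where T: "finite T" "\<And>p. p \<in> T \<Longrightarrow> is_prime_ideal p \<and> J \<subseteq> p"
      "\<And>P. is_prime_ideal P \<Longrightarrow> J \<subseteq> P \<Longrightarrow> \<exists>p\<in>T. p \<subseteq> P"
    using finite_minimal_graded_primes[OF J] by metis
  define T' where "T' = {p \<in> T. \<not> growth_le p t}"
  have "kspace.subspace p \<and> \<not> V \<subseteq> p" if p: "p \<in> T'" for p
  proof
    have Ip: "is_ideal p" using p T(2) by (auto simp: T'_def is_prime_ideal_def)
    thus "kspace.subspace p" by (rule is_ideal_subspace)
    show "\<not> V \<subseteq> p"
    proof
      assume "V \<subseteq> p"
      hence "ideal_gen (J \<union> V) \<subseteq> p" using p T(2) by (intro ideal_gen_minimal Ip) (auto simp: T'_def)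
      hence "growth_le p t" using growth_le_antimono[OF growth(2) is_ideal_ideal_gen Ip] by blast
      thus False using p by (simp add: T'_def)
    qed
  qed
  hence "\<exists>v\<in>V. \<forall>p\<in>S \<union> T'. v \<notin> p"
    using S T(1) by (intro avoid_subspaces[OF K V(1)]) (auto simp: T'_def)
  then obtain g where g: "g \<in> V" "\<And>p. p \<in> S \<Longrightarrow> g \<notin> p" "\<And>p. p \<in> T' \<Longrightarrow> g \<notin> p" by blast
  have "growth_le (adj J g) t"
  proof (rule ccontr)
    assume neg: "\<not> growth_le (adj J g) t"
    have "graded_ideal (adj J g)" using g(1) V(2) by (intro graded_ideal_adj[OF J, of g e]) auto
    then obtain M where M: "is_prime_ideal M" "adj J g \<subseteq> M" "\<not> growth_le M t"
      using prime_of_growth[OF _ neg] by metis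
    have JM: "J \<subseteq> M" using M(2) adj_superset by blast
    note IM = is_prime_ideal_is_ideal[OF M(1)]
    obtain p where p: "p \<in> T" "p \<subseteq> M" using T(3)[OF M(1) JM] by blast
    have Pp: "is_prime_ideal p" "J \<subseteq> p" using T(2)[OF p(1)] by auto
    note Ip = is_prime_ideal_is_ideal[OF Pp(1)]
    have "\<not> growth_le p t" using growth_le_antimono[OF _ Ip IM p(2)] M(3) by blast
    hence "g \<notin> p" using g(3) p(1) by (simp add: T'_def)
    moreover have "g \<in> M" using M(2) adj_mem by blast
    ultimately have "p \<subset> M" using p(2) by blast
    from growth_le_prime[OF Pp(1) IM this] growth_le_antimono[OF growth(1) IJ Ip Pp(2)] M(3)
    show False by blast
  qed
  thus ?thesis using that g by blast
qed

text \<open>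
  Exchanging a linear form \<open>y\<close> for a form \<open>g\<close> of degree \<open>e\<close>: the lower bound on the multiplicity
  of the one-dimensional ring \<open>S/a\<close> forces \<open>y\<close>, and then also \<open>g\<close>, to be a nonzerodivisor on it.
\<close>

lemma exchange:
  assumes a: "graded_ideal a" and y: "y \<in> forms 1" and g: "g \<in> forms e" and e: "e > 0"
    and r: "\<And>d. adim (adj a y) d \<le> r"
    and lower: "\<And>\<rho>. \<rho> \<ge> 0 \<Longrightarrow> mult_le a 1 \<rho> \<Longrightarrow> real r \<le> \<rho>"
    and growth: "growth_le (adj a g) 0"
  shows "adim (adj a g) d \<le> e * r"
proof -
  note I = graded_ideal_is_ideal[OF a]
  have rec: "adim a (Suc d) = adim (adj a y) (Suc d) + adim (ideal_colon a y) d" for d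
    using adim_adj[OF a y, of "Suc d"] by simp
  have y_regular: "ideal_colon a y = a"
  proof (rule ccontr)
    assume "ideal_colon a y \<noteq> a"
    then obtain u where u: "u \<in> ideal_colon a y" "u \<notin> a" using ideal_colon_superset[OF I, of y] by blast
    obtain d0 where d0: "u \<in> polys_le d0" using polys_le_exists by blast
    have less: "adim (ideal_colon a y) d < adim a d" if "d \<ge> d0" for d
      using adim_strict_antimono[OF I is_ideal_colon[OF I] ideal_colon_superset[OF I] u] d0 polys_le_mono[OF that]
      by blast
    \<comment> \<open>A zero divisor y loses at least one dimension in every degree from
      \<open>d0\<close> on, so the slope of \<open>adim a\<close> is at most r - 1.\<close>
    have step: "adim a (Suc d) < r + adim a d" if "d \<ge> d0" for d
      using rec[of d] r[of "Suc d"] less[OF that] by simp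
    have "r \<ge> 1" using step[of d0] adim_mono[OF I, of d0 "Suc d0"] by simp
    define C where "C = adim a d0"
    have ge: "adim a (d0 + j) \<le> C + (r - 1) * j" for j
    proof (induction j)
      case (Suc j)
      thus ?case using step[of "d0 + j"] \<open>r \<ge> 1\<close> by simp
    qed (simp add: C_def)
    have "adim a d \<le> C + (r - 1) * d" for d
    proof (cases "d0 \<le> d")
      case True
      have "(r - 1) * (d - d0) \<le> (r - 1) * d" by (intro mult_le_mono) auto
      thus ?thesis using ge[of "d - d0", unfolded le_add_diff_inverse[OF True]] by linarith
    next
      case False
      thus ?thesis using adim_mono[OF I, of d d0] by (simp add: C_def)
    qed
    hence "real (adim a d) \<le> real (C + (r - 1) * d)" for d by (simp only: of_nat_le_iff)
    \<comment> \<open>The slack 1 / 2 keeps the factor positive, so that a shift can absorb C even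
      when r = 1. Any value below r contradicts \<open>lower\<close>.\<close>
    moreover have "real (C + (r - 1) * d) \<le> (real r - 1 / 2) * real ((d + 2 * C) choose 1)" for d
    proof -
      have "real (C + (r - 1) * d) = real C + (real r - 1) * real d" using \<open>r \<ge> 1\<close> by (simp add: of_nat_diff)
      also have "\<dots> \<le> (real r - 1 / 2) * (2 * real C) + (real r - 1 / 2) * real d"
      proof (rule add_mono)
        have "1 * real C \<le> (2 * real r - 1) * real C" using \<open>r \<ge> 1\<close> by (intro mult_right_mono) auto
        thus "real C \<le> (real r - 1 / 2) * (2 * real C)" by (simp add: algebra_simps)
      qed (intro mult_right_mono, auto)
      finally show ?thesis by (simp add: algebra_simps)
    qed
    ultimately have "mult_le a 1 (real r - 1 / 2)" unfolding mult_le_def by (intro exI[of _ "2 * C"]) (meson order_trans)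
    from lower[OF _ this] \<open>r \<ge> 1\<close> show False by simp
  qed
  have y_power: "y ^ i * u \<in> a \<Longrightarrow> u \<in> a" for i u
  proof (induction i)
    case (Suc i)
    hence "y ^ i * u \<in> ideal_colon a y" by (simp add: ideal_colon_def mult_ac)
    thus ?case using Suc.IH y_regular by simp
  qed simp
  obtain C where C: "\<And>d. adim (adj a g) d \<le> C" using growth by (auto simp: growth_le_def)
  have g_regular: "ideal_colon a g = a"
  proof (rule ccontr)
    assume "ideal_colon a g \<noteq> a"
    then obtain u0 where u0: "u0 \<in> ideal_colon a g" "u0 \<notin> a" using ideal_colon_superset[OF I, of g] by blast
    \<comment> \<open>For homogeneous u the products y^i u lie in different degrees and outside a,
      so each of them adds a dimension to (a : g) / a.\<close>
    obtain j where j: "hom_comp j u0 \<notin> a" using hom_comp_exists[OF _ I] u0(2) by blast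
    define u where "u = hom_comp j u0"
    have u: "u \<in> forms j" "u \<notin> a" "u \<in> ideal_colon a g"
      using j graded_ideal_hom_comp[OF graded_ideal_colon[OF a g] u0(1)] by (simp_all add: u_def hom_comp_forms)
    note IC = is_ideal_colon[OF I, of g]
    have deg: "y ^ i * u \<in> forms (j + i)" for i
    proof (induction i)
      case (Suc i)
      thus ?case using forms_mult[OF y Suc] by (simp add: mult.assoc)
    qed (use u in simp)
    have not_in: "y ^ i * u \<notin> adj a (y ^ Suc i * u)" for i
    proof
      assume "y ^ i * u \<in> adj a (y ^ Suc i * u)"
      then obtain s where s: "y ^ i * u - s * (y ^ Suc i * u) \<in> a" using mem_adj_iff[OF I] by blast
      have "hom_comp (j + i) (s * (y ^ Suc i * u)) = 0"
        by (rule hom_comp_mult_form_less[OF deg]) simp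
      moreover have "hom_comp (j + i) (y ^ i * u) = y ^ i * u" using hom_comp_form[OF deg[of i], of "j + i"] by simp
      moreover have "hom_comp (j + i) (y ^ i * u) = hom_comp (j + i) (y ^ i * u - s * (y ^ Suc i * u)) +
          hom_comp (j + i) (s * (y ^ Suc i * u))" by (subst hom_comp_add[symmetric]) simp
      ultimately have "y ^ i * u \<in> a" using graded_ideal_hom_comp[OF a s, of "j + i"] by simp
      thus False using y_power u(2) by blast
    qed
    have sub: "adj a (y ^ Suc i * u) \<subseteq> adj a (y ^ i * u)" for i
      by (intro adj_minimal adj_superset) (auto simp: mult.assoc intro: is_ideal_mult adj_mem)
    have grow: "adim (adj a u) d + i \<le> adim (adj a (y ^ i * u)) d" if "j + i \<le> d" for i d
      using that
    proof (induction i)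
      case (Suc i)
      have "y ^ i * u \<in> polys_le d"
        using deg[of i] forms_polys_le polys_le_mono[of "j + i" d] Suc.prems by fastforce
      hence "adim (adj a (y ^ i * u)) d < adim (adj a (y ^ Suc i * u)) d"
        using adim_strict_antimono[OF _ _ sub adj_mem not_in] by simp
      thus ?case using Suc by simp
    qed simp
    have gap: "adim (ideal_colon a g) (j + i) + i \<le> adim a (j + i)" for i
    proof -
      have "adj a u \<subseteq> ideal_colon a g" by (intro adj_minimal ideal_colon_superset I u IC)
      hence "adim (ideal_colon a g) (j + i) \<le> adim (adj a u) (j + i)" by (intro adim_antimono IC) auto
      moreover have "adim (adj a (y ^ i * u)) (j + i) \<le> adim a (j + i)"
        by (intro adim_antimono I adj_superset) auto
      ultimately show ?thesis using grow[of i "j + i"] by simp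
    qed
    \<comment> \<open>Here the gap of C + 1 between a and a : g exceeds the bound C on
      \<open>adim (adj a g)\<close>, so \<open>adim a\<close> would have to decrease.\<close>
    let ?d = "j + Suc C"
    have "adim a (?d + e) = adim (adj a g) (?d + e) + adim (ideal_colon a g) ?d"
      using adim_adj[OF a g, of "?d + e"] by simp
    moreover have "adim a ?d \<le> adim a (?d + e)" by (intro adim_mono I) simp
    ultimately show False using gap[of "Suc C"] C[of "?d + e"] by simp
  qed
  \<comment> \<open>Since g is regular, \<open>adim (adj a g) d\<close> is the increase of
    \<open>adim a\<close> over e degrees, and each degree contributes at most r because y is regular
    too.\<close>
  have step: "adim a (d + m) \<le> m * r + adim a d" for d m
  proof (induction m)
    case (Suc m)
    thus ?case using rec[of "d + m"] r[of "Suc (d + m)"] y_regular by simp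
  qed simp
  show ?thesis
  proof (cases "d < e")
    case True
    have "adim a 0 \<le> r" using adim_adj_less[OF a y, of 0] r[of 0] by simp
    hence "adim a d \<le> Suc d * r" using step[of 0 d] by simp
    also have "\<dots> \<le> e * r" using True by (intro mult_le_mono1) simp
    finally show ?thesis using adim_adj_less[OF a g True] by simp
  next
    case False
    thus ?thesis using adim_adj[OF a g, of d] step[of "d - e" e] g_regular by simp
  qed
qed

text \<open>V is a linear space of forms and not just a set of generators, because generic elements
  of degree e are drawn from it.\<close>

theorem mult_le_infinite_field:
  fixes V :: "('n::finite, 'k::field) mpoly set"
  assumes K: "infinite (UNIV :: 'k set)" and V: "kspace.subspace V" "V \<subseteq> forms e" and e: "e > 0"
    and f: "f \<in> forms 1" "f \<noteq> 0"
    and growth: "growth_le (ideal_gen (insert f V)) k" and k: "k < num_vars TYPE('n) TYPE('k)"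
  shows "mult_le (ideal_gen (insert f V)) k (real e ^ (num_vars TYPE('n) TYPE('k) - 1 - k))"
proof -
  let ?N = "num_vars TYPE('n) TYPE('k)" and ?Q = "ideal_gen (insert f V)"
  have Q: "graded_ideal ?Q" using V(2) f(1) by (intro graded_ideal_ideal_gen) blast
  have "\<exists>bs. length bs = i \<and> lin_chain {0} (f # bs) \<and> growth_le (adjs ?Q bs) (k - i)" if "i \<le> k" for i
    using that
  proof (induction i)
    case 0
    thus ?case using growth f by (intro exI[of _ "[]"]) simp
  next
    case (Suc i)
    then obtain bs where bs: "length bs = i" "lin_chain {0} (f # bs)" "growth_le (adjs ?Q bs) (k - i)" by auto
    \<comment> \<open>Avoiding this prime keeps f and the forms in \<open>bs\<close> independent, so
      that they can later be completed to generators of the maximal ideal.\<close>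
    let ?p = "adjs {0} (f # bs)"
    have forms_bs: "set (f # bs) \<subseteq> forms 1" by (rule lin_chain_forms[OF bs(2)])
    have lin: "generated_by_linear_forms ?p" by (intro linear_ideal_adjs linear_ideal_zero forms_bs)
    note Ip = is_prime_ideal_is_ideal[OF linear_ideal_prime[OF lin]]
    have "\<not> forms 1 \<subseteq> ?p"
    proof
      assume "forms 1 \<subseteq> ?p"
      hence "max_ideal \<subseteq> ?p" unfolding max_ideal_def using var_forms by (intro ideal_gen_minimal Ip) blast
      hence "?p = max_ideal" using linear_ideal_le_max_ideal[OF lin] by blast
      from lin_chain_length[OF bs(2) this] show False using bs(1) k Suc.prems by simp
    qed
    moreover have "graded_ideal (adjs ?Q bs)" using forms_bs by (intro graded_ideal_adjs[OF Q]) auto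
    moreover have "growth_le (ideal_gen (adjs ?Q bs \<union> forms 1)) (k - Suc i)"
    proof (rule growth_le_antimono)
      have "adim max_ideal d \<le> 1 * (d + 1) ^ (k - Suc i)" for d
        by (simp only: adim_max_ideal) simp
      thus "growth_le max_ideal (k - Suc i)" by (rule growth_leI)
      show "max_ideal \<subseteq> ideal_gen (adjs ?Q bs \<union> forms 1)"
        unfolding max_ideal_def using var_forms by (intro ideal_gen_mono) blast
    qed (simp_all add: max_ideal_def)
    moreover have "growth_le (adjs ?Q bs) (Suc (k - Suc i))" using bs(3) Suc.prems by (simp add: Suc_diff_Suc)
    ultimately obtain b where b: "b \<in> forms 1" "b \<notin> ?p" "growth_le (adj (adjs ?Q bs) b) (k - Suc i)"
      using generic_form[OF K _ subspace_forms order_refl, of "adjs ?Q bs" "k - Suc i" 1 "{?p}"] is_ideal_subspace[OF Ip]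
      by (metis finite.emptyI finite_insert singletonD singletonI)
    have "lin_chain {0} ((f # bs) @ [b])" using bs(2) b(1,2) unfolding lin_chain_append by simp
    thus ?case using bs(1) b(3) by (intro exI[of _ "bs @ [b]"]) simp
  qed
  from this[of k] obtain bs where bs: "length bs = k" "lin_chain {0} (f # bs)" "growth_le (adjs ?Q bs) 0" by auto
  have forms_bs: "set (f # bs) \<subseteq> forms 1" by (rule lin_chain_forms[OF bs(2)])
  define B where "B = adjs {0} (f # bs)"
  have linB: "generated_by_linear_forms B" unfolding B_def by (intro linear_ideal_adjs linear_ideal_zero forms_bs)
  obtain ys where ys: "lin_chain B ys" "adjs B ys = max_ideal"
    using lin_chain_extend[OF linear_ideal_max_ideal linB linear_ideal_le_max_ideal[OF linB]] by blast
  have forms_ys: "set ys \<subseteq> forms 1" by (rule lin_chain_forms[OF ys(1)])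
  have len: "Suc k + length ys = ?N"
    using lin_chain_length[of "(f # bs) @ ys"] ys bs(1,2) unfolding lin_chain_append adjs_append B_def by simp
  have QB: "adjs ?Q bs = ideal_gen (set bs \<union> insert f V)" by (rule adjs_ideal_gen)
  have B: "B = ideal_gen (set (f # bs))" unfolding B_def using adjs_ideal_gen[of "{}" "f # bs"] by simp
  have "\<exists>gs. length gs = i \<and> set gs \<subseteq> V \<and> (\<forall>d. adim (adjs (adjs B gs) (drop i ys)) d \<le> e ^ i)"
    if "i \<le> length ys" for i
    using that
  proof (induction i)
    case 0
    thus ?case using ys(2) by (intro exI[of _ "[]"]) (simp add: adim_max_ideal)
  next
    case (Suc i)
    then obtain gs where gs: "length gs = i" "set gs \<subseteq> V"
      "\<And>d. adim (adjs (adjs B gs) (drop i ys)) d \<le> e ^ i" by auto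
    define y rest where "y = ys ! i" and "rest = drop (Suc i) ys"
    have drop: "drop i ys = y # rest" using Suc.prems by (simp add: y_def rest_def Cons_nth_drop_Suc)
    have y: "y \<in> forms 1" using Suc.prems forms_ys by (auto simp: y_def)
    have rest: "set rest \<subseteq> forms 1" using forms_ys set_drop_subset[of "Suc i" ys] by (auto simp: rest_def)
    have gs_forms: "set gs \<subseteq> forms e" using gs(2) V(2) by blast
    define a where "a = adjs (adjs B gs) rest"
    have gB: "graded_ideal (adjs B gs)" by (intro graded_ideal_adjs[OF linear_ideal_graded[OF linB] gs_forms])
    have a: "graded_ideal a" unfolding a_def by (intro graded_ideal_adjs[OF gB rest])
    have r: "adim (adj a y) d \<le> e ^ i" for d using gs(3)[of d] by (simp add: drop a_def adjs_adj)
    have "growth_le (adj a y) 0" by (rule growth_leI[of _ "e ^ i"]) (simp add: r)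
    hence "growth_le a (Suc 0)" by (rule growth_le_step[OF a y, simplified])
    moreover have "growth_le (ideal_gen (a \<union> V)) 0"
    proof (rule growth_le_antimono[OF bs(3)])
      have "set (f # bs) \<subseteq> B" unfolding B by (rule ideal_gen_superset)
      also have "B \<subseteq> a" unfolding a_def using adjs_superset by blast
      finally show "adjs ?Q bs \<subseteq> ideal_gen (a \<union> V)" unfolding QB by (intro ideal_gen_mono) auto
    qed (auto simp: graded_ideal_is_ideal)
    ultimately obtain g where g: "g \<in> V" "growth_le (adj a g) 0"
      using generic_form[OF K a V, of 0 "{}"] by auto
    \<comment> \<open>The ideal a is generated by N - 1 forms, i of degree e and the others linear.
      Removing them all turns the bound \<rho> into \<rho> / e^i for the zero ideal, where it is at
      least 1.\<close>
    have lower: "real (e ^ i) \<le> \<rho>" if \<rho>: "\<rho> \<ge> 0" "mult_le a 1 \<rho>" for \<rho>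
    proof -
      have "mult_le (adjs B gs) (1 + length rest) (\<rho> / real 1 ^ length rest)"
        using \<rho> unfolding a_def by (intro mult_le_adjs[OF gB rest]) auto
      hence "mult_le B (1 + length rest + length gs) (\<rho> / real e ^ length gs)"
        using \<rho> e by (intro mult_le_adjs[OF linear_ideal_graded[OF linB] gs_forms]) auto
      hence "mult_le {0 :: ('n, 'k) mpoly} (1 + length rest + length gs + length (f # bs)) (\<rho> / real e ^ length gs / real 1 ^ length (f # bs))"
        using \<rho> unfolding B_def by (intro mult_le_adjs[OF graded_ideal_zero forms_bs]) auto
      moreover have "1 + length rest + length gs + length (f # bs) = ?N"
        using len Suc.prems gs(1) bs(1) by (simp add: rest_def)
      ultimately have "1 \<le> \<rho> / real e ^ length gs / real 1 ^ length (f # bs)"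
        by (rule mult_le_zero(2))
      thus ?thesis using e gs(1) by (simp add: field_simps)
    qed
    have "g \<in> forms e" using g(1) V(2) by blast
    from exchange[OF a y this e r lower g(2)] have "adim (adj a g) d \<le> e ^ Suc i" for d by simp
    moreover have "adj a g = adjs (adjs B (gs @ [g])) (drop (Suc i) ys)"
      by (simp add: a_def rest_def adjs_adj)
    ultimately show ?case using gs g(1) by (intro exI[of _ "gs @ [g]"]) simp
  qed
  from this[of "length ys"] obtain gs where gs: "set gs \<subseteq> V" "\<And>d. adim (adjs B gs) d \<le> e ^ length ys" by auto
  \<comment> \<open>The larger ideal inherits the colength bound. Undoing the k cuts by linear forms
    then raises the dimension to k and leaves the bound unchanged.\<close>
  have "adjs B gs \<subseteq> adjs ?Q bs"
    unfolding QB B adjs_ideal_gen using gs(1) by (intro ideal_gen_mono) auto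
  hence "adim (adjs ?Q bs) d \<le> e ^ length ys" for d
    using adim_antimono[of "adjs B gs" "adjs ?Q bs" d] gs(2)[of d] B by (simp add: order_trans)
  hence "real (adim (adjs ?Q bs) d) \<le> real (e ^ length ys)" for d by (simp only: of_nat_le_iff)
  hence "mult_le (adjs ?Q bs) 0 (real e ^ length ys)" by (auto simp: mult_le_def)
  hence "mult_le ?Q (0 + length bs) (real e ^ length ys / real 1 ^ length bs)"
    using forms_bs by (intro mult_le_adjs[OF Q]) auto
  moreover have "length ys = ?N - 1 - k" using len by simp
  ultimately show ?thesis using bs(1) by simp
qed

section \<open>Extension of the base field\<close>

text \<open>Monomials form a basis over any field, so this value and with it \<open>num_vars\<close>
  survive a change of field.\<close>

lemma adim_zero_card:
  "adim ({0} :: ('n::finite, 'k::field) mpoly set) d = card {m :: 'n \<Rightarrow>\<^sub>0 nat. mon_deg m \<le> d}"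
proof -
  define X where "X = (\<lambda>m :: 'n \<Rightarrow>\<^sub>0 nat. single m (1 :: 'k))"
  have inj: "inj_on X A" for A
  proof (rule inj_onI)
    fix m m' assume "X m = X m'"
    hence "lookup (X m) m' = 1" by (simp add: X_def)
    thus "m = m'" by (simp add: X_def lookup_single when_def split: if_splits)
  qed
  have "quot_basis (polys_le d) ({0} \<inter> polys_le d) (X ` {m. mon_deg m \<le> d})"
    unfolding quot_basis_def
  proof (intro conjI allI impI ballI)
    show "X ` {m. mon_deg m \<le> d} \<subseteq> polys_le d" by (auto simp: X_def polys_le_def)
    fix T u b
    assume T: "finite T \<and> T \<subseteq> X ` {m. mon_deg m \<le> d} \<and> (\<Sum>b\<in>T. kscale (u b) b) \<in> {0} \<inter> polys_le d" "b \<in> T"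
    then obtain S where S: "T = X ` S" by (auto simp: subset_image_iff)
    then obtain m where m: "b = X m" "m \<in> S" using T(2) by blast
    have "finite S" using T(1) S inj finite_imageD by blast
    have "0 = lookup (\<Sum>b\<in>X ` S. kscale (u b) b) m" using T(1) S by simp
    also have "\<dots> = (\<Sum>m'\<in>S. u (X m') * lookup (X m') m)"
      by (simp add: sum.reindex[OF inj] lookup_sum)
    also have "\<dots> = (\<Sum>m'\<in>S. if m' = m then u (X m) else 0)"
      by (intro sum.cong) (auto simp: X_def lookup_single when_def)
    also have "\<dots> = u b" using m \<open>finite S\<close> by simp
    finally show "u b = 0" by simp
  next
    fix v :: "('n, 'k) mpoly" assume "v \<in> polys_le d"
    thus "\<exists>x\<in>kspace.span (X ` {m. mon_deg m \<le> d}). v - x \<in> {0} \<inter> polys_le d"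
      using polys_le_span[of d] kspace.subspace_0[OF subspace_polys_le, of d]
      by (intro bexI[of _ v]) (auto simp: X_def)
  qed
  from quot_dim_eq[OF subspace_cut[OF is_ideal_zero] this finite_imageI[OF finite_mon_deg_le]]
  show ?thesis using card_image[OF inj] by (simp add: adim_def)
qed

lemma num_vars_eq: "num_vars TYPE('n::finite) TYPE('l::field) = num_vars TYPE('n) TYPE('k::field)"
  by (rule num_vars_eqI) (use adim_zero[where 'n = 'n and 'k = 'k] in \<open>simp add: adim_zero_card\<close>)

section \<open>Base change along a field homomorphism\<close>

definition field_hom :: "('k::field \<Rightarrow> 'l::field) \<Rightarrow> bool" where
  "field_hom \<phi> \<longleftrightarrow> \<phi> 1 = 1 \<and> (\<forall>a b. \<phi> (a + b) = \<phi> a + \<phi> b) \<and> (\<forall>a b. \<phi> (a * b) = \<phi> a * \<phi> b)"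

context
  fixes \<phi> :: "'k::field \<Rightarrow> 'l::field"
  assumes \<phi>: "field_hom \<phi>"
begin

lemma hom_one: "\<phi> 1 = 1" and hom_add: "\<phi> (a + b) = \<phi> a + \<phi> b" and hom_mult: "\<phi> (a * b) = \<phi> a * \<phi> b"
  using \<phi> by (auto simp: field_hom_def)

lemma hom_zero: "\<phi> 0 = 0"
proof -
  have "\<phi> 0 + \<phi> 0 = \<phi> 0 + 0" using hom_add[of 0 0] by simp
  thus ?thesis by (simp only: add_left_cancel)
qed

lemma hom_eq_0_iff: "\<phi> a = 0 \<longleftrightarrow> a = 0"
proof
  assume "\<phi> a = 0"
  hence "\<phi> (a * inverse a) = 0" by (simp only: hom_mult mult_zero_left)
  thus "a = 0" by (cases "a = 0") (auto simp: hom_one)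
qed (simp add: hom_zero)

definition ext :: "('n, 'k) mpoly \<Rightarrow> ('n, 'l) mpoly" where
  "ext p = Poly_Mapping.map \<phi> p"

lemma lookup_ext: "lookup (ext p) m = \<phi> (lookup p m)"
  by (simp add: ext_def map.rep_eq when_def hom_zero)

lemma keys_ext: "keys (ext p) = keys p"
  by (auto simp: in_keys_iff lookup_ext hom_eq_0_iff)

lemma ext_zero: "ext 0 = 0"
  by (intro poly_mapping_eqI) (simp add: lookup_ext hom_zero)

lemma ext_add: "ext (p + q) = ext p + ext q"
  by (intro poly_mapping_eqI) (simp add: lookup_ext lookup_add hom_add)

lemma ext_sum: "ext (sum f A) = (\<Sum>x\<in>A. ext (f x))"
  by (induction A rule: infinite_finite_induct) (simp_all add: ext_zero ext_add)

lemma ext_single: "ext (single m c) = single m (\<phi> c)"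
  by (intro poly_mapping_eqI) (simp add: lookup_ext lookup_single when_def hom_zero)

lemma ext_kscale: "ext (kscale c p) = kscale (\<phi> c) (ext p)"
  by (intro poly_mapping_eqI) (simp add: lookup_ext hom_mult)

lemma ext_mult: "ext (p * q) = ext p * ext q"
proof -
  let ?P = "\<lambda>p m. single m (lookup p m)"
  have "p * q = (\<Sum>m\<in>keys p. \<Sum>k\<in>keys q. ?P p m * ?P q k)"
    using arg_cong2[OF mpoly_sum_single[of p] mpoly_sum_single[of q], of "(*)"] by (simp only: sum_product)
  hence "ext (p * q) = (\<Sum>m\<in>keys p. \<Sum>k\<in>keys q. ?P (ext p) m * ?P (ext q) k)"
    by (simp add: ext_sum mult_single ext_single hom_mult lookup_ext)
  also have "\<dots> = ext p * ext q"
    using arg_cong2[OF mpoly_sum_single[of "ext p"] mpoly_sum_single[of "ext q"], of "(*)"]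
    by (simp only: sum_product keys_ext)
  finally show ?thesis .
qed

lemma ext_forms: "p \<in> forms d \<Longrightarrow> ext p \<in> forms d"
  by (simp add: forms_def keys_ext)

lemma ext_polys_le: "p \<in> polys_le d \<Longrightarrow> ext p \<in> polys_le d"
  by (simp add: polys_le_def keys_ext)

lemma trunc_ext: "trunc d (ext p) = ext (trunc d p)"
  by (intro poly_mapping_eqI) (simp add: trunc_def lookup_restr lookup_ext hom_zero)

lemma ext_span: "x \<in> kspace.span B \<Longrightarrow> ext x \<in> kspace.span (ext ` B)"
proof (induction x rule: kspace.span_induct_alt)
  case (step c b y)
  have "ext b \<in> kspace.span (ext ` B)" using step(1) by (intro kspace.span_base) auto
  thus ?case using step(2) by (simp add: ext_add ext_kscale kspace.span_add kspace.span_scale)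
qed (simp add: ext_zero kspace.span_zero)

text \<open>The span is already an ideal, since monomials have coefficient 1 and therefore come from
  the smaller ring.\<close>

lemma ext_ideal_gen:
  fixes A :: "('n::finite, 'k) mpoly set"
  shows "ideal_gen (ext ` A) = kspace.span (ext ` ideal_gen A)"
proof
  let ?S = "kspace.span (ext ` ideal_gen A)"
  have mon: "single m 1 * x \<in> ?S" if "x \<in> ?S" for m x
    using that
  proof (induction x rule: kspace.span_induct_alt)
    case (step c x y)
    then obtain p where p: "x = ext p" "p \<in> ideal_gen A" by blast
    have "single m 1 * x = ext (single m 1 * p)"
      by (simp add: p ext_mult ext_single hom_one)
    also have "\<dots> \<in> ?S" using p(2) by (intro kspace.span_base imageI is_ideal_mult) auto
    finally have "kscale c (single m 1 * x) \<in> ?S" by (rule kspace.span_scale)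
    thus ?case using step by (simp add: distrib_left kscale_mult kspace.span_add)
  qed (simp add: kspace.span_zero)
  have "is_ideal ?S"
  proof (rule is_idealI)
    fix s x assume x: "x \<in> ?S"
    have "s * x = (\<Sum>m\<in>keys s. kscale (lookup s m) (single m 1)) * x"
      using mpoly_sum_monomials[of s] by simp
    also have "\<dots> = (\<Sum>m\<in>keys s. kscale (lookup s m) (single m 1 * x))"
      by (simp add: sum_distrib_right kscale_mult_left)
    also have "\<dots> \<in> ?S" using mon[OF x] by (intro kspace.span_sum kspace.span_scale)
    finally show "s * x \<in> ?S" .
  qed (auto intro: kspace.span_zero kspace.span_add)
  thus "ideal_gen (ext ` A) \<subseteq> ?S"
    using ideal_gen_superset[of A] kspace.span_superset by (intro ideal_gen_minimal) blast+
  have "ext x \<in> ideal_gen (ext ` A)" if "x \<in> ideal_gen A" for x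
  proof -
    have "is_ideal {x. ext x \<in> ideal_gen (ext ` A)}"
      by (rule is_idealI) (simp_all add: ext_zero ext_add ext_mult is_ideal_0 is_ideal_add is_ideal_mult)
    hence "ideal_gen A \<subseteq> {x. ext x \<in> ideal_gen (ext ` A)}"
      using ideal_gen_superset[of "ext ` A"] by (intro ideal_gen_minimal) blast+
    thus ?thesis using that by blast
  qed
  thus "?S \<subseteq> ideal_gen (ext ` A)"
    by (intro kspace.span_minimal is_ideal_subspace) auto
qed

text \<open>Bases of the truncated ideal and of its quotient map to spanning sets over the larger
  field, so neither dimension can grow. Their sum is the number of monomials over both fields, so
  both are preserved.\<close>

lemma adim_ext:
  fixes A :: "('n::finite, 'k) mpoly set"
  assumes J: "graded_ideal (ideal_gen A)"
  shows "adim (ideal_gen (ext ` A)) d = adim (ideal_gen A) d"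
proof -
  let ?J = "ideal_gen A" and ?J' = "ideal_gen (ext ` A)"
  let ?W = "?J \<inter> polys_le d" and ?W' = "?J' \<inter> polys_le d"
  have sub: "ext x \<in> ?J'" if "x \<in> ?J" for x
    unfolding ext_ideal_gen using that by (intro kspace.span_base) auto
  have sW: "kspace.subspace ?W" and sW': "kspace.subspace ?W'" by (simp_all add: subspace_cut)
  have fin: "fin_quot (polys_le d) ?W" "fin_quot (polys_le d) ?W'" "fin_quot ?W {0}" "fin_quot ?W' {0}"
    using is_ideal_0[OF is_ideal_ideal_gen] kspace.subspace_0[OF subspace_polys_le]
    by (auto intro!: fin_quot_polys_le[where d = d] subspace_polys_le sW sW')
  have zero: "{0} \<inter> polys_le d = ({0} :: ('n, 'k) mpoly set)" "{0} \<inter> polys_le d = ({0} :: ('n, 'l) mpoly set)"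
    using kspace.subspace_0[OF subspace_polys_le] by blast+
  have total: "adim ({0} :: ('n, 'k) mpoly set) d = adim ?J d + quot_dim ?W {0}"
    unfolding adim_def zero by (rule quot_dim_trans[OF sW _ _ _ fin(1,3)]) (auto simp: is_ideal_0 polys_le_def)
  have total': "adim ({0} :: ('n, 'l) mpoly set) d = adim ?J' d + quot_dim ?W' {0}"
    unfolding adim_def zero by (rule quot_dim_trans[OF sW' _ _ _ fin(2,4)]) (auto simp: is_ideal_0 polys_le_def)
  obtain B where B: "finite B" "quot_basis (polys_le d) ?W B" using fin(1) by (auto simp: fin_quot_def)
  obtain D where D: "finite D" "quot_basis ?W {0} D" using fin(3) by (auto simp: fin_quot_def)
  have "\<exists>x\<in>kspace.span (ext ` D). v - x \<in> {0}" if v: "v \<in> ?W'" for v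
  proof -
    have "trunc d x \<in> kspace.span (ext ` D)" if "x \<in> kspace.span (ext ` ?J)" for x
      using that
    proof (induction x rule: kspace.span_induct_alt)
      case (step c x y)
      then obtain p where p: "x = ext p" "p \<in> ?J" by blast
      have "trunc d p \<in> ?W" using graded_ideal_trunc[OF J p(2)] trunc_polys_le by blast
      hence "trunc d p \<in> kspace.span D" using quot_basis_spanning[OF D(2)] by fastforce
      hence "trunc d x \<in> kspace.span (ext ` D)" using ext_span p(1) by (simp add: trunc_ext)
      moreover have "trunc d (kscale c x + y) = kscale c (trunc d x) + trunc d y"
        by (simp add: trunc_def restr_add restr_kscale)
      ultimately show ?case using step(2) by (simp add: kspace.span_add kspace.span_scale)
    qed (simp add: trunc_def kspace.span_zero)
    hence "trunc d v \<in> kspace.span (ext ` D)" using v unfolding ext_ideal_gen by blast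
    thus ?thesis using v trunc_id[of v d] by (intro bexI[of _ v]) auto
  qed
  hence "quot_dim ?W' {0} \<le> card (ext ` D)" by (rule quot_dim_le_spanning[OF kspace.subspace_single_0]) (use D fin in auto)
  also have "\<dots> \<le> card D" by (rule card_image_le[OF D(1)])
  also have "card D = quot_dim ?W {0}" using quot_dim_eq[OF _ D(2,1)] by simp
  finally have le1: "quot_dim ?W' {0} \<le> quot_dim ?W {0}" .
  have "\<exists>x\<in>kspace.span (ext ` B). v - x \<in> ?W'" if v: "v \<in> polys_le d" for v
  proof -
    let ?U = "{w + x | w x. w \<in> ?W' \<and> x \<in> kspace.span (ext ` B)}"
    have sU: "kspace.subspace ?U" by (intro kspace.subspace_sums sW') simp
    have "single m 1 \<in> ?U" if "m \<in> keys v" for m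
    proof -
      have m: "single m (1 :: 'k) \<in> polys_le d" using that v by (simp add: polys_le_def)
      obtain x where x: "x \<in> kspace.span B" "single m 1 - x \<in> ?W"
        using quot_basis_spanning[OF B(2) m] by blast
      have "single m 1 = ext ((single m 1 - x) + x)"
        by (simp add: ext_single hom_one)
      also have "\<dots> = ext (single m 1 - x) + ext x" by (rule ext_add)
      finally have "single m 1 = ext (single m 1 - x) + ext x" .
      moreover have "ext (single m 1 - x) \<in> ?W'" using x(2) sub ext_polys_le by blast
      ultimately show ?thesis using ext_span[OF x(1)] by blast
    qed
    hence "(\<Sum>m\<in>keys v. kscale (lookup v m) (single m 1)) \<in> ?U"
      by (intro kspace.subspace_sum[OF sU] kspace.subspace_scale[OF sU])
    hence "v \<in> ?U" using mpoly_sum_monomials[of v] by simp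
    then obtain w x where "v = w + x" "w \<in> ?W'" "x \<in> kspace.span (ext ` B)" by blast
    thus ?thesis by (intro bexI[of _ x]) simp_all
  qed
  hence "adim ?J' d \<le> card (ext ` B)"
    unfolding adim_def by (rule quot_dim_le_spanning[OF sW']) (use B fin in auto)
  also have "\<dots> \<le> card B" by (rule card_image_le[OF B(1)])
  also have "card B = adim ?J d" using quot_dim_eq[OF sW B(2,1)] by (simp add: adim_def)
  finally have le2: "adim ?J' d \<le> adim ?J d" .
  have "adim ({0} :: ('n, 'k) mpoly set) d = adim ({0} :: ('n, 'l) mpoly set) d"
    by (simp add: adim_zero_card)
  thus ?thesis using total total' le1 le2 by linarith
qed

lemma mult_le_via_extension:
  fixes G :: "('n::finite, 'k) mpoly set"
  assumes K: "infinite (UNIV :: 'l set)" and G: "G \<subseteq> forms e" and e: "e > 0"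
    and f: "f \<in> forms 1" "f \<noteq> 0"
    and growth: "growth_le (ideal_gen (insert f G)) k" and k: "k < num_vars TYPE('n) TYPE('k)"
  shows "mult_le (ideal_gen (insert f G)) k (real e ^ (num_vars TYPE('n) TYPE('k) - 1 - k))"
proof -
  \<comment> \<open>The span over the larger field has room for generic choices and generates the
    same ideal as the image of G.\<close>
  define V where "V = kspace.span (ext ` G)"
  have "ext ` G \<subseteq> forms e" using G ext_forms by blast
  hence V: "kspace.subspace V" "V \<subseteq> forms e"
    unfolding V_def by (simp_all add: kspace.span_minimal[OF _ subspace_forms])
  have "ideal_gen (insert (ext f) V) = ideal_gen (ext ` insert f G)"
  proof
    have "V \<subseteq> ideal_gen (ext ` insert f G)"
      unfolding V_def using ideal_gen_superset[of "ext ` insert f G"]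
      by (intro kspace.span_minimal is_ideal_subspace) auto
    thus "ideal_gen (insert (ext f) V) \<subseteq> ideal_gen (ext ` insert f G)"
      using ideal_gen_superset[of "ext ` insert f G"] by (intro ideal_gen_minimal) auto
    show "ideal_gen (ext ` insert f G) \<subseteq> ideal_gen (insert (ext f) V)"
      unfolding V_def using kspace.span_superset[of "ext ` G"] by (intro ideal_gen_mono) auto
  qed
  moreover have "graded_ideal (ideal_gen (insert f G))" using G f(1) by (intro graded_ideal_ideal_gen) blast
  ultimately have adim: "adim (ideal_gen (insert (ext f) V)) = adim (ideal_gen (insert f G))"
    using adim_ext[of "insert f G"] by (intro ext) (simp only:)
  have "ext f \<noteq> 0" using f(2) keys_ext[of f] by (metis keys_eq_empty)
  hence "mult_le (ideal_gen (insert (ext f) V)) k (real e ^ (num_vars TYPE('n) TYPE('l) - 1 - k))"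
    using growth k ext_forms[OF f(1)]
    by (intro mult_le_infinite_field[OF K V e]) (simp_all add: growth_le_def adim num_vars_eq[where 'l = 'l and 'k = 'k])
  thus ?thesis by (simp add: mult_le_def adim num_vars_eq[where 'l = 'l and 'k = 'k])
qed

end

section \<open>Passage to the rational function field\<close>

lemma field_hom_const: "field_hom (\<lambda>c :: 'k::field. Fract [:c:] 1)"
  by (simp add: field_hom_def One_fract_def one_pCons mult.commute)

lemma infinite_rational_functions: "infinite (UNIV :: 'k::field poly fract set)"
proof
  assume "finite (UNIV :: 'k poly fract set)"
  hence fin: "finite (range (\<lambda>n. Fract (monom (1 :: 'k) n) 1))" by (rule finite_subset[OF subset_UNIV])
  have "inj (\<lambda>n. Fract (monom (1 :: 'k) n) 1)"
  proof (rule injI)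
    fix m n assume "Fract (monom (1 :: 'k) m) 1 = Fract (monom 1 n) 1"
    hence "monom (1 :: 'k) m = monom 1 n" by (simp add: eq_fract)
    hence "degree (monom (1 :: 'k) m) = degree (monom (1 :: 'k) n)" by simp
    thus "m = n" by (simp add: degree_monom_eq)
  qed
  from finite_imageD[OF fin this] show False by simp
qed

theorem mult_le_linear_section:
  fixes G :: "('n::finite, 'k::field) mpoly set"
  assumes "G \<subseteq> forms e" "e > 0" "f \<in> forms 1" "f \<noteq> 0"
    "growth_le (ideal_gen (insert f G)) k" "k < num_vars TYPE('n) TYPE('k)"
  shows "mult_le (ideal_gen (insert f G)) k (real e ^ (num_vars TYPE('n) TYPE('k) - 1 - k))"
  by (rule mult_le_via_extension[OF field_hom_const infinite_rational_functions assms])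

section \<open>Ideals generated in one degree\<close>

text \<open>Finiteness guarantees an irredundant generating subset, the only kind of which
  \<open>min_generated_in_degree\<close> asserts anything.\<close>

lemma finite_homogeneous_generators:
  fixes I :: "('n::finite, 'k::field) mpoly set"
  assumes I: "graded_ideal I"
  obtains F where "finite F" "F \<subseteq> (\<Union>d. forms d)" "ideal_gen F = I"
proof -
  define P where "P = (\<lambda>J. \<exists>F. finite F \<and> F \<subseteq> I \<and> F \<subseteq> (\<Union>d. forms d) \<and> J = ideal_gen F)"
  have "P {0}" unfolding P_def by (intro exI[of _ "{}"]) simp
  then obtain J where J: "is_ideal J" "{0} \<subseteq> J" "P J" "\<And>J'. is_ideal J' \<Longrightarrow> J \<subset> J' \<Longrightarrow> \<not> P J'"
    using maximal_ideal_exists[where P = P, OF is_ideal_zero] by (metis (no_types))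
  from J(3)[unfolded P_def] obtain F where F: "finite F" "F \<subseteq> I" "F \<subseteq> (\<Union>d. forms d)" "J = ideal_gen F"
    by (elim exE conjE) (rule that)
  have form: "p \<in> J" if "p \<in> I" "p \<in> forms d" for p d
  proof (rule ccontr)
    assume "p \<notin> J"
    have "J \<subset> ideal_gen (insert p F)"
      using \<open>p \<notin> J\<close> F(4) ideal_gen_mono[of F "insert p F"] ideal_gen_superset[of "insert p F"] by blast
    moreover have "P (ideal_gen (insert p F))"
      unfolding P_def using F that by (intro exI[of _ "insert p F"]) auto
    ultimately show False using J(4)[OF is_ideal_ideal_gen] by blast
  qed
  have "I \<subseteq> J"
    using form[OF graded_ideal_hom_comp[OF I] hom_comp_forms] hom_comp_exists[OF _ J(1)] by blast
  moreover have "J \<subseteq> I" unfolding F(4) by (intro ideal_gen_minimal F(2) graded_ideal_is_ideal I)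
  ultimately show ?thesis using that[OF F(1,3)] F(4) by blast
qed

lemma generated_in_degree:
  fixes I :: "('n::finite, 'k::field) mpoly set"
  assumes I: "graded_ideal I" and e: "min_generated_in_degree e I"
  obtains G where "G \<subseteq> forms e" "ideal_gen G = I"
proof -
  obtain F where F: "finite F" "F \<subseteq> (\<Union>d. forms d)" "ideal_gen F = I"
    using finite_homogeneous_generators[OF I] by metis
  have "finite {G \<in> Pow F. ideal_gen G = I}" "{G \<in> Pow F. ideal_gen G = I} \<noteq> {}" using F by auto
  from finite_has_minimal[OF this] obtain G where min: "G \<in> {G \<in> Pow F. ideal_gen G = I}"
    "\<forall>G'\<in>{G \<in> Pow F. ideal_gen G = I}. G' \<subseteq> G \<longrightarrow> G = G'" by blast
  hence G: "G \<subseteq> F" "ideal_gen G = I" by auto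
  have "ideal_gen G' \<noteq> I" if "G' \<subset> G" for G' using that G(1) min(2) by blast
  hence "min_hom_generators I G" using G F(2) unfolding min_hom_generators_def by blast
  hence "G \<subseteq> forms e" using e by (simp add: min_generated_in_degree_def)
  thus ?thesis using that G(2) by blast
qed

lemma hom_comp_mult_low:
  fixes a p :: "('n::finite, 'k::field) mpoly"
  assumes "\<And>j. j < e \<Longrightarrow> hom_comp j p = 0"
  shows "hom_comp e (a * p) = hom_comp 0 a * hom_comp e p"
proof -
  obtain D where D: "p \<in> polys_le D" using polys_le_exists by blast
  hence p: "p = (\<Sum>j\<le>D + e. hom_comp j p)"
    using trunc_id[of p "D + e"] polys_le_mono[of D "D + e"] by (auto simp: trunc_sum)
  have "hom_comp e (a * p) = (\<Sum>j\<le>D + e. hom_comp e (a * hom_comp j p))"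
    using arg_cong[OF p, of "\<lambda>p. hom_comp e (a * p)"] by (simp add: sum_distrib_left hom_comp_sum)
  also have "\<dots> = (\<Sum>j\<in>{e}. hom_comp e (a * hom_comp j p))"
  proof (intro sum.mono_neutral_right ballI)
    fix j assume "j \<in> {..D + e} - {e}"
    thus "hom_comp e (a * hom_comp j p) = 0"
      using assms hom_comp_mult_form_less[OF hom_comp_forms[of j p], of e a] by (cases "j < e") auto
  qed auto
  also have "\<dots> = hom_comp 0 a * hom_comp e p" using hom_comp_mult_form[OF hom_comp_forms[of e p], of 0 a] by simp
  finally show ?thesis .
qed

text \<open>Elements of I have no components below degree e, so the component of degree e of a
  combination of A involves only the constant terms of the coefficients. This replaces the possibly
  inhomogeneous generators allowed by \<open>complete_intersection\<close> with equally many
  forms.\<close>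

lemma initial_forms_generate:
  fixes I :: "('n::finite, 'k::field) mpoly set"
  assumes G: "G \<subseteq> forms e" "ideal_gen G = I" and A: "ideal_gen A = I"
  shows "ideal_gen (hom_comp e ` A) = I"
proof
  have I: "graded_ideal I" using G graded_ideal_ideal_gen[of G] by blast
  have AI: "A \<subseteq> I" using A ideal_gen_superset by blast
  thus "ideal_gen (hom_comp e ` A) \<subseteq> I"
    using graded_ideal_hom_comp[OF I] graded_ideal_is_ideal[OF I] by (intro ideal_gen_minimal) auto
  have low: "hom_comp j p = 0" if "p \<in> I" "j < e" for p j
    using that(1) unfolding G(2)[symmetric] ideal_gen_def
  proof (induction p rule: ring_module.span_induct_alt)
    case (step c x y)
    hence "hom_comp j (c * x) = 0" using G(1) that(2) by (intro hom_comp_mult_form_less) auto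
    thus ?case using step by (simp add: hom_comp_add)
  qed simp
  have "hom_comp e p \<in> ideal_gen (hom_comp e ` A)" if "p \<in> I" for p
    using that unfolding A[symmetric] ideal_gen_def[of A]
  proof (induction p rule: ring_module.span_induct_alt)
    case base
    show ?case by (simp add: is_ideal_0)
  next
    case (step c x y)
    have "hom_comp e (c * x) = hom_comp 0 c * hom_comp e x"
      using step(1) AI low by (intro hom_comp_mult_low) auto
    moreover have "hom_comp e x \<in> ideal_gen (hom_comp e ` A)"
      using step(1) ideal_gen_superset[of "hom_comp e ` A"] by blast
    ultimately show ?case using step(2) by (simp add: hom_comp_add is_ideal_add is_ideal_mult)
  qed
  moreover have "hom_comp e p = p" if "p \<in> G" for p using that G(1) hom_comp_form[of p e e] by auto
  moreover have "G \<subseteq> I" using G(2) ideal_gen_superset by blast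
  ultimately have "G \<subseteq> ideal_gen (hom_comp e ` A)" by (metis subsetD subsetI)
  thus "I \<subseteq> ideal_gen (hom_comp e ` A)" unfolding G(2)[symmetric] by (intro ideal_gen_minimal) auto
qed


section \<open>The degree bounds\<close>

text \<open>The zero ideal is prime and lies strictly below every prime over I. Positivity makes c -
  1 a genuine subtraction.\<close>

lemma height_pos:
  fixes I :: "('n::finite, 'k::field) mpoly set"
  assumes "is_ideal I" "I \<noteq> {0}" "ideal_height I = enat c"
  shows "c > 0"
proof -
  obtain P where P: "is_prime_ideal P" "I \<subseteq> P" "prime_height P = enat c"
    using ideal_height_attained[OF assms(3)] by blast
  have "{0} \<subset> P" using assms(1,2) P(2) is_ideal_0 by blast
  hence "prime_chain 1 (\<lambda>i. if i = 0 then {0} else P)"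
    using P(1) is_prime_ideal_zero by (auto simp: prime_chain_def)
  from prime_height_ge[OF this refl] have "enat 1 \<le> enat c" by (simp add: P(3))
  thus ?thesis by simp
qed

context
  fixes I G :: "('n::finite, 'k::field) mpoly set" and c e :: nat
  assumes nonzero: "I \<noteq> {0}" and graded: "graded_ideal I" and unmixed: "unmixed I"
    and height: "ideal_height I = enat c" and e: "e > 0"
    and G: "G \<subseteq> forms e" "ideal_gen G = I"
    and linear: "\<forall>P\<in>ass_primes I. generated_by_linear_forms P"
begin

lemma dimension_eq:
  fixes Q :: "('n, 'k) mpoly set"
  assumes "is_ideal Q" "I \<subseteq> Q" "Q \<subseteq> P" "P \<in> ass_primes I"
  shows "quot_krull_dim Q = enat (num_vars TYPE('n) TYPE('k) - c)"
    "growth_le Q (num_vars TYPE('n) TYPE('k) - c)"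
  using krull_dim_below_linear_prime[OF graded height assms(1-3)] linear assms(4)
    unmixed_height_le[OF unmixed height assms(4)] by blast+

text \<open>A zero divisor f lies in an associated prime, which places (I, f) between I and a linear
  prime; its dimension is therefore still N - c, the k of
  \<open>mult_le_linear_section\<close>.\<close>

lemma linear_section_degree:
  assumes f: "f \<in> zero_div_forms I 1"
  obtains n :: nat where "quot_degree (ideal_gen (insert f I)) = real n" "n \<le> e ^ (c - 1)"
proof -
  let ?N = "num_vars TYPE('n) TYPE('k)" and ?Q = "ideal_gen (insert f I)"
  note ideal = graded_ideal_is_ideal[OF graded]
  have f1: "f \<in> forms 1" "f \<notin> I" "ideal_colon I f \<noteq> I" using f by (auto simp: zero_div_forms_def)
  then obtain g where g: "g \<notin> I" "g * f \<in> I" using ideal_colon_superset[OF ideal, of f] by (auto simp: ideal_colon_def)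
  obtain P where P: "P \<in> ass_primes I" "ideal_colon I g \<subseteq> P" using ass_prime_above_colon[OF ideal g(1)] by blast
  have idP: "is_ideal P" using P(1) by (simp add: ass_primes_def is_prime_ideal_def)
  have "f \<in> P" using P(2) g(2) by (auto simp: ideal_colon_def mult.commute)
  moreover have "I \<subseteq> P" using P(2) ideal_colon_superset[OF ideal] by blast
  ultimately have QP: "?Q \<subseteq> P" using idP by (intro ideal_gen_minimal) auto
  have IQ: "I \<subseteq> ?Q" using ideal_gen_superset[of "insert f I"] by blast
  note dim = dimension_eq[OF is_ideal_ideal_gen IQ QP P(1)]
  have Q: "?Q = ideal_gen (insert f G)" using adj_ideal_gen[of G f] G(2) by (simp add: adj_def)
  have gQ: "graded_ideal ?Q" using graded_ideal_adj[OF graded f1(1)] by (simp add: adj_def)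
  have "c > 0" by (rule height_pos[OF ideal nonzero height])
  moreover have "c \<le> ?N" by (rule growth_le_height(2)[OF graded height])
  ultimately have k: "?N - c < ?N" "?N - 1 - (?N - c) = c - 1" by auto
  have "f \<noteq> 0" using f1(2) is_ideal_0[OF ideal] by auto
  from mult_le_linear_section[OF G(1) e f1(1) this _ k(1)] dim(2)
  have "mult_le ?Q (?N - c) (real e ^ (c - 1))" unfolding Q k(2) by blast
  from quot_degree_le[OF gQ dim(1) this] have "quot_degree ?Q \<le> real (e ^ (c - 1))" by simp
  moreover obtain n where "quot_degree ?Q = real n" using adim_degree[OF gQ dim(2,1)] by blast
  ultimately show ?thesis using that by simp
qed

lemma hyp_le: "hyp I 1 \<le> real e ^ (c - 1)"
proof (cases "zero_div_forms I 1 = {}")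
  case False
  let ?D = "(\<lambda>f. quot_degree (ideal_gen (insert f I))) ` zero_div_forms I 1"
  \<comment> \<open>\<open>Max\<close> is meaningful on finite sets only, hence the detour through
    natural numbers below a common bound.\<close>
  have sub: "?D \<subseteq> real ` {..e ^ (c - 1)}"
  proof
    fix x assume "x \<in> ?D"
    then obtain f where f: "f \<in> zero_div_forms I 1" "x = quot_degree (ideal_gen (insert f I))" by blast
    obtain n where "quot_degree (ideal_gen (insert f I)) = real n" "n \<le> e ^ (c - 1)"
      using linear_section_degree[OF f(1)] by blast
    thus "x \<in> real ` {..e ^ (c - 1)}" using f(2) by auto
  qed
  hence fin: "finite ?D" by (rule finite_subset) simp
  have "Max ?D \<in> ?D" using fin False by (intro Max_in) auto
  then obtain n where "n \<le> e ^ (c - 1)" "Max ?D = real n" using sub by auto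
  hence "Max ?D \<le> real (e ^ (c - 1))" by simp
  thus ?thesis using False by (simp add: hyp_def)
qed (simp add: hyp_def)

text \<open>Removing the c generating forms of degree e divides a multiplicity bound by e^c. What is
  left bounds the multiplicity of S itself and so is at least 1.\<close>

lemma complete_intersection_degree:
  assumes "complete_intersection I"
  shows "real e ^ c \<le> quot_degree I"
proof (rule ccontr)
  let ?N = "num_vars TYPE('n) TYPE('k)"
  note ideal = graded_ideal_is_ideal[OF graded]
  assume neg: "\<not> real e ^ c \<le> quot_degree I"
  obtain g :: "nat \<Rightarrow> ('n, 'k) mpoly" where g: "ideal_gen (g ` {..<c}) = I"
    using assms height by (auto simp: complete_intersection_def)
  define hs where "hs = map (\<lambda>i. hom_comp e (g i)) [0..<c]"
  have set_hs: "set hs = hom_comp e ` g ` {..<c}" by (auto simp: hs_def)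
  have hs: "set hs \<subseteq> forms e" "length hs = c" by (auto simp: hs_def hom_comp_forms)
  have I: "adjs {0} hs = I"
    using adjs_ideal_gen[of "{}" hs] initial_forms_generate[OF G g] by (simp add: set_hs)
  have "1 \<notin> I" using unmixed is_ideal_UNIV_iff[OF ideal] by (simp add: unmixed_def)
  then obtain P where P: "P \<in> ass_primes I" "ideal_colon I 1 \<subseteq> P" using ass_prime_above_colon[OF ideal] by blast
  hence "I \<subseteq> P" by (simp add: ideal_colon_def)
  note dim = dimension_eq[OF ideal order_refl this P(1)]
  \<comment> \<open>\<open>mult_le_quot_degree\<close> needs a value strictly above the degree; the
    midpoint also stays strictly below e^c.\<close>
  define \<rho> where "\<rho> = (quot_degree I + real e ^ c) / 2"
  have \<rho>: "quot_degree I < \<rho>" "\<rho> < real e ^ c" using neg by (simp_all add: \<rho>_def)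
  obtain n where "quot_degree I = real n" using adim_degree[OF graded dim(2,1)] by blast
  hence "\<rho> \<ge> 0" using \<rho>(1) by simp
  have "mult_le (adjs {0} hs) (?N - c) \<rho>" unfolding I by (rule mult_le_quot_degree[OF graded dim(2,1) \<rho>(1)])
  from mult_le_adjs[OF graded_ideal_zero hs(1) e \<open>\<rho> \<ge> 0\<close> this]
  have "mult_le ({0} :: ('n, 'k) mpoly set) (?N - c + c) (\<rho> / real e ^ c)" by (simp only: hs(2))
  from mult_le_zero(2)[OF this] growth_le_height(2)[OF graded height] have "1 \<le> \<rho> / real e ^ c" by simp
  thus False using \<rho>(2) e by (simp add: field_simps)
qed

end

theorem proposition6p4:
  fixes I :: "('n::finite, 'k::field) mpoly set" and c e :: nat
  assumes "I \<noteq> {0}"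
    and "graded_ideal I"
    and "unmixed I"
    and "ideal_height I = enat c"
    and "e \<ge> 2"
    and "min_generated_in_degree e I"
    and "\<forall>P\<in>ass_primes I. generated_by_linear_forms P"
  shows "hyp I 1 \<le> real e ^ (c - 1) \<and>
    delta I 1 \<ge> quot_degree I - real e ^ (c - 1) \<and>
    (complete_intersection I \<longrightarrow> delta I 1 \<ge> real e ^ c - real e ^ (c - 1))"
proof -
  obtain G where G: "G \<subseteq> forms e" "ideal_gen G = I"
    using generated_in_degree[OF assms(2,6)] by blast
  have e: "e > 0" using assms(5) by simp
  have "hyp I 1 \<le> real e ^ (c - 1)" by (rule hyp_le[OF assms(1-4) e G assms(7)])
  moreover have "real e ^ c \<le> quot_degree I" if "complete_intersection I"
    by (rule complete_intersection_degree[OF assms(1-4) e G assms(7) that])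
  ultimately show ?thesis by (auto simp: delta_def)
qed

end
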